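(* Let $\mathsf{C}$ be a locally small category. Let $D:\mathsf{J}\to\mathsf{C}$ and $E:\mathsf{K}\to\mathsf{C}$ be small diagrams. The following conditions are equivalent. (1) The image presheaves $\mathrm{Im}\,D$ and $\mathrm{Im}\,E$ are naturally isomorphic. (2) For every locally small category $\mathsf{D}$ and every functor $F:\mathsf{C}\to\mathsf{D}$, the composite diagram $F\circ D:\mathsf{J}\to\mathsf{D}$ admits a colimit if and only if $F\circ E:\mathsf{K}\to\mathsf{D}$ does, and in that case the two colimits are isomorphic. (3) $D$ and $E$ are connected by a zigzag in $\mathsf{Cat}/\mathsf{C}$ such that all the arrows of the underlying zigzag $\mathsf{J}\leftrightsquigarrow\mathsf{K}$ in $\mathsf{Cat}$ are confinal functors.
   Context: A small diagram in $\mathsf{C}$ is a functor $D:\mathsf{J}\to\mathsf{C}$ with $\mathsf{J}$ a small category. Its image presheaf is the presheaf $\mathrm{Im}\,D=\mathrm{colim}_{J\in\mathsf{J}}\mathrm{Hom}_{\mathsf{C}}(-,DJ)$ on $\mathsf{C}$, i.e. the colimit in $[\mathsf{C}^{\mathrm{op}},\mathsf{Set}]$ of $D$ followed by the Yoneda embedding. A functor $F:\mathsf{A}\to\mathsf{B}$ is confinal if for every object $B$ of $\mathsf{B}$ the comma category $B/F$ is non-empty and connected. $\mathsf{Cat}$ is the category of small categories; $\mathsf{Cat}/\mathsf{C}$ has as objects functors $\mathsf{S}\to\mathsf{C}$ with $\mathsf{S}$ small (while $\mathsf{C}$ may be large) and as morphisms strictly commuting triangles over $\mathsf{C}$. A zigzag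 is a finite sequence of arrows, each pointing in either direction. *)

theory Defs
  imports "HOL-Library.FuncSet"
begin

unbundle cardinal_syntax

section \<open>Size\<close>

text \<open>
  A type \<open>'v\<close> plays the role of the class of all sets: the classes are the sets of type
  \<open>'v set\<close>, and a class is small, i.e. a set of the theory, iff its cardinality is smaller than
  that of the class of all sets. For the small classes to behave like the sets of ZFC, the
  cardinality of \<open>'v\<close> must be (strongly) inaccessible: uncountable, regular, and a strong limit.
  A category, possibly large, is one whose objects and arrows are elements of \<open>'v\<close>.
\<close>

definition small :: "'v set \<Rightarrow> bool" where
  "small A \<longleftrightarrow> |A| <o |UNIV :: 'v set|"

definition inaccessible :: "'v itself \<Rightarrow> bool" where
  "inaccessible (_ :: 'v itself) \<longleftrightarrow>
     natLeq <o |UNIV :: 'v set| \<and>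
     regularCard |UNIV :: 'v set| \<and>
     (\<forall>A :: 'v set. small A \<longrightarrow> |Pow A| <o |UNIV :: 'v set| )"


section \<open>Categories and functors\<close>

record ('o, 'm) category =
  Obj :: "'o set"
  Arr :: "'m set"
  Dom :: "'m \<Rightarrow> 'o"
  Cod :: "'m \<Rightarrow> 'o"
  Id :: "'o \<Rightarrow> 'm"
  Comp :: "'m \<Rightarrow> 'm \<Rightarrow> 'm"  \<comment> \<open>\<open>Comp C g f\<close> is \<open>g\<close> after \<open>f\<close>\<close>

definition hom :: "('o, 'm) category \<Rightarrow> 'o \<Rightarrow> 'o \<Rightarrow> 'm set" where
  "hom C X Y = {f \<in> Arr C. Dom C f = X \<and> Cod C f = Y}"

definition is_category :: "('o, 'm) category \<Rightarrow> bool" where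
  "is_category C \<longleftrightarrow>
     (\<forall>f\<in>Arr C. Dom C f \<in> Obj C \<and> Cod C f \<in> Obj C) \<and>
     (\<forall>X\<in>Obj C. Id C X \<in> hom C X X) \<and>
     (\<forall>f\<in>Arr C. \<forall>g\<in>Arr C. Dom C g = Cod C f \<longrightarrow> Comp C g f \<in> hom C (Dom C f) (Cod C g)) \<and>
     (\<forall>f\<in>Arr C. Comp C f (Id C (Dom C f)) = f \<and> Comp C (Id C (Cod C f)) f = f) \<and>
     (\<forall>f\<in>Arr C. \<forall>g\<in>Arr C. \<forall>h\<in>Arr C. Dom C g = Cod C f \<longrightarrow> Dom C h = Cod C g \<longrightarrow>
        Comp C h (Comp C g f) = Comp C (Comp C h g) f)"

definition locally_small :: "('o, 'v) category \<Rightarrow> bool" where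
  "locally_small C \<longleftrightarrow> is_category C \<and> (\<forall>X\<in>Obj C. \<forall>Y\<in>Obj C. small (hom C X Y))"

definition small_category :: "('v, 'v) category \<Rightarrow> bool" where
  "small_category C \<longleftrightarrow> is_category C \<and> small (Obj C) \<and> small (Arr C)"

definition iso_objects :: "('o, 'm) category \<Rightarrow> 'o \<Rightarrow> 'o \<Rightarrow> bool" where
  "iso_objects C X Y \<longleftrightarrow> X \<in> Obj C \<and> Y \<in> Obj C \<and>
     (\<exists>f\<in>hom C X Y. \<exists>g\<in>hom C Y X. Comp C g f = Id C X \<and> Comp C f g = Id C Y)"

definition op_cat :: "('o, 'm) category \<Rightarrow> ('o, 'm) category" where
  "op_cat C = \<lparr>Obj = Obj C, Arr = Arr C, Dom = Cod C, Cod = Dom C, Id = Id C,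
               Comp = (\<lambda>g f. Comp C f g)\<rparr>"

text \<open>\<open>equivclp\<close> of ``there is an arrow from X to Y'' is ``there is a zigzag from X to Y''.\<close>

definition connected_category :: "('o, 'm) category \<Rightarrow> bool" where
  "connected_category C \<longleftrightarrow>
     (\<forall>X\<in>Obj C. \<forall>Y\<in>Obj C. equivclp (\<lambda>X' Y'. hom C X' Y' \<noteq> {}) X Y)"

record ('o1, 'm1, 'o2, 'm2) cfunctor =
  ob_map :: "'o1 \<Rightarrow> 'o2"
  ar_map :: "'m1 \<Rightarrow> 'm2"

definition is_functor ::
  "('o1, 'm1) category \<Rightarrow> ('o2, 'm2) category \<Rightarrow> ('o1, 'm1, 'o2, 'm2) cfunctor \<Rightarrow> bool" where
  "is_functor A B F \<longleftrightarrow> is_category A \<and> is_category B \<and>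
     (\<forall>X\<in>Obj A. ob_map F X \<in> Obj B) \<and>
     (\<forall>f\<in>Arr A. ar_map F f \<in> hom B (ob_map F (Dom A f)) (ob_map F (Cod A f))) \<and>
     (\<forall>X\<in>Obj A. ar_map F (Id A X) = Id B (ob_map F X)) \<and>
     (\<forall>f\<in>Arr A. \<forall>g\<in>Arr A. Dom A g = Cod A f \<longrightarrow>
        ar_map F (Comp A g f) = Comp B (ar_map F g) (ar_map F f))"

definition comp_functor ::
  "('o2, 'm2, 'o3, 'm3) cfunctor \<Rightarrow> ('o1, 'm1, 'o2, 'm2) cfunctor \<Rightarrow> ('o1, 'm1, 'o3, 'm3) cfunctor"
  (infixl \<open>\<circ>\<^sub>F\<close> 55) where
  "G \<circ>\<^sub>F F = \<lparr>ob_map = ob_map G \<circ> ob_map F, ar_map = ar_map G \<circ> ar_map F\<rparr>"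

definition natural ::
  "('o1, 'm1) category \<Rightarrow> ('o2, 'm2) category \<Rightarrow> ('o1, 'm1, 'o2, 'm2) cfunctor \<Rightarrow>
   ('o1, 'm1, 'o2, 'm2) cfunctor \<Rightarrow> ('o1 \<Rightarrow> 'm2) \<Rightarrow> bool" where
  "natural A B F G \<alpha> \<longleftrightarrow>
     (\<forall>X\<in>Obj A. \<alpha> X \<in> hom B (ob_map F X) (ob_map G X)) \<and>
     (\<forall>f\<in>Arr A. Comp B (\<alpha> (Cod A f)) (ar_map F f) = Comp B (ar_map G f) (\<alpha> (Dom A f)))"

text \<open>
  In the functor category, functors and transformations are required to be extensional, so
  that equality in HOL is equality of functors and of transformations.
\<close>

definition functors ::
  "('o1, 'm1) category \<Rightarrow> ('o2, 'm2) category \<Rightarrow> ('o1, 'm1, 'o2, 'm2) cfunctor set" where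
  "functors A B = {F. is_functor A B F \<and>
     ob_map F \<in> extensional (Obj A) \<and> ar_map F \<in> extensional (Arr A)}"

type_synonym ('o1, 'm1, 'o2, 'm2) transformation =
  "('o1, 'm1, 'o2, 'm2) cfunctor \<times> ('o1, 'm1, 'o2, 'm2) cfunctor \<times> ('o1 \<Rightarrow> 'm2)"

definition functor_cat :: "('o1, 'm1) category \<Rightarrow> ('o2, 'm2) category \<Rightarrow>
    (('o1, 'm1, 'o2, 'm2) cfunctor, ('o1, 'm1, 'o2, 'm2) transformation) category" where
  "functor_cat A B =
     \<lparr>Obj = functors A B,
      Arr = {(F, G, \<alpha>). F \<in> functors A B \<and> G \<in> functors A B \<and> natural A B F G \<alpha> \<and>
                        \<alpha> \<in> extensional (Obj A)},
      Dom = (\<lambda>(F, G, \<alpha>). F),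
      Cod = (\<lambda>(F, G, \<alpha>). G),
      Id = (\<lambda>F. (F, F, \<lambda>X\<in>Obj A. Id B (ob_map F X))),
      Comp = (\<lambda>(G', H, \<beta>) (F, G, \<alpha>). (F, H, \<lambda>X\<in>Obj A. Comp B (\<beta> X) (\<alpha> X)))\<rparr>"


section \<open>Colimits\<close>

definition cocone ::
  "('o1, 'm1) category \<Rightarrow> ('o2, 'm2) category \<Rightarrow> ('o1, 'm1, 'o2, 'm2) cfunctor \<Rightarrow>
   'o2 \<Rightarrow> ('o1 \<Rightarrow> 'm2) \<Rightarrow> bool" where
  "cocone J C D X \<kappa> \<longleftrightarrow> X \<in> Obj C \<and>
     (\<forall>j\<in>Obj J. \<kappa> j \<in> hom C (ob_map D j) X) \<and>
     (\<forall>u\<in>Arr J. Comp C (\<kappa> (Cod J u)) (ar_map D u) = \<kappa> (Dom J u))"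

definition is_colimit ::
  "('o1, 'm1) category \<Rightarrow> ('o2, 'm2) category \<Rightarrow> ('o1, 'm1, 'o2, 'm2) cfunctor \<Rightarrow>
   'o2 \<Rightarrow> ('o1 \<Rightarrow> 'm2) \<Rightarrow> bool" where
  "is_colimit J C D X \<kappa> \<longleftrightarrow> cocone J C D X \<kappa> \<and>
     (\<forall>Y \<mu>. cocone J C D Y \<mu> \<longrightarrow>
        (\<exists>!h. h \<in> hom C X Y \<and> (\<forall>j\<in>Obj J. Comp C h (\<kappa> j) = \<mu> j)))"

definition is_colimit_object ::
  "('o1, 'm1) category \<Rightarrow> ('o2, 'm2) category \<Rightarrow> ('o1, 'm1, 'o2, 'm2) cfunctor \<Rightarrow> 'o2 \<Rightarrow> bool" where
  "is_colimit_object J C D X \<longleftrightarrow> (\<exists>\<kappa>. is_colimit J C D X \<kappa>)"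


type_synonym ('v, 'o, 'm) diagram = "('v, 'v) category \<times> ('v, 'v, 'o, 'm) cfunctor"

definition same_colimits :: "('v, 'v) category \<Rightarrow> ('v, 'v, 'v) diagram \<Rightarrow>
    ('v, 'v, 'v) diagram \<Rightarrow> bool" where
  "same_colimits C = (\<lambda>(J, D) (K, E).
     \<forall>(L :: ('v, 'v) category) (F :: ('v, 'v, 'v, 'v) cfunctor).
       locally_small L \<and> is_functor C L F \<longrightarrow>
         ((\<exists>X. is_colimit_object J L (F \<circ>\<^sub>F D) X) \<longleftrightarrow> (\<exists>Y. is_colimit_object K L (F \<circ>\<^sub>F E) Y)) \<and>
         (\<forall>X Y. is_colimit_object J L (F \<circ>\<^sub>F D) X \<longrightarrow> is_colimit_object K L (F \<circ>\<^sub>F E) Y \<longrightarrow>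
            iso_objects L X Y))"


section \<open>Presheaves and the Yoneda embedding\<close>

definition set_cat :: "('v set, 'v set \<times> 'v set \<times> ('v \<Rightarrow> 'v)) category" where
  "set_cat =
     \<lparr>Obj = {A. small A},
      Arr = {(A, B, f). small A \<and> small B \<and> f \<in> A \<rightarrow>\<^sub>E B},
      Dom = (\<lambda>(A, B, f). A),
      Cod = (\<lambda>(A, B, f). B),
      Id = (\<lambda>A. (A, A, \<lambda>x\<in>A. x)),
      Comp = (\<lambda>(B', C, g) (A, B, f). (A, C, compose A g f))\<rparr>"

type_synonym ('o, 'v) presheaf = "('o, 'v, 'v set, 'v set \<times> 'v set \<times> ('v \<Rightarrow> 'v)) cfunctor"
type_synonym ('o, 'v) presheaf_map =
  "('o, 'v, 'v set, 'v set \<times> 'v set \<times> ('v \<Rightarrow> 'v)) transformation"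

definition presheaf_cat ::
  "('o, 'v) category \<Rightarrow> (('o, 'v) presheaf, ('o, 'v) presheaf_map) category" where
  "presheaf_cat C = functor_cat (op_cat C) set_cat"

definition representable :: "('o, 'v) category \<Rightarrow> 'o \<Rightarrow> ('o, 'v) presheaf" where
  "representable C X =
     \<lparr>ob_map = (\<lambda>Y\<in>Obj C. hom C Y X),
      ar_map = (\<lambda>f\<in>Arr C. (hom C (Cod C f) X, hom C (Dom C f) X,
                            \<lambda>g\<in>hom C (Cod C f) X. Comp C g f))\<rparr>"

definition yoneda :: "('o, 'v) category \<Rightarrow>
    ('o, 'v, ('o, 'v) presheaf, ('o, 'v) presheaf_map) cfunctor" where
  "yoneda C =
     \<lparr>ob_map = representable C,
      ar_map = (\<lambda>h. (representable C (Dom C h), representable C (Cod C h),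
         \<lambda>Y\<in>Obj C. (hom C Y (Dom C h), hom C Y (Cod C h),
                      \<lambda>g\<in>hom C Y (Dom C h). Comp C h g)))\<rparr>"

text \<open>
  A chosen colimit, determined up to isomorphism; it exists by \<open>is_colimit_image_presheaf\<close> below.
\<close>

definition image_presheaf :: "('j, 'k) category \<Rightarrow> ('o, 'v) category \<Rightarrow>
    ('j, 'k, 'o, 'v) cfunctor \<Rightarrow> ('o, 'v) presheaf" where
  "image_presheaf J C D = (SOME P. is_colimit_object J (presheaf_cat C) (yoneda C \<circ>\<^sub>F D) P)"


section \<open>Confinal functors\<close>

text \<open>The comma category \<open>B/F\<close>: an object \<open>(X, f)\<close> is an arrow \<open>f: B \<rightarrow> F X\<close>.\<close>

definition comma_cat :: "('o1, 'm1) category \<Rightarrow> ('o2, 'm2) category \<Rightarrow>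
    ('o1, 'm1, 'o2, 'm2) cfunctor \<Rightarrow> 'o2 \<Rightarrow>
    ('o1 \<times> 'm2, ('o1 \<times> 'm2) \<times> ('o1 \<times> 'm2) \<times> 'm1) category" where
  "comma_cat A B F b =
     \<lparr>Obj = {(X, f). X \<in> Obj A \<and> f \<in> hom B b (ob_map F X)},
      Arr = {((X, f), (Y, g), u). X \<in> Obj A \<and> f \<in> hom B b (ob_map F X) \<and>
               Y \<in> Obj A \<and> g \<in> hom B b (ob_map F Y) \<and>
               u \<in> hom A X Y \<and> Comp B (ar_map F u) f = g},
      Dom = (\<lambda>(p, q, u). p),
      Cod = (\<lambda>(p, q, u). q),
      Id = (\<lambda>p. (p, p, Id A (fst p))),
      Comp = (\<lambda>(q', r, v) (p, q, u). (p, r, Comp A v u))\<rparr>"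

definition confinal :: "('o1, 'm1) category \<Rightarrow> ('o2, 'm2) category \<Rightarrow>
    ('o1, 'm1, 'o2, 'm2) cfunctor \<Rightarrow> bool" where
  "confinal A B F \<longleftrightarrow> is_functor A B F \<and>
     (\<forall>b\<in>Obj B. Obj (comma_cat A B F b) \<noteq> {} \<and> connected_category (comma_cat A B F b))"


section \<open>The category of small categories over C\<close>

definition small_diagram :: "('o, 'm) category \<Rightarrow> ('v, 'o, 'm) diagram \<Rightarrow> bool" where
  "small_diagram C = (\<lambda>(S, P). small_category S \<and> is_functor S C P)"

definition slice_arrow :: "('o, 'm) category \<Rightarrow> ('v, 'o, 'm) diagram \<Rightarrow> ('v, 'o, 'm) diagram \<Rightarrow>
    ('v, 'v, 'v, 'v) cfunctor \<Rightarrow> bool" where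
  "slice_arrow C = (\<lambda>(S, P) (T, Q) G.
     small_diagram C (S, P) \<and> small_diagram C (T, Q) \<and> is_functor S T G \<and>
     (\<forall>X\<in>Obj S. ob_map (Q \<circ>\<^sub>F G) X = ob_map P X) \<and>
     (\<forall>f\<in>Arr S. ar_map (Q \<circ>\<^sub>F G) f = ar_map P f))"

definition confinal_arrow :: "('o, 'm) category \<Rightarrow> ('v, 'o, 'm) diagram \<Rightarrow>
    ('v, 'o, 'm) diagram \<Rightarrow> bool" where
  "confinal_arrow C SP TQ \<longleftrightarrow> (\<exists>G. slice_arrow C SP TQ G \<and> confinal (fst SP) (fst TQ) G)"

definition confinal_zigzag :: "('o, 'm) category \<Rightarrow> ('v, 'o, 'm) diagram \<Rightarrow>
    ('v, 'o, 'm) diagram \<Rightarrow> bool" where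
  "confinal_zigzag C = equivclp (confinal_arrow C)"


section \<open>Well-definedness\<close>

lemma is_category_op_cat: "is_category C \<Longrightarrow> is_category (op_cat C)"
  unfolding is_category_def op_cat_def hom_def by auto

lemma is_category_set_cat: "is_category set_cat"
  unfolding is_category_def set_cat_def hom_def
  by (auto simp: compose_def restrict_def PiE_def Pi_def extensional_def fun_eq_iff)

lemma hom_set_cat:
  "(A, B, f) \<in> hom set_cat X Y \<longleftrightarrow> A = X \<and> B = Y \<and> small X \<and> small Y \<and> f \<in> X \<rightarrow>\<^sub>E Y"
  unfolding set_cat_def hom_def by auto

lemma hom_functor_cat:
  "(F, G, \<alpha>) \<in> hom (functor_cat A B) X Y \<longleftrightarrow> F = X \<and> G = Y \<and>
     X \<in> functors A B \<and> Y \<in> functors A B \<and> natural A B X Y \<alpha> \<and> \<alpha> \<in> extensional (Obj A)"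
  unfolding functor_cat_def hom_def by auto

lemma is_category_functor_cat:
  assumes A: "is_category A" and B: "is_category B"
  shows "is_category (functor_cat A B)"
proof -
  have B_comp: "Comp B g f \<in> hom B X Z" if "f \<in> hom B X Y" "g \<in> hom B Y Z" for f g X Y Z
    using B that unfolding is_category_def hom_def by auto
  have B_assoc: "Comp B h (Comp B g f) = Comp B (Comp B h g) f"
    if "f \<in> hom B X Y" "g \<in> hom B Y Z" "h \<in> hom B Z W" for f g h X Y Z W
    using B that unfolding is_category_def hom_def by auto
  have B_id: "Comp B f (Id B X) = f" "Comp B (Id B Y) f = f" if "f \<in> hom B X Y" for f X Y
    using B that unfolding is_category_def hom_def by auto
  have A_ob: "Dom A f \<in> Obj A" "Cod A f \<in> Obj A" if "f \<in> Arr A" for f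
    using A that unfolding is_category_def by auto
  have comp: "natural A B F H (\<lambda>X\<in>Obj A. Comp B (\<beta> X) (\<alpha> X))"
    if F: "is_functor A B F" and G: "is_functor A B G" and H: "is_functor A B H"
      and \<alpha>: "natural A B F G \<alpha>" and \<beta>: "natural A B G H \<beta>" for F G H \<alpha> \<beta>
    unfolding natural_def
  proof (intro conjI ballI)
    fix X assume "X \<in> Obj A"
    then show "(\<lambda>X\<in>Obj A. Comp B (\<beta> X) (\<alpha> X)) X \<in> hom B (ob_map F X) (ob_map H X)"
      using \<alpha> \<beta> B_comp unfolding natural_def by auto
  next
    fix f assume f: "f \<in> Arr A"
    let ?X = "Dom A f" and ?Y = "Cod A f"
    have t: "\<alpha> ?X \<in> hom B (ob_map F ?X) (ob_map G ?X)" "\<alpha> ?Y \<in> hom B (ob_map F ?Y) (ob_map G ?Y)"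
      "\<beta> ?X \<in> hom B (ob_map G ?X) (ob_map H ?X)" "\<beta> ?Y \<in> hom B (ob_map G ?Y) (ob_map H ?Y)"
      using \<alpha> \<beta> A_ob[OF f] unfolding natural_def by auto
    have m: "ar_map F f \<in> hom B (ob_map F ?X) (ob_map F ?Y)"
      "ar_map G f \<in> hom B (ob_map G ?X) (ob_map G ?Y)"
      "ar_map H f \<in> hom B (ob_map H ?X) (ob_map H ?Y)"
      using F G H f unfolding is_functor_def by auto
    have "Comp B (Comp B (\<beta> ?Y) (\<alpha> ?Y)) (ar_map F f) = Comp B (\<beta> ?Y) (Comp B (\<alpha> ?Y) (ar_map F f))"
      using B_assoc[OF m(1) t(2,4)] by simp
    also have "\<dots> = Comp B (\<beta> ?Y) (Comp B (ar_map G f) (\<alpha> ?X))"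
      using \<alpha> f unfolding natural_def by simp
    also have "\<dots> = Comp B (Comp B (\<beta> ?Y) (ar_map G f)) (\<alpha> ?X)"
      using B_assoc[OF t(1) m(2) t(4)] .
    also have "\<dots> = Comp B (Comp B (ar_map H f) (\<beta> ?X)) (\<alpha> ?X)"
      using \<beta> f unfolding natural_def by simp
    also have "\<dots> = Comp B (ar_map H f) (Comp B (\<beta> ?X) (\<alpha> ?X))"
      using B_assoc[OF t(1,3) m(3)] by simp
    finally show "Comp B ((\<lambda>X\<in>Obj A. Comp B (\<beta> X) (\<alpha> X)) ?Y) (ar_map F f) =
        Comp B (ar_map H f) ((\<lambda>X\<in>Obj A. Comp B (\<beta> X) (\<alpha> X)) ?X)"
      using A_ob[OF f] by simp
  qed
  have id: "natural A B F F (\<lambda>X\<in>Obj A. Id B (ob_map F X))" if F: "is_functor A B F" for F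
    unfolding natural_def
  proof (intro conjI ballI)
    fix X assume "X \<in> Obj A"
    then show "(\<lambda>X\<in>Obj A. Id B (ob_map F X)) X \<in> hom B (ob_map F X) (ob_map F X)"
      using F B unfolding is_functor_def is_category_def by simp
  next
    fix f assume f: "f \<in> Arr A"
    then have "ar_map F f \<in> hom B (ob_map F (Dom A f)) (ob_map F (Cod A f))"
      using F unfolding is_functor_def by simp
    then show "Comp B ((\<lambda>X\<in>Obj A. Id B (ob_map F X)) (Cod A f)) (ar_map F f) =
        Comp B (ar_map F f) ((\<lambda>X\<in>Obj A. Id B (ob_map F X)) (Dom A f))"
      using A_ob[OF f] B_id by simp
  qed
  have ext: "(\<lambda>X\<in>Obj A. \<gamma> X) = \<alpha>"
    if "\<alpha> \<in> extensional (Obj A)" "\<And>X. X \<in> Obj A \<Longrightarrow> \<gamma> X = \<alpha> X" for \<alpha> \<gamma> :: "_ \<Rightarrow> _"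
    using that by (auto simp: extensional_def restrict_def fun_eq_iff)
  show ?thesis
    unfolding is_category_def
  proof (intro conjI ballI impI)
    fix f g h
    assume f: "f \<in> Arr (functor_cat A B)" and g: "g \<in> Arr (functor_cat A B)"
      and h: "h \<in> Arr (functor_cat A B)"
      and gf: "Dom (functor_cat A B) g = Cod (functor_cat A B) f"
      and hg: "Dom (functor_cat A B) h = Cod (functor_cat A B) g"
    obtain F G H K \<alpha> \<beta> \<gamma> where e: "f = (F, G, \<alpha>)" "g = (G, H, \<beta>)" "h = (H, K, \<gamma>)"
      using gf hg by (cases f; cases g; cases h) (auto simp: functor_cat_def)
    have n: "natural A B F G \<alpha>" "natural A B G H \<beta>" "natural A B H K \<gamma>"
      using f g h unfolding e functor_cat_def by auto
    have "Comp B (\<gamma> X) (Comp B (\<beta> X) (\<alpha> X)) = Comp B (Comp B (\<gamma> X) (\<beta> X)) (\<alpha> X)"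
      if "X \<in> Obj A" for X
      using n that B_assoc unfolding natural_def by blast
    then show "Comp (functor_cat A B) h (Comp (functor_cat A B) g f) =
        Comp (functor_cat A B) (Comp (functor_cat A B) h g) f"
      by (auto simp: e functor_cat_def restrict_def fun_eq_iff)
  next
    fix f g assume f: "f \<in> Arr (functor_cat A B)" and g: "g \<in> Arr (functor_cat A B)"
      and gf: "Dom (functor_cat A B) g = Cod (functor_cat A B) f"
    then show "Comp (functor_cat A B) g f
        \<in> hom (functor_cat A B) (Dom (functor_cat A B) f) (Cod (functor_cat A B) g)"
      by (auto simp: functor_cat_def hom_def functors_def intro: comp)
  next
    fix f assume "f \<in> Arr (functor_cat A B)"
    then show "Comp (functor_cat A B) f (Id (functor_cat A B) (Dom (functor_cat A B) f)) = f"
      "Comp (functor_cat A B) (Id (functor_cat A B) (Cod (functor_cat A B) f)) f = f"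
      by (auto simp: functor_cat_def natural_def B_id intro!: ext)
  qed (auto simp: functor_cat_def hom_def functors_def intro: id)
qed

lemma is_category_presheaf_cat: "is_category C \<Longrightarrow> is_category (presheaf_cat C)"
  unfolding presheaf_cat_def
  by (intro is_category_functor_cat is_category_op_cat is_category_set_cat)

lemma representable_in_functors:
  assumes C: "locally_small C" and X: "X \<in> Obj C"
  shows "representable C X \<in> functors (op_cat C) set_cat"
proof -
  have cat: "is_category C" and sm: "\<And>X Y. X \<in> Obj C \<Longrightarrow> Y \<in> Obj C \<Longrightarrow> small (hom C X Y)"
    using C unfolding locally_small_def by auto
  have c: "Comp C g f \<in> hom C Y W" if "f \<in> hom C Y Z" "g \<in> hom C Z W" for f g Y Z W
    using cat that unfolding is_category_def hom_def by auto
  have a: "Comp C h (Comp C g f) = Comp C (Comp C h g) f"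
    if "f \<in> hom C Y Z" "g \<in> hom C Z W" "h \<in> hom C W V" for f g h Y Z W V
    using cat that unfolding is_category_def hom_def by auto
  have i: "Comp C f (Id C Y) = f" if "f \<in> hom C Y Z" for f Y Z
    using cat that unfolding is_category_def hom_def by auto
  have ob: "Dom C f \<in> Obj C" "Cod C f \<in> Obj C" "f \<in> hom C (Dom C f) (Cod C f)"
    if "f \<in> Arr C" for f
    using cat that unfolding is_category_def hom_def by auto
  have id: "Id C Y \<in> Arr C" "Dom C (Id C Y) = Y" "Cod C (Id C Y) = Y" if "Y \<in> Obj C" for Y
    using cat that unfolding is_category_def hom_def by auto
  have cc: "Comp C g f \<in> Arr C" "Dom C (Comp C g f) = Dom C f" "Cod C (Comp C g f) = Cod C g"
    if "f \<in> Arr C" "g \<in> Arr C" "Dom C g = Cod C f" for f g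
    using cat that unfolding is_category_def hom_def by auto
  let ?R = "representable C X"
  have "is_functor (op_cat C) set_cat ?R"
    unfolding is_functor_def
  proof (intro conjI ballI impI)
    show "is_category (op_cat C)" using is_category_op_cat[OF cat] .
    show "is_category set_cat" by (rule is_category_set_cat)
    fix Y assume "Y \<in> Obj (op_cat C)"
    then have Y: "Y \<in> Obj C" by (simp add: op_cat_def)
    show "ob_map ?R Y \<in> Obj set_cat"
      using Y X sm by (simp add: representable_def set_cat_def)
    show "ar_map ?R (Id (op_cat C) Y) = Id set_cat (ob_map ?R Y)"
      using Y id[OF Y] i by (auto simp: representable_def set_cat_def op_cat_def restrict_def fun_eq_iff)
  next
    fix f assume "f \<in> Arr (op_cat C)"
    then have f: "f \<in> Arr C" by (simp add: op_cat_def)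
    show "ar_map ?R f \<in> hom set_cat (ob_map ?R (Dom (op_cat C) f)) (ob_map ?R (Cod (op_cat C) f))"
      using f ob[OF f] X sm c by (auto simp: representable_def op_cat_def hom_set_cat)
    fix g assume "g \<in> Arr (op_cat C)" and "Dom (op_cat C) g = Cod (op_cat C) f"
    then have g: "g \<in> Arr C" and gf: "Dom C f = Cod C g" by (simp_all add: op_cat_def)
    show "ar_map ?R (Comp (op_cat C) g f) = Comp set_cat (ar_map ?R g) (ar_map ?R f)"
      using f g gf cc[OF g f gf] a[OF ob(3)[OF g]] ob(3)[OF f] c
      by (auto simp: representable_def set_cat_def op_cat_def compose_def restrict_def fun_eq_iff)
  qed
  then show ?thesis
    by (simp add: functors_def representable_def op_cat_def)
qed

lemma is_functor_yoneda:
  assumes C: "locally_small C"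
  shows "is_functor C (presheaf_cat C) (yoneda C)"
proof -
  have cat: "is_category C" and sm: "\<And>X Y. X \<in> Obj C \<Longrightarrow> Y \<in> Obj C \<Longrightarrow> small (hom C X Y)"
    using C unfolding locally_small_def by auto
  have c: "Comp C g f \<in> hom C Y W" if "f \<in> hom C Y Z" "g \<in> hom C Z W" for f g Y Z W
    using cat that unfolding is_category_def hom_def by auto
  have a: "Comp C h (Comp C g f) = Comp C (Comp C h g) f"
    if "f \<in> hom C Y Z" "g \<in> hom C Z W" "h \<in> hom C W V" for f g h Y Z W V
    using cat that unfolding is_category_def hom_def by auto
  have i: "Comp C (Id C Z) f = f" if "f \<in> hom C Y Z" for f Y Z
    using cat that unfolding is_category_def hom_def by auto
  have ob: "Dom C f \<in> Obj C" "Cod C f \<in> Obj C" "f \<in> hom C (Dom C f) (Cod C f)"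
    if "f \<in> Arr C" for f
    using cat that unfolding is_category_def hom_def by auto
  have id: "Id C Y \<in> Arr C" "Dom C (Id C Y) = Y" "Cod C (Id C Y) = Y" if "Y \<in> Obj C" for Y
    using cat that unfolding is_category_def hom_def by auto
  have cc: "Comp C g f \<in> Arr C" "Dom C (Comp C g f) = Dom C f" "Cod C (Comp C g f) = Cod C g"
    if "f \<in> Arr C" "g \<in> Arr C" "Dom C g = Cod C f" for f g
    using cat that unfolding is_category_def hom_def by auto
  have rep: "representable C X \<in> functors (op_cat C) set_cat" if "X \<in> Obj C" for X
    using representable_in_functors[OF C that] .
  show ?thesis
    unfolding is_functor_def
  proof (intro conjI ballI impI)
    show "is_category C" by (rule cat)
    show "is_category (presheaf_cat C)" using is_category_presheaf_cat[OF cat] .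
    fix X assume X: "X \<in> Obj C"
    show "ob_map (yoneda C) X \<in> Obj (presheaf_cat C)"
      using rep[OF X] by (simp add: yoneda_def presheaf_cat_def functor_cat_def)
    show "ar_map (yoneda C) (Id C X) = Id (presheaf_cat C) (ob_map (yoneda C) X)"
      using id[OF X] i
      by (auto simp: yoneda_def presheaf_cat_def functor_cat_def representable_def set_cat_def
          op_cat_def restrict_def fun_eq_iff)
  next
    fix f assume f: "f \<in> Arr C"
    have "natural (op_cat C) set_cat (representable C (Dom C f)) (representable C (Cod C f))
        (\<lambda>Y\<in>Obj C. (hom C Y (Dom C f), hom C Y (Cod C f), \<lambda>g\<in>hom C Y (Dom C f). Comp C f g))"
      unfolding natural_def
    proof (intro conjI ballI)
      fix Y assume "Y \<in> Obj (op_cat C)"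
      then have "Y \<in> Obj C" by (simp add: op_cat_def)
      then show "(\<lambda>Y\<in>Obj C. (hom C Y (Dom C f), hom C Y (Cod C f), \<lambda>g\<in>hom C Y (Dom C f). Comp C f g)) Y
        \<in> hom set_cat (ob_map (representable C (Dom C f)) Y) (ob_map (representable C (Cod C f)) Y)"
        using ob[OF f] sm c by (auto simp: representable_def hom_set_cat)
    next
      fix k assume "k \<in> Arr (op_cat C)"
      then have k: "k \<in> Arr C" by (simp add: op_cat_def)
      show "Comp set_cat ((\<lambda>Y\<in>Obj C. (hom C Y (Dom C f), hom C Y (Cod C f),
            \<lambda>g\<in>hom C Y (Dom C f). Comp C f g)) (Cod (op_cat C) k))
          (ar_map (representable C (Dom C f)) k) =
        Comp set_cat (ar_map (representable C (Cod C f)) k)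
          ((\<lambda>Y\<in>Obj C. (hom C Y (Dom C f), hom C Y (Cod C f),
            \<lambda>g\<in>hom C Y (Dom C f). Comp C f g)) (Dom (op_cat C) k))"
        using k ob[OF k] ob[OF f] c a
        by (auto simp: representable_def set_cat_def op_cat_def compose_def restrict_def fun_eq_iff)
    qed
    then show "ar_map (yoneda C) f
        \<in> hom (presheaf_cat C) (ob_map (yoneda C) (Dom C f)) (ob_map (yoneda C) (Cod C f))"
      using rep ob[OF f]
      by (simp add: yoneda_def presheaf_cat_def hom_functor_cat op_cat_def)
    fix g assume g: "g \<in> Arr C" and gf: "Dom C g = Cod C f"
    show "ar_map (yoneda C) (Comp C g f) =
        Comp (presheaf_cat C) (ar_map (yoneda C) g) (ar_map (yoneda C) f)"
      using cc[OF f g gf] gf ob[OF f] ob[OF g] c a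
      by (auto simp: yoneda_def presheaf_cat_def functor_cat_def set_cat_def op_cat_def
          compose_def restrict_def fun_eq_iff)
  qed
qed

lemma is_colimit_image_presheaf:
  fixes C :: "('o, 'v) category" and J :: "('v, 'v) category"
  assumes U: "inaccessible TYPE('v)" and C: "locally_small C"
    and J: "small_category J" and D: "is_functor J C D"
  shows "is_colimit_object J (presheaf_cat C) (yoneda C \<circ>\<^sub>F D) (image_presheaf J C D)"
proof -
  have cat: "is_category C" and sm: "\<And>X Y. X \<in> Obj C \<Longrightarrow> Y \<in> Obj C \<Longrightarrow> small (hom C X Y)"
    using C unfolding locally_small_def by auto
  have c: "Comp C g f \<in> hom C Y W" if "f \<in> hom C Y Z" "g \<in> hom C Z W" for f g Y Z W
    using cat that unfolding is_category_def hom_def by auto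
  have a: "Comp C h (Comp C g f) = Comp C (Comp C h g) f"
    if "f \<in> hom C Y Z" "g \<in> hom C Z W" "h \<in> hom C W V" for f g h Y Z W V
    using cat that unfolding is_category_def hom_def by auto
  have idr: "Comp C f (Id C Y) = f" if "f \<in> hom C Y Z" for f Y Z
    using cat that unfolding is_category_def hom_def by auto
  have ob: "Dom C f \<in> Obj C" "Cod C f \<in> Obj C" "f \<in> hom C (Dom C f) (Cod C f)"
    if "f \<in> Arr C" for f
    using cat that unfolding is_category_def hom_def by auto
  have id: "Id C Y \<in> Arr C" "Dom C (Id C Y) = Y" "Cod C (Id C Y) = Y" "Id C Y \<in> hom C Y Y"
    if "Y \<in> Obj C" for Y
    using cat that unfolding is_category_def hom_def by auto
  have cc: "Comp C g f \<in> Arr C" "Dom C (Comp C g f) = Dom C f" "Cod C (Comp C g f) = Cod C g"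
    if "f \<in> Arr C" "g \<in> Arr C" "Dom C g = Cod C f" for f g
    using cat that unfolding is_category_def hom_def by auto
  have obJ: "Dom J u \<in> Obj J" "Cod J u \<in> Obj J" if "u \<in> Arr J" for u
    using J that unfolding small_category_def is_category_def by auto
  have D_ob: "ob_map D j \<in> Obj C" if "j \<in> Obj J" for j
    using D that unfolding is_functor_def by auto
  have D_ar: "ar_map D u \<in> hom C (ob_map D (Dom J u)) (ob_map D (Cod J u))" if "u \<in> Arr J" for u
    using D that unfolding is_functor_def by auto

  have inf: "infinite (UNIV :: 'v set)"
    using U unfolding inaccessible_def
    by (meson infinite_iff_natLeq_ordLeq ordLess_imp_ordLeq)
  have stab: "stable |UNIV :: 'v set|"
    using U inf unfolding inaccessible_def by (intro regularCard_stable) (auto simp: card_of_card_order_on Field_card_of)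
  obtain enc :: "'v \<times> 'v \<Rightarrow> 'v" where enc: "inj enc"
    using card_of_Times_same_infinite[OF inf] card_of_ordIso[of "UNIV \<times> UNIV :: ('v \<times> 'v) set" "UNIV :: 'v set"]
    by (auto simp: bij_betw_def)

  define E where "E X = (SIGMA j : Obj J. hom C X (ob_map D j))" for X
  define r where "r X e e' \<longleftrightarrow> (\<exists>u\<in>Arr J. fst e = Dom J u \<and> fst e' = Cod J u \<and>
    snd e \<in> hom C X (ob_map D (Dom J u)) \<and> snd e' = Comp C (ar_map D u) (snd e))" for X e e'
  define cl where "cl X e = enc (SOME e'. equivclp (r X) e e')" for X e
  have cl_iff: "cl X e = cl X e' \<longleftrightarrow> equivclp (r X) e e'" for X e e'
  proof
    assume "equivclp (r X) e e'"
    then have "equivclp (r X) e = equivclp (r X) e'"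
      by (meson equivp_def equivp_evquivclp)
    then show "cl X e = cl X e'" by (simp add: cl_def)
  next
    assume "cl X e = cl X e'"
    then have "(SOME s. equivclp (r X) e s) = (SOME s. equivclp (r X) e' s)"
      using enc unfolding cl_def by (auto dest: injD)
    moreover have "equivclp (r X) e (SOME s. equivclp (r X) e s)" for e
      by (rule someI[of _ e]) simp
    ultimately show "equivclp (r X) e e'"
      by (metis equivclp_sym equivclp_trans)
  qed
  have r_cl: "cl X (Cod J u, Comp C (ar_map D u) f) = cl X (Dom J u, f)"
    if "u \<in> Arr J" "f \<in> hom C X (ob_map D (Dom J u))" for X u f
  proof -
    have "r X (Dom J u, f) (Cod J u, Comp C (ar_map D u) f)" using that unfolding r_def by auto
    then have "cl X (Dom J u, f) = cl X (Cod J u, Comp C (ar_map D u) f)"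
      unfolding cl_iff by (rule r_into_equivclp)
    then show ?thesis by simp
  qed
  define lift :: "'o \<Rightarrow> ('v \<times> 'v \<Rightarrow> 'v) \<Rightarrow> 'v \<Rightarrow> 'v"
    where "lift X \<phi> = (\<lambda>p\<in>cl X ` E X. \<phi> (SOME e. e \<in> E X \<and> cl X e = p))" for X \<phi>
  have lift: "lift X \<phi> (cl X e) = \<phi> e"
    if e: "e \<in> E X" and \<phi>: "\<And>e e'. r X e e' \<Longrightarrow> \<phi> e = \<phi> e'" for X \<phi> e
  proof -
    have inv: "\<phi> x = \<phi> y" if "equivclp (r X) x y" for x y
      using that by (induction rule: equivclp_induct) (auto dest: \<phi>)
    let ?s = "SOME e'. e' \<in> E X \<and> cl X e' = cl X e"
    have "?s \<in> E X \<and> cl X ?s = cl X e"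
      by (rule someI[of _ e]) (use e in simp)
    then have "\<phi> ?s = \<phi> e" using inv cl_iff by blast
    then show ?thesis using e unfolding lift_def by simp
  qed
  have lift_ext: "lift X \<phi> \<in> extensional (cl X ` E X)" for X \<phi>
    by (simp add: lift_def)
  have small_E: "small (cl X ` E X)" if X: "X \<in> Obj C" for X
  proof -
    have "|E X| <o |UNIV :: 'v set|"
      using stab[unfolded stable_def, rule_format, of "Obj J" "\<lambda>j. hom C X (ob_map D j)"]
        J sm[OF X D_ob] by (simp add: E_def small_category_def small_def)
    then show ?thesis
      unfolding small_def using card_of_image ordLeq_ordLess_trans by blast
  qed

  define pre where "pre X h = (\<lambda>(j, f). cl X (j :: 'v, Comp C f h))" for X h
  define P :: "('o, 'v) presheaf" where
    "P = \<lparr>ob_map = (\<lambda>X\<in>Obj C. cl X ` E X),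
          ar_map = (\<lambda>h\<in>Arr C. (cl (Cod C h) ` E (Cod C h), cl (Dom C h) ` E (Dom C h),
                       lift (Cod C h) (pre (Dom C h) h)))\<rparr>"
  have pre_r: "pre (Dom C h) h e = pre (Dom C h) h e'" if h: "h \<in> Arr C" and "r (Cod C h) e e'" for h e e'
  proof -
    obtain u f where u: "u \<in> Arr J" "e = (Dom J u, f)" "e' = (Cod J u, Comp C (ar_map D u) f)"
      "f \<in> hom C (Cod C h) (ob_map D (Dom J u))"
      using \<open>r (Cod C h) e e'\<close> unfolding r_def by (cases e; cases e') auto
    have "Comp C (Comp C (ar_map D u) f) h = Comp C (ar_map D u) (Comp C f h)"
      using a[OF ob(3)[OF h] u(4) D_ar[OF u(1)]] by simp
    then show ?thesis
      using r_cl[OF u(1) c[OF ob(3)[OF h] u(4)]] u by (simp add: pre_def)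
  qed
  have pre_lift: "lift (Cod C h) (pre (Dom C h) h) (cl (Cod C h) (j, f)) = cl (Dom C h) (j, Comp C f h)"
    if h: "h \<in> Arr C" and "(j, f) \<in> E (Cod C h)" for h j f
    using lift[OF that(2), of "pre (Dom C h) h"] pre_r[OF h] by (simp add: pre_def)
  have E_comp: "(j, Comp C f h) \<in> E (Dom C h)" if "h \<in> Arr C" "(j, f) \<in> E (Cod C h)" for h j f
    using that(2) c[OF ob(3)[OF that(1)]] unfolding E_def by auto
  have "is_functor (op_cat C) set_cat P"
    unfolding is_functor_def
  proof (intro conjI ballI impI)
    show "is_category (op_cat C)" using is_category_op_cat[OF cat] .
    show "is_category set_cat" by (rule is_category_set_cat)
    fix X assume "X \<in> Obj (op_cat C)"
    then have X: "X \<in> Obj C" by (simp add: op_cat_def)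
    show "ob_map P X \<in> Obj set_cat" using small_E[OF X] X by (simp add: P_def set_cat_def)
    have "lift X (pre X (Id C X)) = (\<lambda>x\<in>cl X ` E X. x)"
    proof (rule extensionalityI[where A = "cl X ` E X"])
      fix x assume "x \<in> cl X ` E X"
      then obtain j f where x: "x = cl X (j, f)" "(j, f) \<in> E X" by auto
      then have "Comp C f (Id C X) = f" using idr unfolding E_def by auto
      then show "lift X (pre X (Id C X)) x = (\<lambda>x\<in>cl X ` E X. x) x"
        using pre_lift[of "Id C X" j f] id[OF X] x by simp
    qed (auto simp: lift_ext)
    then show "ar_map P (Id (op_cat C) X) = Id set_cat (ob_map P X)"
      using id[OF X] X by (simp add: P_def set_cat_def op_cat_def)
  next
    fix f assume "f \<in> Arr (op_cat C)"
    then have f: "f \<in> Arr C" by (simp add: op_cat_def)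
    have "lift (Cod C f) (pre (Dom C f) f) \<in> cl (Cod C f) ` E (Cod C f) \<rightarrow>\<^sub>E cl (Dom C f) ` E (Dom C f)"
      using lift_ext pre_lift[OF f] E_comp[OF f] by (auto simp: PiE_def)
    then show "ar_map P f \<in> hom set_cat (ob_map P (Dom (op_cat C) f)) (ob_map P (Cod (op_cat C) f))"
      using f ob[OF f] small_E by (simp add: P_def op_cat_def hom_set_cat)
    fix g assume "g \<in> Arr (op_cat C)" and "Dom (op_cat C) g = Cod (op_cat C) f"
    then have g: "g \<in> Arr C" and fg: "Dom C f = Cod C g" by (simp_all add: op_cat_def)
    note cfg = cc[OF g f fg]
    have "lift (Cod C f) (pre (Dom C g) (Comp C f g)) =
      compose (cl (Cod C f) ` E (Cod C f)) (lift (Cod C g) (pre (Dom C g) g)) (lift (Cod C f) (pre (Dom C f) f))"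
    proof (rule extensionalityI[where A = "cl (Cod C f) ` E (Cod C f)"])
      fix x assume "x \<in> cl (Cod C f) ` E (Cod C f)"
      then obtain j k where x: "x = cl (Cod C f) (j, k)" "(j, k) \<in> E (Cod C f)" by auto
      have k: "k \<in> hom C (Cod C f) (ob_map D j)" using x(2) by (simp add: E_def)
      have g': "g \<in> hom C (Dom C g) (Dom C f)" using ob(3)[OF g] fg by simp
      have "Comp C k (Comp C f g) = Comp C (Comp C k f) g"
        using a[OF g' ob(3)[OF f] k] .
      then show "lift (Cod C f) (pre (Dom C g) (Comp C f g)) x =
        compose (cl (Cod C f) ` E (Cod C f)) (lift (Cod C g) (pre (Dom C g) g)) (lift (Cod C f) (pre (Dom C f) f)) x"
        using pre_lift[of "Comp C f g" j k] cfg pre_lift[OF f x(2)] pre_lift[OF g, of j "Comp C k f"]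
          E_comp[OF f x(2)] x fg by (simp add: compose_eq)
    qed (auto simp: lift_ext)
    then show "ar_map P (Comp (op_cat C) g f) = Comp set_cat (ar_map P g) (ar_map P f)"
      using f g fg cfg by (simp add: P_def op_cat_def set_cat_def)
  qed
  then have P: "P \<in> functors (op_cat C) set_cat"
    by (simp add: functors_def P_def op_cat_def)

  define \<kappa> :: "'v \<Rightarrow> ('o, 'v) presheaf_map" where
    "\<kappa> j = (representable C (ob_map D j), P, \<lambda>X\<in>Obj C. (hom C X (ob_map D j), cl X ` E X,
              \<lambda>f\<in>hom C X (ob_map D j). cl X (j, f)))" for j
  have nat\<kappa>: "natural (op_cat C) set_cat (representable C (ob_map D j)) P
      (\<lambda>X\<in>Obj C. (hom C X (ob_map D j), cl X ` E X, \<lambda>f\<in>hom C X (ob_map D j). cl X (j, f)))"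
    if j: "j \<in> Obj J" for j
    unfolding natural_def
  proof (intro conjI ballI)
    fix X assume "X \<in> Obj (op_cat C)"
    then have X: "X \<in> Obj C" by (simp add: op_cat_def)
    then show "(\<lambda>X\<in>Obj C. (hom C X (ob_map D j), cl X ` E X, \<lambda>f\<in>hom C X (ob_map D j). cl X (j, f))) X
      \<in> hom set_cat (ob_map (representable C (ob_map D j)) X) (ob_map P X)"
      using j sm[OF X D_ob[OF j]] small_E[OF X]
      by (auto simp: hom_set_cat representable_def P_def E_def)
  next
    fix h assume "h \<in> Arr (op_cat C)"
    then have h: "h \<in> Arr C" by (simp add: op_cat_def)
    have 1: "Comp C f h \<in> hom C (Dom C h) (ob_map D j)" if "f \<in> hom C (Cod C h) (ob_map D j)" for f
      using c[OF ob(3)[OF h] that] .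
    have 2: "lift (Cod C h) (pre (Dom C h) h) (cl (Cod C h) (j, f)) = cl (Dom C h) (j, Comp C f h)"
      if "f \<in> hom C (Cod C h) (ob_map D j)" for f
      using pre_lift[OF h, of j f] that j by (simp add: E_def)
    show "Comp set_cat ((\<lambda>X\<in>Obj C. (hom C X (ob_map D j), cl X ` E X,
          \<lambda>f\<in>hom C X (ob_map D j). cl X (j, f))) (Cod (op_cat C) h))
        (ar_map (representable C (ob_map D j)) h) =
      Comp set_cat (ar_map P h) ((\<lambda>X\<in>Obj C. (hom C X (ob_map D j), cl X ` E X,
          \<lambda>f\<in>hom C X (ob_map D j). cl X (j, f))) (Dom (op_cat C) h))"
      using h ob[OF h] 1 2
      by (auto simp: set_cat_def op_cat_def representable_def P_def compose_def restrict_def fun_eq_iff)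
  qed
  have D_obs: "ob_map (yoneda C \<circ>\<^sub>F D) j = representable C (ob_map D j)" for j
    by (simp add: comp_functor_def yoneda_def)
  have cocone: "cocone J (presheaf_cat C) (yoneda C \<circ>\<^sub>F D) P \<kappa>"
    unfolding cocone_def
  proof (intro conjI ballI)
    show "P \<in> Obj (presheaf_cat C)" using P by (simp add: presheaf_cat_def functor_cat_def)
    fix j assume j: "j \<in> Obj J"
    show "\<kappa> j \<in> hom (presheaf_cat C) (ob_map (yoneda C \<circ>\<^sub>F D) j) P"
      using nat\<kappa>[OF j] P representable_in_functors[OF C D_ob[OF j]]
      unfolding \<kappa>_def presheaf_cat_def hom_functor_cat D_obs by (simp add: op_cat_def)
  next
    fix u assume u: "u \<in> Arr J"
    have Du: "Dom C (ar_map D u) = ob_map D (Dom J u)" "Cod C (ar_map D u) = ob_map D (Cod J u)"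
      using D_ar[OF u] by (auto simp: hom_def)
    show "Comp (presheaf_cat C) (\<kappa> (Cod J u)) (ar_map (yoneda C \<circ>\<^sub>F D) u) = \<kappa> (Dom J u)"
      using r_cl[OF u] c[OF _ D_ar[OF u]]
      by (auto simp: \<kappa>_def presheaf_cat_def functor_cat_def comp_functor_def yoneda_def Du
          set_cat_def op_cat_def compose_def restrict_def fun_eq_iff)
  qed
  have "\<exists>!h. h \<in> hom (presheaf_cat C) P Q \<and> (\<forall>j\<in>Obj J. Comp (presheaf_cat C) h (\<kappa> j) = \<mu> j)"
    if Q\<mu>: "cocone J (presheaf_cat C) (yoneda C \<circ>\<^sub>F D) Q \<mu>" for Q \<mu>
  proof -
    have Q: "Q \<in> functors (op_cat C) set_cat"
      using Q\<mu> by (simp add: cocone_def presheaf_cat_def functor_cat_def)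
    define m where "m j X = snd (snd (snd (snd (\<mu> j)) X))" for j X
    have \<mu>: "\<mu> j = (representable C (ob_map D j), Q, snd (snd (\<mu> j)))"
      "natural (op_cat C) set_cat (representable C (ob_map D j)) Q (snd (snd (\<mu> j)))"
      "snd (snd (\<mu> j)) \<in> extensional (Obj C)"
      if "j \<in> Obj J" for j
    proof -
      have "\<mu> j \<in> hom (presheaf_cat C) (representable C (ob_map D j)) Q"
        using Q\<mu> that unfolding cocone_def D_obs by blast
      then show "\<mu> j = (representable C (ob_map D j), Q, snd (snd (\<mu> j)))"
        "natural (op_cat C) set_cat (representable C (ob_map D j)) Q (snd (snd (\<mu> j)))"
        "snd (snd (\<mu> j)) \<in> extensional (Obj C)"
        by (cases "\<mu> j"; auto simp: presheaf_cat_def hom_functor_cat op_cat_def)+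
    qed
    have \<mu>_at: "snd (snd (\<mu> j)) X = (hom C X (ob_map D j), ob_map Q X, m j X)"
      "m j X \<in> hom C X (ob_map D j) \<rightarrow>\<^sub>E ob_map Q X" if "j \<in> Obj J" "X \<in> Obj C" for j X
    proof -
      have "snd (snd (\<mu> j)) X \<in> hom set_cat (ob_map (representable C (ob_map D j)) X) (ob_map Q X)"
        using \<mu>(2)[OF that(1)] that(2) by (simp add: natural_def op_cat_def)
      then show "snd (snd (\<mu> j)) X = (hom C X (ob_map D j), ob_map Q X, m j X)"
        "m j X \<in> hom C X (ob_map D j) \<rightarrow>\<^sub>E ob_map Q X"
        using that(2) unfolding m_def
        by (cases "snd (snd (\<mu> j)) X"; auto simp: hom_set_cat representable_def)+
    qed
    have Q_ar: "ar_map Q h = (ob_map Q (Cod C h), ob_map Q (Dom C h), snd (snd (ar_map Q h)))"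
      if "h \<in> Arr C" for h
    proof -
      have "ar_map Q h \<in> hom set_cat (ob_map Q (Cod C h)) (ob_map Q (Dom C h))"
        using Q that by (simp add: functors_def is_functor_def op_cat_def)
      then show ?thesis by (cases "ar_map Q h") (auto simp: hom_set_cat)
    qed
    have m_nat: "m j (Dom C h) (Comp C f h) = snd (snd (ar_map Q h)) (m j (Cod C h) f)"
      if j: "j \<in> Obj J" and h: "h \<in> Arr C" and f: "f \<in> hom C (Cod C h) (ob_map D j)" for j h f
    proof -
      have "Comp set_cat (snd (snd (\<mu> j)) (Dom C h)) (ar_map (representable C (ob_map D j)) h) =
          Comp set_cat (ar_map Q h) (snd (snd (\<mu> j)) (Cod C h))"
        using \<mu>(2)[OF j] h by (simp add: natural_def op_cat_def)
      then have "compose (hom C (Cod C h) (ob_map D j)) (m j (Dom C h))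
            (\<lambda>g\<in>hom C (Cod C h) (ob_map D j). Comp C g h) =
          compose (hom C (Cod C h) (ob_map D j)) (snd (snd (ar_map Q h))) (m j (Cod C h))"
        using \<mu>_at(1)[OF j] ob[OF h] h
        by (subst (asm) Q_ar[OF h]) (simp add: representable_def set_cat_def)
      from fun_cong[OF this, of f] show ?thesis using f by (simp add: compose_eq)
    qed
    have m_r: "(\<lambda>(j, f). m j X f) e = (\<lambda>(j, f). m j X f) e'" if X: "X \<in> Obj C" and "r X e e'" for X e e'
    proof -
      obtain u f where u: "u \<in> Arr J" "e = (Dom J u, f)" "e' = (Cod J u, Comp C (ar_map D u) f)"
        "f \<in> hom C X (ob_map D (Dom J u))"
        using \<open>r X e e'\<close> unfolding r_def by (cases e; cases e') auto
      have Du: "Dom C (ar_map D u) = ob_map D (Dom J u)" "Cod C (ar_map D u) = ob_map D (Cod J u)"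
        using D_ar[OF u(1)] by (auto simp: hom_def)
      have "Comp (presheaf_cat C) (\<mu> (Cod J u)) (ar_map (yoneda C \<circ>\<^sub>F D) u) = \<mu> (Dom J u)"
        using Q\<mu> u(1) by (simp add: cocone_def)
      then have "Comp (presheaf_cat C)
            (representable C (ob_map D (Cod J u)), Q, snd (snd (\<mu> (Cod J u))))
            (ar_map (yoneda C \<circ>\<^sub>F D) u) =
          (representable C (ob_map D (Dom J u)), Q, snd (snd (\<mu> (Dom J u))))"
        using \<mu>(1)[OF obJ(1)[OF u(1)]] \<mu>(1)[OF obJ(2)[OF u(1)]] by simp
      then have "Comp set_cat (snd (snd (\<mu> (Cod J u))) X) (hom C X (ob_map D (Dom J u)),
            hom C X (ob_map D (Cod J u)), \<lambda>g\<in>hom C X (ob_map D (Dom J u)). Comp C (ar_map D u) g) =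
          snd (snd (\<mu> (Dom J u))) X"
        using X by (auto simp: presheaf_cat_def functor_cat_def comp_functor_def yoneda_def Du
            op_cat_def dest: fun_cong[of _ _ X])
      then have "compose (hom C X (ob_map D (Dom J u))) (m (Cod J u) X)
          (\<lambda>g\<in>hom C X (ob_map D (Dom J u)). Comp C (ar_map D u) g) = m (Dom J u) X"
        using \<mu>_at(1)[OF obJ(1)[OF u(1)] X] \<mu>_at(1)[OF obJ(2)[OF u(1)] X]
        by (simp add: set_cat_def)
      from fun_cong[OF this, of f] show ?thesis using u by (simp add: compose_eq)
    qed
    define n where "n X = lift X (\<lambda>(j, f). m j X f)" for X
    have n: "n X (cl X (j, f)) = m j X f" if "X \<in> Obj C" "(j, f) \<in> E X" for X j f
      using lift[OF that(2) m_r[OF that(1)]] by (simp add: n_def)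
    define h where "h = (P, Q, \<lambda>X\<in>Obj C. (cl X ` E X, ob_map Q X, n X))"
    have Q_small: "small (ob_map Q X)" if "X \<in> Obj C" for X
      using Q that by (simp add: functors_def is_functor_def op_cat_def set_cat_def)
    have "natural (op_cat C) set_cat P Q (\<lambda>X\<in>Obj C. (cl X ` E X, ob_map Q X, n X))"
      unfolding natural_def
    proof (intro conjI ballI)
      fix X assume "X \<in> Obj (op_cat C)"
      then have X: "X \<in> Obj C" by (simp add: op_cat_def)
      have "n X \<in> cl X ` E X \<rightarrow>\<^sub>E ob_map Q X"
      proof (intro PiE_I)
        fix x assume "x \<in> cl X ` E X"
        then obtain j f where x: "x = cl X (j, f)" "(j, f) \<in> E X" by auto
        then show "n X x \<in> ob_map Q X"
          using n[OF X x(2)] \<mu>_at(2)[of j X] X by (auto simp: E_def)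
      next
        fix x assume "x \<notin> cl X ` E X"
        then show "n X x = undefined" by (simp add: n_def lift_def)
      qed
      then show "(\<lambda>X\<in>Obj C. (cl X ` E X, ob_map Q X, n X)) X \<in> hom set_cat (ob_map P X) (ob_map Q X)"
        using X small_E[OF X] Q_small[OF X] by (simp add: hom_set_cat P_def)
    next
      fix k assume "k \<in> Arr (op_cat C)"
      then have k: "k \<in> Arr C" by (simp add: op_cat_def)
      have "compose (cl (Cod C k) ` E (Cod C k)) (n (Dom C k)) (lift (Cod C k) (pre (Dom C k) k)) =
          compose (cl (Cod C k) ` E (Cod C k)) (snd (snd (ar_map Q k))) (n (Cod C k))"
      proof (rule extensionalityI[where A = "cl (Cod C k) ` E (Cod C k)"])
        fix x assume "x \<in> cl (Cod C k) ` E (Cod C k)"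
        then obtain j f where x: "x = cl (Cod C k) (j, f)" "(j, f) \<in> E (Cod C k)" by auto
        then have "j \<in> Obj J" "f \<in> hom C (Cod C k) (ob_map D j)" by (auto simp: E_def)
        then show "compose (cl (Cod C k) ` E (Cod C k)) (n (Dom C k)) (lift (Cod C k) (pre (Dom C k) k)) x =
            compose (cl (Cod C k) ` E (Cod C k)) (snd (snd (ar_map Q k))) (n (Cod C k)) x"
          using x pre_lift[OF k x(2)] n[OF ob(1)[OF k] E_comp[OF k x(2)]] n[OF ob(2)[OF k] x(2)]
            m_nat[OF _ k] by (simp add: compose_eq)
      qed auto
      then show "Comp set_cat ((\<lambda>X\<in>Obj C. (cl X ` E X, ob_map Q X, n X)) (Cod (op_cat C) k)) (ar_map P k) =
          Comp set_cat (ar_map Q k) ((\<lambda>X\<in>Obj C. (cl X ` E X, ob_map Q X, n X)) (Dom (op_cat C) k))"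
        using k ob[OF k] by (subst Q_ar[OF k]) (simp add: op_cat_def set_cat_def P_def)
    qed
    then have h_hom: "h \<in> hom (presheaf_cat C) P Q"
      using P Q unfolding h_def presheaf_cat_def hom_functor_cat by (simp add: op_cat_def)
    have comp_\<kappa>: "Comp (presheaf_cat C) (P, Q, \<lambda>X\<in>Obj C. (cl X ` E X, ob_map Q X, t X)) (\<kappa> j) =
        (representable C (ob_map D j), Q, \<lambda>X\<in>Obj C. (hom C X (ob_map D j), ob_map Q X,
          \<lambda>f\<in>hom C X (ob_map D j). t X (cl X (j, f))))" for t j
      by (auto simp: presheaf_cat_def functor_cat_def \<kappa>_def set_cat_def op_cat_def compose_def
          restrict_def fun_eq_iff)
    have h_\<kappa>: "Comp (presheaf_cat C) h (\<kappa> j) = \<mu> j" if j: "j \<in> Obj J" for j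
    proof -
      have "(\<lambda>X\<in>Obj C. (hom C X (ob_map D j), ob_map Q X,
          \<lambda>f\<in>hom C X (ob_map D j). n X (cl X (j, f)))) = snd (snd (\<mu> j))"
      proof (rule extensionalityI[where A = "Obj C"])
        fix X assume X: "X \<in> Obj C"
        have "(\<lambda>f\<in>hom C X (ob_map D j). n X (cl X (j, f))) = m j X"
          using \<mu>_at(2)[OF j X] n[OF X, of j] j
          by (intro extensionalityI[where A = "hom C X (ob_map D j)"]) (auto simp: E_def PiE_def)
        then show "(\<lambda>X\<in>Obj C. (hom C X (ob_map D j), ob_map Q X,
            \<lambda>f\<in>hom C X (ob_map D j). n X (cl X (j, f)))) X = snd (snd (\<mu> j)) X"
          using X \<mu>_at(1)[OF j X] by simp
      qed (use \<mu>(3)[OF j] in auto)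
      then show ?thesis
        using \<mu>(1)[OF j] comp_\<kappa>[of n j] by (simp add: h_def)
    qed
    have uniq: "h' = h"
      if h': "h' \<in> hom (presheaf_cat C) P Q" and h'\<kappa>: "\<forall>j\<in>Obj J. Comp (presheaf_cat C) h' (\<kappa> j) = \<mu> j"
      for h'
    proof -
      obtain \<tau> where \<tau>: "h' = (P, Q, \<tau>)" "natural (op_cat C) set_cat P Q \<tau>" "\<tau> \<in> extensional (Obj C)"
        using h' by (cases h') (auto simp: presheaf_cat_def hom_functor_cat op_cat_def)
      define t where "t X = snd (snd (\<tau> X))" for X
      have t: "\<tau> X = (cl X ` E X, ob_map Q X, t X)" "t X \<in> cl X ` E X \<rightarrow>\<^sub>E ob_map Q X"
        if "X \<in> Obj C" for X
      proof -
        have "\<tau> X \<in> hom set_cat (ob_map P X) (ob_map Q X)"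
          using \<tau>(2) that by (simp add: natural_def op_cat_def)
        then show "\<tau> X = (cl X ` E X, ob_map Q X, t X)" "t X \<in> cl X ` E X \<rightarrow>\<^sub>E ob_map Q X"
          using that unfolding t_def by (cases "\<tau> X"; auto simp: hom_set_cat P_def)+
      qed
      have \<tau>_eq: "\<tau> = (\<lambda>X\<in>Obj C. (cl X ` E X, ob_map Q X, t X))"
        using \<tau>(3) t(1) by (intro extensionalityI[where A = "Obj C"]) auto
      have "t X = n X" if X: "X \<in> Obj C" for X
      proof (rule extensionalityI[where A = "cl X ` E X"])
        show "t X \<in> extensional (cl X ` E X)" using t(2)[OF X] by (simp add: PiE_def)
        show "n X \<in> extensional (cl X ` E X)" by (simp add: n_def lift_ext)
        fix x assume "x \<in> cl X ` E X"
        then obtain j f where x: "x = cl X (j, f)" "(j, f) \<in> E X" by auto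
        then have j: "j \<in> Obj J" and f: "f \<in> hom C X (ob_map D j)" by (auto simp: E_def)
        have "Comp (presheaf_cat C) (P, Q, \<lambda>X\<in>Obj C. (cl X ` E X, ob_map Q X, t X)) (\<kappa> j) = \<mu> j"
          using h'\<kappa> j unfolding \<tau>(1) \<tau>_eq by (rule bspec)
        from arg_cong[OF this[unfolded comp_\<kappa>], of "\<lambda>p. snd (snd p)"]
        have "(\<lambda>X\<in>Obj C. (hom C X (ob_map D j), ob_map Q X,
            \<lambda>f\<in>hom C X (ob_map D j). t X (cl X (j, f)))) = snd (snd (\<mu> j))"
          unfolding snd_conv .
        from fun_cong[OF this, of X]
        have "(\<lambda>f\<in>hom C X (ob_map D j). t X (cl X (j, f))) = m j X"
          using X \<mu>_at(1)[OF j X] by simp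
        from fun_cong[OF this, of f] show "t X x = n X x"
          using f x n[OF X x(2)] by simp
      qed
      then have "\<tau> = (\<lambda>X\<in>Obj C. (cl X ` E X, ob_map Q X, n X))"
        unfolding \<tau>_eq by (auto simp: restrict_def fun_eq_iff)
      then show ?thesis by (simp add: \<tau>(1) h_def)
    qed
    show ?thesis using h_hom h_\<kappa> uniq by blast
  qed
  then have "is_colimit J (presheaf_cat C) (yoneda C \<circ>\<^sub>F D) P \<kappa>"
    using cocone unfolding is_colimit_def by blast
  then have "is_colimit_object J (presheaf_cat C) (yoneda C \<circ>\<^sub>F D) P"
    unfolding is_colimit_object_def by blast
  then show ?thesis
    unfolding image_presheaf_def by (rule someI)
qed

lemma is_category_comma_cat:
  assumes F: "is_functor A B F"
  shows "is_category (comma_cat A B F b)"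
proof -
  have A: "is_category A" and B: "is_category B" using F by (auto simp: is_functor_def)
  have 1: "Comp B (ar_map F (Id A X)) f = f" if "X \<in> Obj A" "f \<in> hom B b (ob_map F X)" for X f
    using F B that unfolding is_functor_def is_category_def hom_def by auto
  have 2: "Comp B (ar_map F (Comp A v u)) f = Comp B (ar_map F v) (Comp B (ar_map F u) f)"
    if "f \<in> hom B b (ob_map F X)" "u \<in> hom A X Y" "v \<in> hom A Y Z" for X Y Z f u v
    using F B that unfolding is_functor_def is_category_def hom_def by auto
  have 3: "Comp A v u \<in> hom A X Z" if "u \<in> hom A X Y" "v \<in> hom A Y Z" for X Y Z u v
    using A that unfolding is_category_def hom_def by auto
  have 4: "Id A X \<in> hom A X X" if "X \<in> Obj A" for X
    using A that unfolding is_category_def by auto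
  have 5: "Comp A f (Id A X) = f" "Comp A (Id A Y) f = f" if "f \<in> hom A X Y" for f X Y
    using A that unfolding is_category_def hom_def by auto
  have 6: "Comp A h (Comp A g f) = Comp A (Comp A h g) f"
    if "f \<in> hom A X Y" "g \<in> hom A Y Z" "h \<in> hom A Z W" for f g h X Y Z W
    using A that unfolding is_category_def hom_def by auto
  show ?thesis
    unfolding is_category_def hom_def[of "comma_cat A B F b"]
    using 2 by (auto simp: comma_cat_def 1 4 5 intro: 3 6)
qed

end

theory Submission
  imports Defs
begin

text \<open>
  The implications are proved in the cycle (1), (3), (2), (1).

  From (1) to (3): if \<open>P\<close> is a colimit of both \<open>yoneda C \<circ>\<^sub>F D\<close> and \<open>yoneda C \<circ>\<^sub>F E\<close>, the colimit
  cocones lift \<open>D\<close> and \<open>E\<close> to functors into the category of elements of \<open>P\<close>. As \<open>P\<close> is a colimit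
  of representables, both lifts are confinal, and they remain so when the category of elements is
  cut down to any full subcategory containing their images. Such a subcategory can be chosen small,
  which gives a zigzag of length two.

  From (3) to (2): cocones extend uniquely along a confinal functor.

  From (2) to (1): apply (2) to the Yoneda embedding, with codomain restricted to the full
  subcategory of presheaves on the representables, \<open>Im D\<close> and \<open>Im E\<close>. Unlike the category of all
  presheaves, which need not be locally small for large \<open>C\<close>, this one is locally small.
\<close>

section \<open>Categories and functors\<close>

text \<open>Confinality of the two lifts is a statement about the elements of a colimit of
  representables: each is a restriction of some generator, and two presentations of the same element
  are linked by a zigzag. \<open>image_presheaf\<close> is an arbitrary choice of colimit, and a
  single \<open>P\<close> has to serve for both diagrams; these facts are therefore derived from the
  universal property alone, by mapping \<open>P\<close> into presheaves of sets of arrows, and not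
  from a quotient formula. The comma category under an element involves only that element and the
  generators, which is why passing to a full subcategory does no harm. Size shapes the rest.
  Condition (2) ranges over categories whose objects and arrows lie in \<open>'v\<close>, whereas
  presheaves have a higher type, so the test category must be coded inside \<open>'v\<close>. A map
  out of a presheaf with a small generating family is determined by a small family of values, and
  inaccessibility keeps the set of such families small.\<close>

lemma comp_in_hom:
  "\<lbrakk>is_category C; f \<in> hom C X Y; g \<in> hom C Y Z\<rbrakk> \<Longrightarrow> Comp C g f \<in> hom C X Z"
  unfolding is_category_def hom_def by auto

lemma category_comp_assoc:
  "\<lbrakk>is_category C; f \<in> hom C X Y; g \<in> hom C Y Z; h \<in> hom C Z W\<rbrakk> \<Longrightarrow>
    Comp C (Comp C h g) f = Comp C h (Comp C g f)"
  unfolding is_category_def hom_def by auto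

lemma comp_id_right: "\<lbrakk>is_category C; f \<in> hom C X Y\<rbrakk> \<Longrightarrow> Comp C f (Id C X) = f"
  unfolding is_category_def hom_def by auto

lemma comp_id_left: "\<lbrakk>is_category C; f \<in> hom C X Y\<rbrakk> \<Longrightarrow> Comp C (Id C Y) f = f"
  unfolding is_category_def hom_def by auto

lemma id_in_hom: "\<lbrakk>is_category C; X \<in> Obj C\<rbrakk> \<Longrightarrow> Id C X \<in> hom C X X"
  unfolding is_category_def by auto

lemma hom_objects: "\<lbrakk>is_category C; f \<in> hom C X Y\<rbrakk> \<Longrightarrow> X \<in> Obj C \<and> Y \<in> Obj C"
  unfolding is_category_def hom_def by auto

lemma arr_in_hom: "f \<in> Arr C \<Longrightarrow> f \<in> hom C (Dom C f) (Cod C f)"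
  unfolding hom_def by auto

lemma functor_obj: "\<lbrakk>is_functor A B F; X \<in> Obj A\<rbrakk> \<Longrightarrow> ob_map F X \<in> Obj B"
  unfolding is_functor_def by auto

lemma functor_hom:
  "\<lbrakk>is_functor A B F; f \<in> hom A X Y\<rbrakk> \<Longrightarrow> ar_map F f \<in> hom B (ob_map F X) (ob_map F Y)"
  unfolding is_functor_def hom_def by auto

lemma functor_comp:
  "\<lbrakk>is_functor A B F; f \<in> hom A X Y; g \<in> hom A Y Z\<rbrakk> \<Longrightarrow>
    ar_map F (Comp A g f) = Comp B (ar_map F g) (ar_map F f)"
  unfolding is_functor_def hom_def by auto

lemma functor_id:
  "\<lbrakk>is_functor A B F; X \<in> Obj A\<rbrakk> \<Longrightarrow> ar_map F (Id A X) = Id B (ob_map F X)"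
  unfolding is_functor_def by auto

lemma comp_functor_maps [simp]:
  "ob_map (G \<circ>\<^sub>F F) X = ob_map G (ob_map F X)"
  "ar_map (G \<circ>\<^sub>F F) f = ar_map G (ar_map F f)"
  by (simp_all add: comp_functor_def)

lemma is_functor_comp:
  assumes F: "is_functor A B F" and G: "is_functor B C G"
  shows "is_functor A C (G \<circ>\<^sub>F F)"
  using assms unfolding is_functor_def hom_def by auto

lemma iso_objects_sym: "iso_objects C X Y \<Longrightarrow> iso_objects C Y X"
  unfolding iso_objects_def by auto


section \<open>Colimits\<close>

lemma cocone_hom: "\<lbrakk>cocone J C D X \<kappa>; j \<in> Obj J\<rbrakk> \<Longrightarrow> \<kappa> j \<in> hom C (ob_map D j) X"
  unfolding cocone_def by auto

lemma cocone_arr: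
  "\<lbrakk>cocone J C D X \<kappa>; u \<in> hom J j j'\<rbrakk> \<Longrightarrow> Comp C (\<kappa> j') (ar_map D u) = \<kappa> j"
  unfolding cocone_def hom_def by auto

lemma cocone_comp:
  assumes C: "is_category C" and D: "is_functor J C D"
    and \<kappa>: "cocone J C D X \<kappa>" and h: "h \<in> hom C X Y"
  shows "cocone J C D Y (\<lambda>j. Comp C h (\<kappa> j))"
  unfolding cocone_def
proof (intro conjI ballI)
  show "Y \<in> Obj C" using hom_objects[OF C h] by simp
  show "Comp C h (\<kappa> j) \<in> hom C (ob_map D j) Y" if "j \<in> Obj J" for j
    using comp_in_hom[OF C cocone_hom[OF \<kappa> that] h] .
  fix u assume u: "u \<in> Arr J"
  then have ob: "Cod J u \<in> Obj J"
    using D unfolding is_functor_def is_category_def by auto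
  show "Comp C (Comp C h (\<kappa> (Cod J u))) (ar_map D u) = Comp C h (\<kappa> (Dom J u))"
    using category_comp_assoc[OF C functor_hom[OF D arr_in_hom[OF u]] cocone_hom[OF \<kappa> ob] h]
      cocone_arr[OF \<kappa> arr_in_hom[OF u]] by simp
qed

lemma colimit_endo_id:
  assumes C: "is_category C" and \<kappa>: "is_colimit J C D X \<kappa>"
    and h: "h \<in> hom C X X" "\<And>j. j \<in> Obj J \<Longrightarrow> Comp C h (\<kappa> j) = \<kappa> j"
  shows "h = Id C X"
proof -
  have cc: "cocone J C D X \<kappa>" using \<kappa> unfolding is_colimit_def by auto
  then have X: "X \<in> Obj C" unfolding cocone_def by auto
  have "\<exists>!h. h \<in> hom C X X \<and> (\<forall>j\<in>Obj J. Comp C h (\<kappa> j) = \<kappa> j)"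
    using \<kappa> cc unfolding is_colimit_def by blast
  moreover have "Comp C (Id C X) (\<kappa> j) = \<kappa> j" if "j \<in> Obj J" for j
    using comp_id_left[OF C cocone_hom[OF cc that]] .
  ultimately show ?thesis using h id_in_hom[OF C X] by blast
qed

lemma colimit_objects_iso:
  assumes C: "is_category C"
    and X: "is_colimit_object J C D X" and Y: "is_colimit_object J C D Y"
  shows "iso_objects C X Y"
proof -
  obtain \<kappa> \<mu> where \<kappa>: "is_colimit J C D X \<kappa>" and \<mu>: "is_colimit J C D Y \<mu>"
    using X Y unfolding is_colimit_object_def by auto
  have cc: "cocone J C D X \<kappa>" "cocone J C D Y \<mu>"
    using \<kappa> \<mu> unfolding is_colimit_def by auto
  obtain f where f: "f \<in> hom C X Y" "\<And>j. j \<in> Obj J \<Longrightarrow> Comp C f (\<kappa> j) = \<mu> j"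
    using \<kappa> cc(2) unfolding is_colimit_def by blast
  obtain g where g: "g \<in> hom C Y X" "\<And>j. j \<in> Obj J \<Longrightarrow> Comp C g (\<mu> j) = \<kappa> j"
    using \<mu> cc(1) unfolding is_colimit_def by blast
  have "Comp C g f = Id C X"
    using colimit_endo_id[OF C \<kappa> comp_in_hom[OF C f(1) g(1)]]
      category_comp_assoc[OF C cocone_hom[OF cc(1)] f(1) g(1)] f(2) g(2) by simp
  moreover have "Comp C f g = Id C Y"
    using colimit_endo_id[OF C \<mu> comp_in_hom[OF C g(1) f(1)]]
      category_comp_assoc[OF C cocone_hom[OF cc(2)] g(1) f(1)] f(2) g(2) by simp
  ultimately show ?thesis
    using f(1) g(1) hom_objects[OF C f(1)] unfolding iso_objects_def by auto
qed

text \<open>Composing the colimit cocone with the isomorphism gives the new one. This is what lets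
  one presheaf be a colimit for both diagrams once their images are isomorphic.\<close>

lemma is_colimit_object_iso:
  assumes C: "is_category C" and D: "is_functor J C D"
    and X: "is_colimit_object J C D X" and XY: "iso_objects C X Y"
  shows "is_colimit_object J C D Y"
proof -
  obtain \<kappa> where \<kappa>: "is_colimit J C D X \<kappa>"
    using X unfolding is_colimit_object_def by auto
  then have cc: "cocone J C D X \<kappa>" unfolding is_colimit_def by auto
  obtain f g where f: "f \<in> hom C X Y" and g: "g \<in> hom C Y X"
    and gf: "Comp C g f = Id C X" and fg: "Comp C f g = Id C Y"
    using XY unfolding iso_objects_def by auto
  have "is_colimit J C D Y (\<lambda>j. Comp C f (\<kappa> j))"
    unfolding is_colimit_def
  proof (intro conjI allI impI)
    show "cocone J C D Y (\<lambda>j. Comp C f (\<kappa> j))" using cocone_comp[OF C D cc f] .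
    fix Z \<mu> assume "cocone J C D Z \<mu>"
    then obtain h where h: "h \<in> hom C X Z" "\<And>j. j \<in> Obj J \<Longrightarrow> Comp C h (\<kappa> j) = \<mu> j"
      and uniq: "\<And>h'. h' \<in> hom C X Z \<Longrightarrow> \<forall>j\<in>Obj J. Comp C h' (\<kappa> j) = \<mu> j \<Longrightarrow> h' = h"
      using \<kappa> unfolding is_colimit_def by metis
    show "\<exists>!h. h \<in> hom C Y Z \<and> (\<forall>j\<in>Obj J. Comp C h (Comp C f (\<kappa> j)) = \<mu> j)"
    proof (rule ex1I[of _ "Comp C h g"], intro conjI ballI)
      show "Comp C h g \<in> hom C Y Z" using comp_in_hom[OF C g h(1)] .
      fix j assume j: "j \<in> Obj J"
      have \<kappa>j: "\<kappa> j \<in> hom C (ob_map D j) X" using cocone_hom[OF cc j] .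
      have "Comp C (Comp C h g) (Comp C f (\<kappa> j)) = Comp C h (Comp C (Comp C g f) (\<kappa> j))"
        using category_comp_assoc[OF C comp_in_hom[OF C \<kappa>j f] g h(1)] category_comp_assoc[OF C \<kappa>j f g] by simp
      then show "Comp C (Comp C h g) (Comp C f (\<kappa> j)) = \<mu> j"
        using gf comp_id_left[OF C \<kappa>j] h(2)[OF j] by simp
    next
      fix k assume k: "k \<in> hom C Y Z \<and> (\<forall>j\<in>Obj J. Comp C k (Comp C f (\<kappa> j)) = \<mu> j)"
      then have "Comp C k f = h"
        using category_comp_assoc[OF C cocone_hom[OF cc] f] comp_in_hom[OF C f] by (intro uniq) auto
      then show "k = Comp C h g"
        using category_comp_assoc[OF C g f, of k Z] k fg comp_id_right[OF C, of k Y Z] by auto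
    qed
  qed
  then show ?thesis unfolding is_colimit_object_def by auto
qed

text \<open>Triangles in the slice commute only on objects and arrows of the source, not as an
  equality of HOL records; colimits cannot see the difference.\<close>

lemma is_colimit_object_cong:
  assumes "\<And>j. j \<in> Obj J \<Longrightarrow> ob_map D j = ob_map D' j"
    and "\<And>u. u \<in> Arr J \<Longrightarrow> ar_map D u = ar_map D' u"
  shows "is_colimit_object J C D X \<longleftrightarrow> is_colimit_object J C D' X"
proof -
  have "cocone J C D Y \<kappa> \<longleftrightarrow> cocone J C D' Y \<kappa>" for Y \<kappa>
    using assms unfolding cocone_def by simp
  then show ?thesis unfolding is_colimit_object_def is_colimit_def by simp
qed


section \<open>Confinal functors preserve and reflect colimits\<close>

lemma obj_comma_cat:
  "(X, f) \<in> Obj (comma_cat A B F b) \<longleftrightarrow> X \<in> Obj A \<and> f \<in> hom B b (ob_map F X)"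
  unfolding comma_cat_def by simp

lemma hom_comma_cat_nonempty:
  "hom (comma_cat A B F b) (X, f) (Y, g) \<noteq> {} \<longleftrightarrow>
    X \<in> Obj A \<and> f \<in> hom B b (ob_map F X) \<and> Y \<in> Obj A \<and> g \<in> hom B b (ob_map F Y) \<and>
    (\<exists>u \<in> hom A X Y. Comp B (ar_map F u) f = g)"
  unfolding comma_cat_def hom_def
  by auto

lemma cocone_restrict:
  assumes G: "is_functor S T G" and \<kappa>: "cocone T L H X \<kappa>"
  shows "cocone S L (H \<circ>\<^sub>F G) X (\<lambda>s. \<kappa> (ob_map G s))"
  using functor_obj[OF G] functor_hom[OF G arr_in_hom] cocone_hom[OF \<kappa>] cocone_arr[OF \<kappa>] \<kappa>
  unfolding cocone_def by simp

text \<open>The component at \<open>t\<close> is forced: choose any \<open>a\<close> from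
  \<open>t\<close> to some \<open>G s\<close> and compose \<open>\<mu> s\<close> with
  \<open>H a\<close>. Non-emptiness of the comma category provides \<open>a\<close>, and
  connectedness makes the result independent of it.\<close>

lemma cocone_extend:
  assumes G: "confinal S T G" and H: "is_functor T L H"
    and \<mu>: "cocone S L (H \<circ>\<^sub>F G) X \<mu>"
  shows "\<exists>\<nu>. cocone T L H X \<nu> \<and> (\<forall>s\<in>Obj S. \<nu> (ob_map G s) = \<mu> s)"
proof -
  have T: "is_category T" and L: "is_category L" and Gf: "is_functor S T G"
    using H G unfolding is_functor_def confinal_def by auto
  define v where "v = (\<lambda>(s, a). Comp L (\<mu> s) (ar_map H a))"
  have \<mu>s: "\<mu> s \<in> hom L (ob_map H (ob_map G s)) X" if "s \<in> Obj S" for s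
    using cocone_hom[OF \<mu> that] by simp
  have v_arr: "v p = v q" if pq: "hom (comma_cat S T G t) p q \<noteq> {}" for t p q
  proof -
    obtain s a s' a' where p: "p = (s, a)" and q: "q = (s', a')" by fastforce
    obtain u where a: "a \<in> hom T t (ob_map G s)" and s': "s' \<in> Obj S"
      and u: "u \<in> hom S s s'" "Comp T (ar_map G u) a = a'"
      using pq unfolding p q hom_comma_cat_nonempty by auto
    have Gu: "ar_map G u \<in> hom T (ob_map G s) (ob_map G s')" using functor_hom[OF Gf u(1)] .
    have "Comp L (\<mu> s') (ar_map H a') = Comp L (Comp L (\<mu> s') (ar_map H (ar_map G u))) (ar_map H a)"
      using functor_comp[OF H a Gu] u(2)
        category_comp_assoc[OF L functor_hom[OF H a] functor_hom[OF H Gu] \<mu>s[OF s']] by simp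
    then show ?thesis using cocone_arr[OF \<mu> u(1)] by (simp add: v_def p q)
  qed
  have v_eq: "v p = v q"
    if t: "t \<in> Obj T" and p: "p \<in> Obj (comma_cat S T G t)" and q: "q \<in> Obj (comma_cat S T G t)"
    for t p q
  proof -
    have "equivclp (\<lambda>p q. hom (comma_cat S T G t) p q \<noteq> {}) p q"
      using G t p q unfolding confinal_def connected_category_def by auto
    then show ?thesis
    proof (induction rule: equivclp_induct)
      case (step q r)
      then show ?case using v_arr[of t q r] v_arr[of t r q] by argo
    qed simp
  qed
  \<comment> \<open>The choice is immaterial: \<open>v\<close> is constant on the comma category by
    \<open>v_eq\<close>, so later steps may evaluate \<open>\<nu> t\<close> at whichever object is
    convenient.\<close>
  define \<nu> where "\<nu> t = v (SOME p. p \<in> Obj (comma_cat S T G t))" for t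
  have \<nu>: "\<nu> t = v p" if "t \<in> Obj T" "p \<in> Obj (comma_cat S T G t)" for t p
    unfolding \<nu>_def by (rule v_eq[OF that(1) someI[of "\<lambda>p. p \<in> Obj (comma_cat S T G t)", OF that(2)] that(2)])
  have ex: "\<exists>s a. s \<in> Obj S \<and> a \<in> hom T t (ob_map G s) \<and> \<nu> t = Comp L (\<mu> s) (ar_map H a)"
    if t: "t \<in> Obj T" for t
  proof -
    obtain s a where "(s, a) \<in> Obj (comma_cat S T G t)"
      using G t unfolding confinal_def by fastforce
    then show ?thesis using \<nu>[OF t, of "(s, a)"] by (auto simp: obj_comma_cat v_def)
  qed
  have "cocone T L H X \<nu>"
    unfolding cocone_def
  proof (intro conjI ballI)
    show "X \<in> Obj L" using \<mu> unfolding cocone_def by simp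
    show "\<nu> t \<in> hom L (ob_map H t) X" if "t \<in> Obj T" for t
      using ex[OF that] comp_in_hom[OF L functor_hom[OF H] \<mu>s] by fastforce
    fix w assume "w \<in> Arr T"
    then have w: "w \<in> hom T (Dom T w) (Cod T w)" by (rule arr_in_hom)
    then obtain s a where s: "s \<in> Obj S" and a: "a \<in> hom T (Cod T w) (ob_map G s)"
      and \<nu>c: "\<nu> (Cod T w) = Comp L (\<mu> s) (ar_map H a)"
      using ex hom_objects[OF T w] by blast
    \<comment> \<open>Precomposing with \<open>w\<close> turns the object \<open>(s, a)\<close>
      under the codomain of \<open>w\<close> into one under its domain.\<close>
    have "\<nu> (Dom T w) = Comp L (\<mu> s) (ar_map H (Comp T a w))"
      using \<nu>[of "Dom T w" "(s, Comp T a w)"] hom_objects[OF T w] s comp_in_hom[OF T w a]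
      by (simp add: obj_comma_cat v_def)
    then show "Comp L (\<nu> (Cod T w)) (ar_map H w) = \<nu> (Dom T w)"
      using \<nu>c category_comp_assoc[OF L functor_hom[OF H w] functor_hom[OF H a] \<mu>s[OF s]]
        functor_comp[OF H w a] by simp
  qed
  \<comment> \<open>Here the convenient object is \<open>s\<close> with the identity of
    \<open>G s\<close>.\<close>
  moreover have "\<nu> (ob_map G s) = \<mu> s" if s: "s \<in> Obj S" for s
    using \<nu>[of "ob_map G s" "(s, Id T (ob_map G s))"] functor_obj[OF Gf s] s
      id_in_hom[OF T functor_obj[OF Gf s]] functor_id[OF H functor_obj[OF Gf s]]
      comp_id_right[OF L \<mu>s[OF s]]
    by (simp add: obj_comma_cat v_def)
  ultimately show ?thesis by blast
qed

text \<open>An arrow from \<open>t\<close> to some \<open>G s\<close> expresses the component at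
  \<open>t\<close> through the one at \<open>G s\<close>. Together with \<open>cocone_extend\<close>
  this makes restriction along \<open>G\<close> a bijection on cocones.\<close>

lemma cocone_eq_if_eq_on_image:
  assumes G: "confinal S T G" and \<mu>: "cocone T L H X \<mu>" and \<nu>: "cocone T L H X \<nu>"
    and eq: "\<And>s. s \<in> Obj S \<Longrightarrow> \<mu> (ob_map G s) = \<nu> (ob_map G s)" and t: "t \<in> Obj T"
  shows "\<mu> t = \<nu> t"
proof -
  obtain s a where "s \<in> Obj S" "a \<in> hom T t (ob_map G s)"
    using G t unfolding confinal_def by (fastforce simp: obj_comma_cat)
  then show ?thesis using cocone_arr[OF \<mu>, of a t] cocone_arr[OF \<nu>, of a t] eq by metis
qed

lemma confinal_colimit_objects:
  assumes G: "confinal S T G" and H: "is_functor T L H"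
  shows "is_colimit_object S L (H \<circ>\<^sub>F G) X \<longleftrightarrow> is_colimit_object T L H X"
proof
  have L: "is_category L" and Gf: "is_functor S T G"
    using H G unfolding is_functor_def confinal_def by auto
  \<comment> \<open>The two factorisation problems have the same solutions, so unique existence
    passes from either to the other.\<close>
  have fill: "(h \<in> hom L X Y \<and> (\<forall>s\<in>Obj S. Comp L h (\<kappa> (ob_map G s)) = \<nu> (ob_map G s))) \<longleftrightarrow>
      (h \<in> hom L X Y \<and> (\<forall>t\<in>Obj T. Comp L h (\<kappa> t) = \<nu> t))"
    if \<kappa>: "cocone T L H X \<kappa>" and \<nu>: "cocone T L H Y \<nu>" for Y \<kappa> \<nu> h
    using cocone_eq_if_eq_on_image[OF G cocone_comp[OF L H \<kappa>] \<nu>] functor_obj[OF Gf] by blast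
  show "is_colimit_object T L H X" if X: "is_colimit_object S L (H \<circ>\<^sub>F G) X"
  proof -
    obtain \<mu> where \<mu>: "is_colimit S L (H \<circ>\<^sub>F G) X \<mu>"
      using X unfolding is_colimit_object_def by auto
    then obtain \<kappa> where \<kappa>: "cocone T L H X \<kappa>" "\<forall>s\<in>Obj S. \<kappa> (ob_map G s) = \<mu> s"
      using cocone_extend[OF G H] unfolding is_colimit_def by blast
    have "\<exists>!h. h \<in> hom L X Y \<and> (\<forall>t\<in>Obj T. Comp L h (\<kappa> t) = \<nu> t)"
      if \<nu>: "cocone T L H Y \<nu>" for Y \<nu>
    proof -
      have "\<exists>!h. h \<in> hom L X Y \<and> (\<forall>s\<in>Obj S. Comp L h (\<mu> s) = \<nu> (ob_map G s))"
        using \<mu> cocone_restrict[OF Gf \<nu>] unfolding is_colimit_def by blast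
      then show ?thesis using fill[OF \<kappa>(1) \<nu>] \<kappa>(2) by simp
    qed
    then show ?thesis using \<kappa> unfolding is_colimit_object_def is_colimit_def by blast
  qed
  show "is_colimit_object S L (H \<circ>\<^sub>F G) X" if X: "is_colimit_object T L H X"
  proof -
    obtain \<kappa> where \<kappa>: "is_colimit T L H X \<kappa>"
      using X unfolding is_colimit_object_def by auto
    then have cc: "cocone T L H X \<kappa>" unfolding is_colimit_def by auto
    have "\<exists>!h. h \<in> hom L X Y \<and> (\<forall>s\<in>Obj S. Comp L h (\<kappa> (ob_map G s)) = \<mu> s)"
      if \<mu>: "cocone S L (H \<circ>\<^sub>F G) Y \<mu>" for Y \<mu>
    proof -
      obtain \<nu> where \<nu>: "cocone T L H Y \<nu>" "\<forall>s\<in>Obj S. \<nu> (ob_map G s) = \<mu> s"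
        using cocone_extend[OF G H \<mu>] by blast
      have "\<exists>!h. h \<in> hom L X Y \<and> (\<forall>t\<in>Obj T. Comp L h (\<kappa> t) = \<nu> t)"
        using \<kappa> \<nu>(1) unfolding is_colimit_def by blast
      then show ?thesis using fill[OF cc \<nu>(1)] \<nu>(2) by simp
    qed
    then show ?thesis using cocone_restrict[OF Gf cc] unfolding is_colimit_object_def is_colimit_def by blast
  qed
qed

section \<open>Invariance of colimits along a confinal zigzag\<close>

lemma confinal_arrow_colimit_objects:
  assumes "confinal_arrow C (S, P) (T, Q)" and F: "is_functor C L F"
  shows "is_colimit_object S L (F \<circ>\<^sub>F P) X \<longleftrightarrow> is_colimit_object T L (F \<circ>\<^sub>F Q) X"
proof -
  obtain G where G: "confinal S T G" and Q: "is_functor T C Q"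
    and eq: "\<forall>X\<in>Obj S. ob_map (Q \<circ>\<^sub>F G) X = ob_map P X" "\<forall>f\<in>Arr S. ar_map (Q \<circ>\<^sub>F G) f = ar_map P f"
    using assms(1) unfolding confinal_arrow_def slice_arrow_def small_diagram_def by auto
  have "is_colimit_object S L (F \<circ>\<^sub>F P) X \<longleftrightarrow> is_colimit_object S L ((F \<circ>\<^sub>F Q) \<circ>\<^sub>F G) X"
    using eq by (intro is_colimit_object_cong) auto
  then show ?thesis using confinal_colimit_objects[OF G is_functor_comp[OF Q F]] by simp
qed

lemma confinal_zigzag_colimit_objects:
  fixes J K :: "('v, 'v) category" and D E :: "('v, 'v, 'o, 'm) cfunctor"
  assumes "confinal_zigzag C (J, D) (K, E)" and F: "is_functor C L F"
  shows "is_colimit_object J L (F \<circ>\<^sub>F D) X \<longleftrightarrow> is_colimit_object K L (F \<circ>\<^sub>F E) X"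
proof -
  \<comment> \<open>The index category changes along the zigzag, so the invariant is a predicate on
    whole diagrams.\<close>
  define col :: "('v, 'o, 'm) diagram \<Rightarrow> bool" where
    "col = (\<lambda>(S, P). is_colimit_object S L (F \<circ>\<^sub>F P) X)"
  have step: "col p \<longleftrightarrow> col q" if "confinal_arrow C p q" for p q
    using confinal_arrow_colimit_objects[OF _ F, of "fst p" "snd p" "fst q" "snd q" X] that
    by (simp add: col_def case_prod_beta)
  have "col (J, D) \<longleftrightarrow> col (K, E)"
    using assms(1) unfolding confinal_zigzag_def
    by (induction rule: equivclp_induct) (auto dest: step)
  then show ?thesis by (simp add: col_def)
qed

text \<open>The two composites have literally the same colimit objects, so the required isomorphism
  is uniqueness of the colimit of a single diagram.\<close>

lemma confinal_zigzag_same_colimits: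
  fixes C J K :: "('v, 'v) category" and D E :: "('v, 'v, 'v, 'v) cfunctor"
  assumes "confinal_zigzag C (J, D) (K, E)"
  shows "same_colimits C (J, D) (K, E)"
proof -
  have "iso_objects L X Y"
    if "locally_small L" "is_functor C L F" "is_colimit_object J L (F \<circ>\<^sub>F D) X"
      "is_colimit_object K L (F \<circ>\<^sub>F E) Y" for L :: "('v, 'v) category" and F :: "('v, 'v, 'v, 'v) cfunctor" and X Y
  proof (rule colimit_objects_iso)
    show "is_category L" using that(1) by (simp add: locally_small_def)
    show "is_colimit_object J L (F \<circ>\<^sub>F D) X" by (rule that(3))
    show "is_colimit_object J L (F \<circ>\<^sub>F D) Y"
      using that(4) confinal_zigzag_colimit_objects[OF assms that(2)] by simp
  qed
  moreover have "is_colimit_object J L (F \<circ>\<^sub>F D) = is_colimit_object K L (F \<circ>\<^sub>F E)"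
    if "is_functor C L F" for L :: "('v, 'v) category" and F :: "('v, 'v, 'v, 'v) cfunctor"
    using confinal_zigzag_colimit_objects[OF assms that] by (intro ext)
  ultimately show ?thesis by (auto simp: same_colimits_def)
qed


section \<open>Presheaves element by element\<close>

text \<open>Restriction of elements: for \<open>f\<close> from \<open>X\<close> to \<open>Y\<close>
  it goes from \<open>P\<close> at \<open>Y\<close> to \<open>P\<close> at \<open>X\<close>. The
  projections discard the source and target sets that an arrow of \<open>set_cat\<close>
  carries.\<close>

definition act :: "('o, 'v) presheaf \<Rightarrow> 'v \<Rightarrow> 'v \<Rightarrow> 'v" where
  "act P f = snd (snd (ar_map P f))"

definition app :: "('o, 'v) presheaf_map \<Rightarrow> 'o \<Rightarrow> 'v \<Rightarrow> 'v" where
  "app h X = snd (snd (snd (snd h) X))"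

lemma obj_presheaf_cat: "Obj (presheaf_cat C) = functors (op_cat C) set_cat"
  by (simp add: presheaf_cat_def functor_cat_def)

lemma presheaf_small:
  "\<lbrakk>P \<in> Obj (presheaf_cat C); X \<in> Obj C\<rbrakk> \<Longrightarrow> small (ob_map P X)"
  by (simp add: obj_presheaf_cat functors_def is_functor_def op_cat_def set_cat_def)

lemma presheaf_ar_map:
  assumes P: "P \<in> Obj (presheaf_cat C)" and f: "f \<in> hom C X Y"
  shows "ar_map P f = (ob_map P Y, ob_map P X, act P f)"
    and "act P f \<in> ob_map P Y \<rightarrow>\<^sub>E ob_map P X"
proof -
  have "is_functor (op_cat C) set_cat P" using P by (simp add: obj_presheaf_cat functors_def)
  moreover have "f \<in> hom (op_cat C) Y X" using f by (auto simp: op_cat_def hom_def)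
  ultimately have "ar_map P f \<in> hom set_cat (ob_map P Y) (ob_map P X)"
    by (rule functor_hom)
  then show "ar_map P f = (ob_map P Y, ob_map P X, act P f)"
    "act P f \<in> ob_map P Y \<rightarrow>\<^sub>E ob_map P X"
    by (cases "ar_map P f"; simp add: hom_set_cat act_def)+
qed

lemma act_in:
  "\<lbrakk>P \<in> Obj (presheaf_cat C); f \<in> hom C X Y; p \<in> ob_map P Y\<rbrakk> \<Longrightarrow> act P f p \<in> ob_map P X"
  using presheaf_ar_map(2) by fastforce

lemma act_id:
  assumes P: "P \<in> Obj (presheaf_cat C)" and X: "X \<in> Obj C" and p: "p \<in> ob_map P X"
  shows "act P (Id C X) p = p"
proof -
  have "ar_map P (Id (op_cat C) X) = Id set_cat (ob_map P X)"
    using P X by (simp add: obj_presheaf_cat functors_def is_functor_def op_cat_def)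
  then show ?thesis using p by (simp add: op_cat_def set_cat_def act_def)
qed

lemma act_comp:
  assumes P: "P \<in> Obj (presheaf_cat C)" and f: "f \<in> hom C X Y" and g: "g \<in> hom C Y Z"
    and p: "p \<in> ob_map P Z"
  shows "act P (Comp C g f) p = act P f (act P g p)"
proof -
  have F: "is_functor (op_cat C) set_cat P" using P by (simp add: obj_presheaf_cat functors_def)
  have "f \<in> hom (op_cat C) Y X" "g \<in> hom (op_cat C) Z Y"
    using f g by (auto simp: op_cat_def hom_def)
  from functor_comp[OF F this(2,1)]
  have "ar_map P (Comp C g f) = Comp set_cat (ar_map P f) (ar_map P g)"
    by (simp add: op_cat_def)
  then have "snd (snd (ar_map P (Comp C g f))) = compose (ob_map P Z) (act P f) (act P g)"
    using presheaf_ar_map(1)[OF P f] presheaf_ar_map(1)[OF P g] by (simp add: set_cat_def)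
  then show ?thesis using p unfolding act_def[of P "Comp C g f"] by (simp add: compose_eq)
qed

section \<open>Presheaves and their maps from data on elements\<close>

definition mk_presheaf ::
  "('o, 'v) category \<Rightarrow> ('o \<Rightarrow> 'v set) \<Rightarrow> ('v \<Rightarrow> 'v \<Rightarrow> 'v) \<Rightarrow> ('o, 'v) presheaf" where
  "mk_presheaf C S a = \<lparr>ob_map = (\<lambda>X\<in>Obj C. S X),
     ar_map = (\<lambda>f\<in>Arr C. (S (Cod C f), S (Dom C f), \<lambda>p\<in>S (Cod C f). a f p))\<rparr>"

lemma ob_map_mk_presheaf: "X \<in> Obj C \<Longrightarrow> ob_map (mk_presheaf C S a) X = S X"
  by (simp add: mk_presheaf_def)

lemma act_mk_presheaf: "\<lbrakk>f \<in> hom C X Y; p \<in> S Y\<rbrakk> \<Longrightarrow> act (mk_presheaf C S a) f p = a f p"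
  by (auto simp: mk_presheaf_def act_def hom_def)

lemma mk_presheaf_obj:
  assumes C: "is_category C"
    and sm: "\<And>X. X \<in> Obj C \<Longrightarrow> small (S X)"
    and a: "\<And>f X Y p. \<lbrakk>f \<in> hom C X Y; p \<in> S Y\<rbrakk> \<Longrightarrow> a f p \<in> S X"
    and id: "\<And>X p. \<lbrakk>X \<in> Obj C; p \<in> S X\<rbrakk> \<Longrightarrow> a (Id C X) p = p"
    and comp: "\<And>f g X Y Z p. \<lbrakk>f \<in> hom C X Y; g \<in> hom C Y Z; p \<in> S Z\<rbrakk> \<Longrightarrow>
      a (Comp C g f) p = a f (a g p)"
  shows "mk_presheaf C S a \<in> Obj (presheaf_cat C)"
proof -
  let ?P = "mk_presheaf C S a"
  have ob: "Dom C f \<in> Obj C" "Cod C f \<in> Obj C" if "f \<in> Arr C" for f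
    using C that unfolding is_category_def by auto
  have "is_functor (op_cat C) set_cat ?P"
    unfolding is_functor_def
  proof (intro conjI ballI impI)
    show "is_category (op_cat C)" using is_category_op_cat[OF C] .
    show "is_category set_cat" by (rule is_category_set_cat)
    fix X assume "X \<in> Obj (op_cat C)"
    then have X: "X \<in> Obj C" by (simp add: op_cat_def)
    show "ob_map ?P X \<in> Obj set_cat" using X sm by (simp add: mk_presheaf_def set_cat_def)
    show "ar_map ?P (Id (op_cat C) X) = Id set_cat (ob_map ?P X)"
      using X id[OF X] id_in_hom[OF C X]
      by (auto simp: mk_presheaf_def op_cat_def set_cat_def hom_def restrict_def fun_eq_iff)
  next
    fix f assume "f \<in> Arr (op_cat C)"
    then have f: "f \<in> Arr C" by (simp add: op_cat_def)
    show "ar_map ?P f \<in> hom set_cat (ob_map ?P (Dom (op_cat C) f)) (ob_map ?P (Cod (op_cat C) f))"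
      using f ob[OF f] sm a[OF arr_in_hom[OF f]] by (auto simp: mk_presheaf_def op_cat_def hom_set_cat)
    fix g assume "g \<in> Arr (op_cat C)" and "Dom (op_cat C) g = Cod (op_cat C) f"
    then have g: "g \<in> Arr C" and gf: "Dom C f = Cod C g" by (simp_all add: op_cat_def)
    have g': "g \<in> hom C (Dom C g) (Dom C f)" using arr_in_hom[OF g] gf by simp
    have fg: "Comp C f g \<in> hom C (Dom C g) (Cod C f)"
      using comp_in_hom[OF C g' arr_in_hom[OF f]] .
    show "ar_map ?P (Comp (op_cat C) g f) = Comp set_cat (ar_map ?P g) (ar_map ?P f)"
      using f g gf fg comp[OF g' arr_in_hom[OF f]] a[OF arr_in_hom[OF f]]
      by (auto simp: mk_presheaf_def op_cat_def set_cat_def hom_def compose_def restrict_def fun_eq_iff)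
  qed
  then show ?thesis
    by (simp add: obj_presheaf_cat functors_def mk_presheaf_def op_cat_def)
qed

definition mk_map ::
  "('o, 'v) category \<Rightarrow> ('o, 'v) presheaf \<Rightarrow> ('o, 'v) presheaf \<Rightarrow> ('o \<Rightarrow> 'v \<Rightarrow> 'v) \<Rightarrow>
    ('o, 'v) presheaf_map" where
  "mk_map C P Q t = (P, Q, \<lambda>X\<in>Obj C. (ob_map P X, ob_map Q X, \<lambda>p\<in>ob_map P X. t X p))"

lemma app_mk_map: "\<lbrakk>X \<in> Obj C; p \<in> ob_map P X\<rbrakk> \<Longrightarrow> app (mk_map C P Q t) X p = t X p"
  by (simp add: mk_map_def app_def)

lemma mk_map_in_hom:
  assumes C: "is_category C" and P: "P \<in> Obj (presheaf_cat C)" and Q: "Q \<in> Obj (presheaf_cat C)"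
    and t: "\<And>X p. \<lbrakk>X \<in> Obj C; p \<in> ob_map P X\<rbrakk> \<Longrightarrow> t X p \<in> ob_map Q X"
    and nat: "\<And>f X Y p. \<lbrakk>f \<in> hom C X Y; p \<in> ob_map P Y\<rbrakk> \<Longrightarrow> t X (act P f p) = act Q f (t Y p)"
  shows "mk_map C P Q t \<in> hom (presheaf_cat C) P Q"
proof -
  have "natural (op_cat C) set_cat P Q
      (\<lambda>X\<in>Obj C. (ob_map P X, ob_map Q X, \<lambda>p\<in>ob_map P X. t X p))"
    unfolding natural_def
  proof (intro conjI ballI)
    fix X assume "X \<in> Obj (op_cat C)"
    then have X: "X \<in> Obj C" by (simp add: op_cat_def)
    then show "(\<lambda>X\<in>Obj C. (ob_map P X, ob_map Q X, \<lambda>p\<in>ob_map P X. t X p)) X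
        \<in> hom set_cat (ob_map P X) (ob_map Q X)"
      using t presheaf_small[OF P X] presheaf_small[OF Q X] by (auto simp: hom_set_cat)
  next
    fix f assume "f \<in> Arr (op_cat C)"
    then have f: "f \<in> hom C (Dom C f) (Cod C f)" by (simp add: op_cat_def hom_def)
    show "Comp set_cat ((\<lambda>X\<in>Obj C. (ob_map P X, ob_map Q X, \<lambda>p\<in>ob_map P X. t X p)) (Cod (op_cat C) f))
          (ar_map P f) =
        Comp set_cat (ar_map Q f)
          ((\<lambda>X\<in>Obj C. (ob_map P X, ob_map Q X, \<lambda>p\<in>ob_map P X. t X p)) (Dom (op_cat C) f))"
      using hom_objects[OF C f] nat[OF f] act_in[OF P f]
        presheaf_ar_map(1)[OF P f] presheaf_ar_map(1)[OF Q f]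
      by (auto simp: op_cat_def set_cat_def compose_def restrict_def fun_eq_iff)
  qed
  then show ?thesis
    using P[unfolded obj_presheaf_cat] Q[unfolded obj_presheaf_cat]
    unfolding mk_map_def presheaf_cat_def hom_functor_cat by (simp add: op_cat_def)
qed

text \<open>Extensionality of transformations and of functions in \<open>set_cat\<close> leaves no
  junk values, so a map is recovered from its action on elements. This justifies equality tests by
  \<open>app\<close> alone.\<close>

lemma presheaf_map_eq:
  assumes h: "h \<in> hom (presheaf_cat C) P Q"
  shows "h = mk_map C P Q (app h)"
    and "natural (op_cat C) set_cat P Q (snd (snd h))"
    and "X \<in> Obj C \<Longrightarrow> app h X \<in> ob_map P X \<rightarrow>\<^sub>E ob_map Q X"
proof -
  obtain \<tau> where \<tau>: "h = (P, Q, \<tau>)" "natural (op_cat C) set_cat P Q \<tau>" "\<tau> \<in> extensional (Obj C)"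
    using h by (cases h) (auto simp: presheaf_cat_def hom_functor_cat op_cat_def)
  have \<tau>X: "\<tau> X = (ob_map P X, ob_map Q X, app h X) \<and> app h X \<in> ob_map P X \<rightarrow>\<^sub>E ob_map Q X"
    if "X \<in> Obj C" for X
  proof -
    have "\<tau> X \<in> hom set_cat (ob_map P X) (ob_map Q X)"
      using \<tau>(2) that by (simp add: natural_def op_cat_def)
    then show ?thesis by (cases "\<tau> X") (simp add: hom_set_cat app_def \<tau>(1))
  qed
  then have "\<tau> = (\<lambda>X\<in>Obj C. (ob_map P X, ob_map Q X, \<lambda>p\<in>ob_map P X. app h X p))"
    using \<tau>(3) by (intro extensionalityI[where A = "Obj C"])
      (auto simp: PiE_def extensional_restrict)
  then show "h = mk_map C P Q (app h)" by (simp add: mk_map_def \<tau>(1))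
  show "natural (op_cat C) set_cat P Q (snd (snd h))" using \<tau> by simp
  show "app h X \<in> ob_map P X \<rightarrow>\<^sub>E ob_map Q X" if "X \<in> Obj C" using \<tau>X[OF that] by simp
qed

lemma app_in:
  "\<lbrakk>h \<in> hom (presheaf_cat C) P Q; X \<in> Obj C; p \<in> ob_map P X\<rbrakk> \<Longrightarrow> app h X p \<in> ob_map Q X"
  using presheaf_map_eq(3) by fastforce

lemma app_act:
  assumes C: "is_category C" and h: "h \<in> hom (presheaf_cat C) P Q"
    and f: "f \<in> hom C X Y" and p: "p \<in> ob_map P Y"
  shows "app h X (act P f p) = act Q f (app h Y p)"
proof -
  have P: "P \<in> Obj (presheaf_cat C)" and Q: "Q \<in> Obj (presheaf_cat C)"
    using hom_objects[OF is_category_presheaf_cat[OF C] h] by auto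
  have XY: "X \<in> Obj C" "Y \<in> Obj C" using hom_objects[OF C f] by auto
  have h2: "snd (snd h) Z = (ob_map P Z, ob_map Q Z, app h Z)" if "Z \<in> Obj C" for Z
    using arg_cong[OF presheaf_map_eq(1)[OF h], of "\<lambda>h. snd (snd h) Z"] that
      presheaf_map_eq(3)[OF h that]
    by (simp add: mk_map_def PiE_def extensional_restrict)
  have "Comp set_cat (snd (snd h) X) (ar_map P f) = Comp set_cat (ar_map Q f) (snd (snd h) Y)"
    using presheaf_map_eq(2)[OF h] f unfolding natural_def by (auto simp: op_cat_def hom_def)
  then have "compose (ob_map P Y) (app h X) (act P f) = compose (ob_map P Y) (act Q f) (app h Y)"
    unfolding h2[OF XY(1)] h2[OF XY(2)] presheaf_ar_map(1)[OF P f] presheaf_ar_map(1)[OF Q f]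
    by (simp add: set_cat_def)
  from fun_cong[OF this, of p] show ?thesis using p by (simp add: compose_eq)
qed

lemma presheaf_map_eqI:
  assumes "h \<in> hom (presheaf_cat C) P Q" "h' \<in> hom (presheaf_cat C) P Q"
    and "\<And>X p. \<lbrakk>X \<in> Obj C; p \<in> ob_map P X\<rbrakk> \<Longrightarrow> app h X p = app h' X p"
  shows "h = h'"
proof -
  have "mk_map C P Q (app h) = mk_map C P Q (app h')"
    using assms(3) by (auto simp: mk_map_def restrict_def fun_eq_iff)
  then show ?thesis
    using presheaf_map_eq(1)[OF assms(1)] presheaf_map_eq(1)[OF assms(2)] by simp
qed

lemma app_comp:
  assumes C: "is_category C" and g: "g \<in> hom (presheaf_cat C) P Q" and h: "h \<in> hom (presheaf_cat C) Q R"
    and X: "X \<in> Obj C" and p: "p \<in> ob_map P X"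
  shows "app (Comp (presheaf_cat C) h g) X p = app h X (app g X p)"
proof -
  have 1: "app (Comp (presheaf_cat C) (mk_map C Q R (app h)) (mk_map C P Q (app g))) X p =
      app h X (app g X p)"
    using X p app_in[OF g X p]
    by (simp add: presheaf_cat_def functor_cat_def mk_map_def app_def op_cat_def set_cat_def compose_eq)
  show ?thesis
    using 1 unfolding presheaf_map_eq(1)[OF h, symmetric] presheaf_map_eq(1)[OF g, symmetric] .
qed

section \<open>Representables and the Yoneda lemma\<close>

lemma ob_map_representable: "Y \<in> Obj C \<Longrightarrow> ob_map (representable C X) Y = hom C Y X"
  by (simp add: representable_def)

lemma act_representable:
  "\<lbrakk>f \<in> hom C Y Z; g \<in> hom C Z X\<rbrakk> \<Longrightarrow> act (representable C X) f g = Comp C g f"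
  by (auto simp: representable_def act_def hom_def)

lemma representable_obj:
  "\<lbrakk>locally_small C; X \<in> Obj C\<rbrakk> \<Longrightarrow> representable C X \<in> Obj (presheaf_cat C)"
  using representable_in_functors by (simp add: obj_presheaf_cat)

lemma ob_map_yoneda: "ob_map (yoneda C) X = representable C X"
  by (simp add: yoneda_def)

lemma app_yoneda:
  "\<lbrakk>u \<in> hom C Y Z; X \<in> Obj C; f \<in> hom C X Y\<rbrakk> \<Longrightarrow> app (ar_map (yoneda C) u) X f = Comp C u f"
  by (auto simp: yoneda_def app_def hom_def)

text \<open>Yoneda: \<open>f\<close> is the restriction along itself of the identity of
  \<open>X\<close>, so naturality determines \<open>h\<close> by its value at that identity.\<close>

lemma app_representable:
  assumes C: "locally_small C" and h: "h \<in> hom (presheaf_cat C) (representable C X) Q"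
    and f: "f \<in> hom C Y X"
  shows "app h Y f = act Q f (app h X (Id C X))"
proof -
  have cat: "is_category C" using C by (simp add: locally_small_def)
  have X: "X \<in> Obj C" using hom_objects[OF cat f] by simp
  show ?thesis
    using app_act[OF cat h f, of "Id C X"] X id_in_hom[OF cat X] comp_id_left[OF cat f]
    by (simp add: ob_map_representable act_representable[OF f])
qed


section \<open>Small sets\<close>

lemma infinite_UNIV_inaccessible:
  assumes "inaccessible TYPE('v)"
  shows "infinite (UNIV :: 'v set)"
  using assms unfolding inaccessible_def
  by (meson infinite_iff_natLeq_ordLeq ordLess_imp_ordLeq)

lemma finite_ordLess_UNIV:
  "\<lbrakk>infinite (UNIV :: 'v set); finite A\<rbrakk> \<Longrightarrow> |A| <o |UNIV :: 'v set|"
  by (rule finite_ordLess_infinite) (use card_of_well_order_on in \<open>auto simp: Field_card_of\<close>)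

text \<open>Regularity of the infinite cardinal of \<open>'v\<close> is used in the form
  \<open>stable\<close>, which bounds disjoint unions.\<close>

lemma ordLess_Sigma_inaccessible:
  assumes U: "inaccessible TYPE('v)"
    and I: "|I| <o |UNIV :: 'v set|" and A: "\<And>i. i \<in> I \<Longrightarrow> |A i| <o |UNIV :: 'v set|"
  shows "|Sigma I A| <o |UNIV :: 'v set|"
proof -
  have "stable |UNIV :: 'v set|"
    using U infinite_UNIV_inaccessible[OF U] unfolding inaccessible_def
    by (intro regularCard_stable) (auto simp: card_of_card_order_on Field_card_of)
  then show ?thesis by (rule stable_elim) (use I A in auto)
qed

text \<open>The strong limit clause speaks of subsets of \<open>'v\<close>, so \<open>A\<close>, of
  arbitrary type, is first injected into \<open>'v\<close>.\<close>

lemma ordLess_Pow_inaccessible: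
  assumes U: "inaccessible TYPE('v)" and A: "|A| <o |UNIV :: 'v set|"
  shows "|Pow A| <o |UNIV :: 'v set|"
proof -
  obtain f where f: "inj_on f A" "f ` A \<subseteq> (UNIV :: 'v set)"
    using ordLess_imp_ordLeq[OF A] unfolding card_of_ordLeq[symmetric] by blast
  have "small (f ` A)"
    unfolding small_def using card_of_image A ordLeq_ordLess_trans by blast
  then have "|Pow (f ` A)| <o |UNIV :: 'v set|" using U unfolding inaccessible_def by blast
  moreover have "|Pow A| \<le>o |Pow (f ` A)|"
    unfolding card_of_ordLeq[symmetric]
    using f(1) by (intro exI[of _ "image f"]) (auto simp: inj_on_image_Pow)
  ultimately show ?thesis by (rule ordLeq_ordLess_trans[rotated])
qed

text \<open>A function in the product is determined by its graph, which is a subset of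
  \<open>Sigma I A\<close>.\<close>

lemma ordLess_PiE_inaccessible:
  assumes U: "inaccessible TYPE('v)"
    and I: "|I| <o |UNIV :: 'v set|" and A: "\<And>i. i \<in> I \<Longrightarrow> |A i| <o |UNIV :: 'v set|"
  shows "|PiE I A| <o |UNIV :: 'v set|"
proof -
  have "inj_on (\<lambda>f. (\<lambda>i. (i, f i)) ` I) (PiE I A)"
  proof (rule inj_onI)
    fix f g assume f: "f \<in> PiE I A" and g: "g \<in> PiE I A"
      and eq: "(\<lambda>i. (i, f i)) ` I = (\<lambda>i. (i, g i)) ` I"
    have "f i = g i" if "i \<in> I" for i
    proof -
      have "(i, f i) \<in> (\<lambda>i. (i, g i)) ` I" using that unfolding eq[symmetric] by blast
      then show ?thesis by auto
    qed
    then show "f = g" using f g by (intro PiE_ext) auto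
  qed
  moreover have "(\<lambda>f. (\<lambda>i. (i, f i)) ` I) ` (PiE I A) \<subseteq> Pow (Sigma I A)" by auto
  ultimately have "|PiE I A| \<le>o |Pow (Sigma I A)|"
    unfolding card_of_ordLeq[symmetric] by blast
  then show ?thesis
    using ordLess_Pow_inaccessible[OF U ordLess_Sigma_inaccessible[OF U I A]]
    by (rule ordLeq_ordLess_trans)
qed

lemma obtain_pairing:
  assumes "infinite (UNIV :: 'v set)"
  obtains e :: "'v \<times> 'v \<Rightarrow> 'v" where "inj e"
proof -
  have "|UNIV :: ('v \<times> 'v) set| \<le>o |UNIV :: 'v set|"
    using card_of_Times_same_infinite[OF assms] ordIso_imp_ordLeq by auto
  then show ?thesis using that unfolding card_of_ordLeq[symmetric] by auto
qed


section \<open>Colimits of representables, element by element\<close>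

text \<open>Under Yoneda the elements \<open>x i\<close> are maps from representables to
  \<open>P\<close>; the second clause says that these maps are jointly epimorphic.\<close>

definition generates ::
  "('o, 'v) category \<Rightarrow> ('o, 'v) presheaf \<Rightarrow> 'i set \<Rightarrow> ('i \<Rightarrow> 'o) \<Rightarrow> ('i \<Rightarrow> 'v) \<Rightarrow> bool" where
  "generates C P I W x \<longleftrightarrow> (\<forall>i\<in>I. W i \<in> Obj C \<and> x i \<in> ob_map P (W i)) \<and>
     (\<forall>Q. \<forall>h\<in>hom (presheaf_cat C) P Q. \<forall>h'\<in>hom (presheaf_cat C) P Q.
        (\<forall>i\<in>I. app h (W i) (x i) = app h' (W i) (x i)) \<longrightarrow> h = h')"

definition compatible_elements ::
  "('j, 'k) category \<Rightarrow> ('j, 'k, 'o, 'v) cfunctor \<Rightarrow> ('o, 'v) presheaf \<Rightarrow> ('j \<Rightarrow> 'v) \<Rightarrow> bool" where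
  "compatible_elements J D P x \<longleftrightarrow> (\<forall>j\<in>Obj J. x j \<in> ob_map P (ob_map D j)) \<and>
     (\<forall>u\<in>Arr J. act P (ar_map D u) (x (Cod J u)) = x (Dom J u))"

text \<open>
  By the Yoneda lemma, a colimit cocone from \<open>yoneda C \<circ>\<^sub>F D\<close> to \<open>P\<close> is a universal compatible
  family of elements of \<open>P\<close>.
\<close>

definition universal_elements ::
  "('o, 'v) category \<Rightarrow> ('j, 'k) category \<Rightarrow> ('j, 'k, 'o, 'v) cfunctor \<Rightarrow> ('o, 'v) presheaf \<Rightarrow>
    ('j \<Rightarrow> 'v) \<Rightarrow> bool" where
  "universal_elements C J D P x \<longleftrightarrow> P \<in> Obj (presheaf_cat C) \<and> compatible_elements J D P x \<and>
     generates C P (Obj J) (ob_map D) x \<and>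
     (\<forall>Q\<in>Obj (presheaf_cat C). \<forall>y. compatible_elements J D Q y \<longrightarrow>
        (\<exists>h\<in>hom (presheaf_cat C) P Q. \<forall>j\<in>Obj J. app h (ob_map D j) (x j) = y j))"

text \<open>Evaluation at the generators embeds the hom-set into a small product of small sets. This
  is the source of local smallness of the test category.\<close>

lemma card_hom_presheaf_cat:
  fixes C :: "('o, 'v) category"
  assumes U: "inaccessible TYPE('v)" and I: "|I| <o |UNIV :: 'v set|"
    and gen: "generates C P I W x" and Q: "Q \<in> Obj (presheaf_cat C)"
  shows "|hom (presheaf_cat C) P Q| <o |UNIV :: 'v set|"
proof -
  let ?v = "\<lambda>h. \<lambda>i\<in>I. app h (W i) (x i)"
  have "inj_on ?v (hom (presheaf_cat C) P Q)"
  proof (rule inj_onI)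
    fix h h' assume h: "h \<in> hom (presheaf_cat C) P Q" "h' \<in> hom (presheaf_cat C) P Q"
      and eq: "?v h = ?v h'"
    have "app h (W i) (x i) = app h' (W i) (x i)" if "i \<in> I" for i
      using fun_cong[OF eq, of i] that by simp
    then show "h = h'" using gen h unfolding generates_def by blast
  qed
  moreover have "?v ` hom (presheaf_cat C) P Q \<subseteq> (\<Pi>\<^sub>E i\<in>I. ob_map Q (W i))"
    using gen app_in unfolding generates_def by fastforce
  ultimately have "|hom (presheaf_cat C) P Q| \<le>o |\<Pi>\<^sub>E i\<in>I. ob_map Q (W i)|"
    unfolding card_of_ordLeq[symmetric] by blast
  moreover have "|\<Pi>\<^sub>E i\<in>I. ob_map Q (W i)| <o |UNIV :: 'v set|"
    using presheaf_small[OF Q] gen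
    by (intro ordLess_PiE_inaccessible[OF U I]) (auto simp: small_def generates_def)
  ultimately show ?thesis by (rule ordLeq_ordLess_trans)
qed

lemma generates_representable:
  assumes C: "locally_small C" and X: "X \<in> Obj C"
  shows "generates C (representable C X) {i} (\<lambda>_. X) (\<lambda>_. Id C X)"
proof -
  have cat: "is_category C" using C by (simp add: locally_small_def)
  have "h = h'"
    if h: "h \<in> hom (presheaf_cat C) (representable C X) Q"
      "h' \<in> hom (presheaf_cat C) (representable C X) Q"
      and eq: "app h X (Id C X) = app h' X (Id C X)" for Q h h'
  proof (rule presheaf_map_eqI[OF h])
    fix Y f assume "Y \<in> Obj C" "f \<in> ob_map (representable C X) Y"
    then show "app h Y f = app h' Y f"
      using app_representable[OF C h(1), of f Y] app_representable[OF C h(2), of f Y] eq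
      by (simp add: ob_map_representable)
  qed
  then show ?thesis
    using X id_in_hom[OF cat X] by (simp add: generates_def ob_map_representable)
qed

lemma colimit_universal_elements:
  fixes C :: "('o, 'v) category"
  assumes C: "locally_small C" and D: "is_functor J C D"
    and P: "is_colimit_object J (presheaf_cat C) (yoneda C \<circ>\<^sub>F D) P"
  shows "\<exists>x. universal_elements C J D P x"
proof -
  let ?PC = "presheaf_cat C" and ?YD = "yoneda C \<circ>\<^sub>F D"
  have cat: "is_category C" using C by (simp add: locally_small_def)
  have PC: "is_category ?PC" using is_category_presheaf_cat[OF cat] .
  have J: "is_category J" using D by (simp add: is_functor_def)
  have YD: "is_functor J ?PC ?YD" using is_functor_comp[OF D is_functor_yoneda[OF C]] .
  obtain \<kappa> where col: "is_colimit J ?PC ?YD P \<kappa>"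
    using P unfolding is_colimit_object_def by auto
  then have \<kappa>: "cocone J ?PC ?YD P \<kappa>" unfolding is_colimit_def by auto
  then have P': "P \<in> Obj ?PC" unfolding cocone_def by auto
  have Dj: "ob_map D j \<in> Obj C" if "j \<in> Obj J" for j using functor_obj[OF D that] .
  have id: "Id C (ob_map D j) \<in> hom C (ob_map D j) (ob_map D j)" if "j \<in> Obj J" for j
    using id_in_hom[OF cat Dj[OF that]] .
  have leg: "\<mu> j \<in> hom ?PC (representable C (ob_map D j)) Q"
    if "cocone J ?PC ?YD Q \<mu>" "j \<in> Obj J" for Q \<mu> j
    using cocone_hom[OF that] by (simp add: ob_map_yoneda)
  \<comment> \<open>The element corresponding to the leg \<open>\<kappa> j\<close> under
    Yoneda.\<close>
  define x where "x j = app (\<kappa> j) (ob_map D j) (Id C (ob_map D j))" for j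
  have x_in: "x j \<in> ob_map P (ob_map D j)" if j: "j \<in> Obj J" for j
    using app_in[OF leg[OF \<kappa> j] Dj[OF j]] id[OF j] Dj[OF j]
    unfolding x_def by (simp add: ob_map_representable)
  have \<kappa>_app: "app (\<kappa> j) X f = act P f (x j)" if "j \<in> Obj J" "f \<in> hom C X (ob_map D j)" for j X f
    using app_representable[OF C leg[OF \<kappa> that(1)] that(2)] by (simp add: x_def)
  have "act P (ar_map D u) (x (Cod J u)) = x (Dom J u)" if "u \<in> Arr J" for u
  proof -
    have u: "u \<in> hom J (Dom J u) (Cod J u)" using that by (rule arr_in_hom)
    then have ob: "Dom J u \<in> Obj J" "Cod J u \<in> Obj J" using hom_objects[OF J] by auto
    have Du: "ar_map D u \<in> hom C (ob_map D (Dom J u)) (ob_map D (Cod J u))"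
      using functor_hom[OF D u] .
    have yu: "ar_map (yoneda C) (ar_map D u) \<in>
        hom ?PC (representable C (ob_map D (Dom J u))) (representable C (ob_map D (Cod J u)))"
      using functor_hom[OF is_functor_yoneda[OF C] Du] by (simp add: ob_map_yoneda)
    have "x (Dom J u) = app (Comp ?PC (\<kappa> (Cod J u)) (ar_map ?YD u)) (ob_map D (Dom J u)) (Id C (ob_map D (Dom J u)))"
      using cocone_arr[OF \<kappa> u] by (simp add: x_def)
    also have "\<dots> = app (\<kappa> (Cod J u)) (ob_map D (Dom J u)) (ar_map D u)"
      using app_comp[OF cat yu leg[OF \<kappa> ob(2)] Dj[OF ob(1)], of "Id C (ob_map D (Dom J u))"]
        app_yoneda[OF Du Dj[OF ob(1)] id[OF ob(1)]] id[OF ob(1)] comp_id_right[OF cat Du] Dj[OF ob(1)]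
      by (simp add: ob_map_representable)
    finally show ?thesis using \<kappa>_app[OF ob(2) Du] by simp
  qed
  then have comp: "compatible_elements J D P x" using x_in by (simp add: compatible_elements_def)
  have gen: "generates C P (Obj J) (ob_map D) x"
    unfolding generates_def
  proof (intro conjI ballI allI impI)
    fix Q h h' assume h: "h \<in> hom ?PC P Q" and h': "h' \<in> hom ?PC P Q"
      and eq: "\<forall>j\<in>Obj J. app h (ob_map D j) (x j) = app h' (ob_map D j) (x j)"
    have "Comp ?PC h (\<kappa> j) = Comp ?PC h' (\<kappa> j)" if j: "j \<in> Obj J" for j
    proof (rule presheaf_map_eqI[OF comp_in_hom[OF PC leg[OF \<kappa> j] h] comp_in_hom[OF PC leg[OF \<kappa> j] h']])
      fix X f assume X: "X \<in> Obj C" and f: "f \<in> ob_map (representable C (ob_map D j)) X"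
      then have f': "f \<in> hom C X (ob_map D j)" by (simp add: ob_map_representable)
      show "app (Comp ?PC h (\<kappa> j)) X f = app (Comp ?PC h' (\<kappa> j)) X f"
        using app_comp[OF cat leg[OF \<kappa> j] h X f] app_comp[OF cat leg[OF \<kappa> j] h' X f]
          \<kappa>_app[OF j f'] app_act[OF cat h f' x_in[OF j]] app_act[OF cat h' f' x_in[OF j]] eq j
        by simp
    qed
    \<comment> \<open>Both \<open>h\<close> and \<open>h'\<close> factor the cocone with legs
      \<open>h\<close> after \<open>\<kappa> j\<close>, so uniqueness identifies them.\<close>
    moreover have "\<exists>!k. k \<in> hom ?PC P Q \<and> (\<forall>j\<in>Obj J. Comp ?PC k (\<kappa> j) = Comp ?PC h (\<kappa> j))"
      using col cocone_comp[OF PC YD \<kappa> h] unfolding is_colimit_def by blast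
    ultimately show "h = h'" using h h' by metis
  qed (use x_in Dj in auto)
  have "\<exists>h\<in>hom ?PC P Q. \<forall>j\<in>Obj J. app h (ob_map D j) (x j) = y j"
    if Q: "Q \<in> Obj ?PC" and y: "compatible_elements J D Q y" for Q y
  proof -
    have y_in: "y j \<in> ob_map Q (ob_map D j)" if "j \<in> Obj J" for j
      using y that by (simp add: compatible_elements_def)
    \<comment> \<open>Yoneda in the other direction: \<open>y j\<close> becomes the map sending an
      arrow \<open>f\<close> to the restriction of \<open>y j\<close> along
      \<open>f\<close>.\<close>
    define \<mu> where "\<mu> j = mk_map C (representable C (ob_map D j)) Q (\<lambda>X f. act Q f (y j))" for j
    have \<mu>: "\<mu> j \<in> hom ?PC (representable C (ob_map D j)) Q" if j: "j \<in> Obj J" for j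
      unfolding \<mu>_def
    proof (rule mk_map_in_hom[OF cat representable_obj[OF C Dj[OF j]] Q])
      fix X f assume "X \<in> Obj C" "f \<in> ob_map (representable C (ob_map D j)) X"
      then show "act Q f (y j) \<in> ob_map Q X"
        using act_in[OF Q _ y_in[OF j]] by (simp add: ob_map_representable)
    next
      fix f X Y g assume f: "f \<in> hom C X Y" and "g \<in> ob_map (representable C (ob_map D j)) Y"
      then have g: "g \<in> hom C Y (ob_map D j)"
        using hom_objects[OF cat f] by (simp add: ob_map_representable)
      show "act Q (act (representable C (ob_map D j)) f g) (y j) = act Q f (act Q g (y j))"
        using act_comp[OF Q f g y_in[OF j]] act_representable[OF f g] by simp
    qed
    have \<mu>_app: "app (\<mu> j) X f = act Q f (y j)" if "X \<in> Obj C" "f \<in> hom C X (ob_map D j)" for X f j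
      using that by (simp add: \<mu>_def app_mk_map ob_map_representable)
    have "cocone J ?PC ?YD Q \<mu>"
      unfolding cocone_def
    proof (intro conjI ballI)
      show "Q \<in> Obj ?PC" by (rule Q)
      show "\<mu> j \<in> hom ?PC (ob_map ?YD j) Q" if "j \<in> Obj J" for j
        using \<mu>[OF that] by (simp add: ob_map_yoneda)
      fix u assume u': "u \<in> Arr J"
      have u: "u \<in> hom J (Dom J u) (Cod J u)" using u' by (rule arr_in_hom)
      then have ob: "Dom J u \<in> Obj J" "Cod J u \<in> Obj J" using hom_objects[OF J] by auto
      have Du: "ar_map D u \<in> hom C (ob_map D (Dom J u)) (ob_map D (Cod J u))"
        using functor_hom[OF D u] .
      have yu: "ar_map ?YD u \<in>
          hom ?PC (representable C (ob_map D (Dom J u))) (representable C (ob_map D (Cod J u)))"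
        using functor_hom[OF is_functor_yoneda[OF C] Du] by (simp add: ob_map_yoneda)
      show "Comp ?PC (\<mu> (Cod J u)) (ar_map ?YD u) = \<mu> (Dom J u)"
      proof (rule presheaf_map_eqI[OF comp_in_hom[OF PC yu \<mu>[OF ob(2)]] \<mu>[OF ob(1)]])
        fix X f assume X: "X \<in> Obj C" and f: "f \<in> ob_map (representable C (ob_map D (Dom J u))) X"
        then have f': "f \<in> hom C X (ob_map D (Dom J u))" by (simp add: ob_map_representable)
        have "app (Comp ?PC (\<mu> (Cod J u)) (ar_map ?YD u)) X f = act Q (Comp C (ar_map D u) f) (y (Cod J u))"
          using app_comp[OF cat yu \<mu>[OF ob(2)] X f] app_yoneda[OF Du X f']
            \<mu>_app[OF X comp_in_hom[OF cat f' Du]] by simp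
        also have "\<dots> = app (\<mu> (Dom J u)) X f"
          using act_comp[OF Q f' Du y_in[OF ob(2)]] y u' \<mu>_app[OF X f']
          by (simp add: compatible_elements_def)
        finally show "app (Comp ?PC (\<mu> (Cod J u)) (ar_map ?YD u)) X f = app (\<mu> (Dom J u)) X f" .
      qed
    qed
    then obtain h where h: "h \<in> hom ?PC P Q" "\<forall>j\<in>Obj J. Comp ?PC h (\<kappa> j) = \<mu> j"
      using col unfolding is_colimit_def by blast
    have "app h (ob_map D j) (x j) = y j" if j: "j \<in> Obj J" for j
      using app_comp[OF cat leg[OF \<kappa> j] h(1) Dj[OF j], of "Id C (ob_map D j)"] h(2) j
        \<mu>_app[OF Dj[OF j] id[OF j]] act_id[OF Q Dj[OF j] y_in[OF j]] id[OF j] Dj[OF j]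
      by (simp add: ob_map_representable x_def)
    then show ?thesis using h(1) by blast
  qed
  then show ?thesis using P' comp gen unfolding universal_elements_def by blast
qed

text \<open>
  A map from \<open>P\<close> to the presheaf \<open>\<lambda>Y. Pow (hom C X Y)\<close> is the same as a subset of \<open>ob_map P X\<close>;
  testing a colimit against it shows what the elements of the colimit at \<open>X\<close> are.
\<close>

lemma obtain_power_presheaf:
  fixes C :: "('o, 'v) category"
  assumes U: "inaccessible TYPE('v)" and C: "locally_small C" and X: "X \<in> Obj C"
  obtains Q and e :: "'o \<Rightarrow> 'v set \<Rightarrow> 'v" where
    "Q \<in> Obj (presheaf_cat C)"
    "\<And>Y. Y \<in> Obj C \<Longrightarrow> ob_map Q Y = e Y ` Pow (hom C X Y)"
    "\<And>Y. Y \<in> Obj C \<Longrightarrow> inj_on (e Y) (Pow (hom C X Y))"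
    "\<And>g Y Z B. \<lbrakk>g \<in> hom C Y Z; B \<subseteq> hom C X Z\<rbrakk> \<Longrightarrow>
       act Q g (e Z B) = e Y {k \<in> hom C X Y. Comp C g k \<in> B}"
proof -
  have cat: "is_category C" using C by (simp add: locally_small_def)
  have pow: "|Pow (hom C X Y)| <o |UNIV :: 'v set|" if "Y \<in> Obj C" for Y
    using C X that by (intro ordLess_Pow_inaccessible[OF U]) (auto simp: locally_small_def small_def)
  \<comment> \<open>Values of a presheaf are subsets of \<open>'v\<close>, so sets of arrows must be
    coded as single elements of \<open>'v\<close>. There is room because power sets of small sets
    are small.\<close>
  have "\<exists>e. inj_on e (Pow (hom C X Y)) \<and> e ` Pow (hom C X Y) \<subseteq> (UNIV :: 'v set)"
    if "Y \<in> Obj C" for Y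
    unfolding card_of_ordLeq using ordLess_imp_ordLeq[OF pow[OF that]] .
  then obtain e :: "'o \<Rightarrow> 'v set \<Rightarrow> 'v" where inj: "inj_on (e Y) (Pow (hom C X Y))" if "Y \<in> Obj C" for Y
    by metis
  define d where "d Y = inv_into (Pow (hom C X Y)) (e Y)" for Y
  have d: "d Y (e Y B) = B" if "Y \<in> Obj C" "B \<subseteq> hom C X Y" for Y B
    unfolding d_def using inj[OF that(1)] that(2) by (simp add: inv_into_f_f)
  \<comment> \<open>Restriction along \<open>g\<close> is the preimage under composition with
    \<open>g\<close>, transported through the coding.\<close>
  define a where "a g p = e (Dom C g) {k \<in> hom C X (Dom C g). Comp C g k \<in> d (Cod C g) p}" for g p
  have a: "a g (e Z B) = e Y {k \<in> hom C X Y. Comp C g k \<in> B}"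
    if g: "g \<in> hom C Y Z" and B: "B \<subseteq> hom C X Z" for g Y Z B
  proof -
    have "Z \<in> Obj C" "Dom C g = Y" "Cod C g = Z" using hom_objects[OF cat g] g by (auto simp: hom_def)
    then show ?thesis using d[OF _ B] by (simp add: a_def)
  qed
  define Q where "Q = mk_presheaf C (\<lambda>Y. e Y ` Pow (hom C X Y)) a"
  have "Q \<in> Obj (presheaf_cat C)"
    unfolding Q_def
  proof (rule mk_presheaf_obj[OF cat])
    show "small (e Y ` Pow (hom C X Y))" if "Y \<in> Obj C" for Y
      unfolding small_def using card_of_image pow[OF that] ordLeq_ordLess_trans by blast
    show "a f p \<in> e Y ` Pow (hom C X Y)" if "f \<in> hom C Y Z" "p \<in> e Z ` Pow (hom C X Z)" for f Y Z p
      using that a by auto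
    show "a (Id C Y) p = p" if Y: "Y \<in> Obj C" and p: "p \<in> e Y ` Pow (hom C X Y)" for Y p
    proof -
      obtain B where B: "p = e Y B" "B \<subseteq> hom C X Y" using p by auto
      have "{k \<in> hom C X Y. Comp C (Id C Y) k \<in> B} = B"
        using comp_id_left[OF cat, of _ X Y] B(2) by auto
      then show ?thesis using a[OF id_in_hom[OF cat Y] B(2)] B(1) by simp
    qed
    show "a (Comp C g f) p = a f (a g p)"
      if f: "f \<in> hom C Y Z" and g: "g \<in> hom C Z W" and p: "p \<in> e W ` Pow (hom C X W)" for f g Y Z W p
    proof -
      obtain B where B: "p = e W B" "B \<subseteq> hom C X W" using p by auto
      have "{k \<in> hom C X Y. Comp C (Comp C g f) k \<in> B} =
          {k \<in> hom C X Y. Comp C f k \<in> {k \<in> hom C X Z. Comp C g k \<in> B}}"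
        using category_comp_assoc[OF cat _ f g, of _ X] comp_in_hom[OF cat _ f, of _ X] by auto
      then show ?thesis
        using a[OF comp_in_hom[OF cat f g] B(2)] a[OF g B(2)]
          a[OF f, of "{k \<in> hom C X Z. Comp C g k \<in> B}"] B(1) by simp
    qed
  qed
  moreover have "ob_map Q Y = e Y ` Pow (hom C X Y)" if "Y \<in> Obj C" for Y
    using that by (simp add: Q_def ob_map_mk_presheaf)
  moreover have "act Q g (e Z B) = e Y {k \<in> hom C X Y. Comp C g k \<in> B}"
    if "g \<in> hom C Y Z" "B \<subseteq> hom C X Z" for g Y Z B
    using act_mk_presheaf[OF that(1), of "e Z B" "\<lambda>Y. e Y ` Pow (hom C X Y)" a] a[OF that] that(2)
    by (simp add: Q_def)
  ultimately show ?thesis using that inj by blast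
qed

text \<open>An arrow in the category of elements of the functor taking \<open>j\<close> to
  \<open>hom C X (ob_map D j)\<close>; the connected components of that category are the elements at
  \<open>X\<close> of the pointwise colimit.\<close>

definition generator_step ::
  "('o, 'm) category \<Rightarrow> ('j, 'k) category \<Rightarrow> ('j, 'k, 'o, 'm) cfunctor \<Rightarrow> 'o \<Rightarrow>
    'j \<times> 'm \<Rightarrow> 'j \<times> 'm \<Rightarrow> bool" where
  "generator_step C J D X = (\<lambda>(j, f) (j', f'). \<exists>u\<in>hom J j j'. f \<in> hom C X (ob_map D j) \<and>
     f' = Comp C (ar_map D u) f)"

text \<open>Let \<open>A\<close> collect all restrictions of generators to \<open>X\<close>. The
  characteristic maps of \<open>A\<close> and of the full set agree on every generator, hence are
  equal, so nothing at \<open>X\<close> lies outside \<open>A\<close>.\<close>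

lemma universal_elements_exhaust:
  fixes C :: "('o, 'v) category"
  assumes U: "inaccessible TYPE('v)" and C: "locally_small C"
    and x: "universal_elements C J D P x" and X: "X \<in> Obj C" and p: "p \<in> ob_map P X"
  shows "\<exists>j\<in>Obj J. \<exists>f\<in>hom C X (ob_map D j). p = act P f (x j)"
proof -
  have cat: "is_category C" using C by (simp add: locally_small_def)
  have P: "P \<in> Obj (presheaf_cat C)" using x by (simp add: universal_elements_def)
  obtain Q and e :: "'o \<Rightarrow> 'v set \<Rightarrow> 'v" where Q: "Q \<in> Obj (presheaf_cat C)"
    and Qob: "\<And>Y. Y \<in> Obj C \<Longrightarrow> ob_map Q Y = e Y ` Pow (hom C X Y)"
    and inj: "\<And>Y. Y \<in> Obj C \<Longrightarrow> inj_on (e Y) (Pow (hom C X Y))"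
    and Qact: "\<And>g Y Z B. \<lbrakk>g \<in> hom C Y Z; B \<subseteq> hom C X Z\<rbrakk> \<Longrightarrow>
       act Q g (e Z B) = e Y {k \<in> hom C X Y. Comp C g k \<in> B}"
    using obtain_power_presheaf[OF U C X] by blast
  define A where "A = {act P f (x j) | j f. j \<in> Obj J \<and> f \<in> hom C X (ob_map D j)}"
  \<comment> \<open>The characteristic map of \<open>B\<close>: an element \<open>q\<close> over
    \<open>Y\<close> goes to the set of arrows from \<open>X\<close> along which it restricts into
    \<open>B\<close>.\<close>
  define s where "s B Y q = e Y {k \<in> hom C X Y. act P k q \<in> B}" for B Y q
  have s: "mk_map C P Q (s B) \<in> hom (presheaf_cat C) P Q" for B
  proof (rule mk_map_in_hom[OF cat P Q])
    show "s B Y q \<in> ob_map Q Y" if "Y \<in> Obj C" for Y q using Qob[OF that] by (auto simp: s_def)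
    fix f Y Z q assume f: "f \<in> hom C Y Z" and q: "q \<in> ob_map P Z"
    have "{k \<in> hom C X Y. act P k (act P f q) \<in> B} =
        {k \<in> hom C X Y. Comp C f k \<in> {k \<in> hom C X Z. act P k q \<in> B}}"
      using act_comp[OF P _ f q, of _ X] comp_in_hom[OF cat _ f, of _ X] by auto
    then show "s B Y (act P f q) = act Q f (s B Z q)"
      using Qact[OF f, of "{k \<in> hom C X Z. act P k q \<in> B}"] by (simp add: s_def)
  qed
  have "mk_map C P Q (s A) = mk_map C P Q (s UNIV)"
  proof -
    have gen: "generates C P (Obj J) (ob_map D) x" using x by (simp add: universal_elements_def)
    have "app (mk_map C P Q (s A)) (ob_map D j) (x j) = app (mk_map C P Q (s UNIV)) (ob_map D j) (x j)"
      if j: "j \<in> Obj J" for j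
    proof -
      have "{k \<in> hom C X (ob_map D j). act P k (x j) \<in> A} = {k \<in> hom C X (ob_map D j). act P k (x j) \<in> UNIV}"
        using j unfolding A_def by blast
      then show ?thesis
        using gen j unfolding generates_def by (simp add: app_mk_map s_def)
    qed
    then show ?thesis using gen s unfolding generates_def by blast
  qed
  then have "s A X p = s UNIV X p"
    using app_mk_map[OF X p, of Q "s A"] app_mk_map[OF X p, of Q "s UNIV"] by simp
  then have "{k \<in> hom C X X. act P k p \<in> A} = hom C X X"
    using inj_onD[OF inj[OF X], of "{k \<in> hom C X X. act P k p \<in> A}" "hom C X X"] by (auto simp: s_def)
  \<comment> \<open>Membership of \<open>p\<close> itself is tested by the identity arrow.\<close>
  then have "act P (Id C X) p \<in> A" using id_in_hom[OF cat X] by blast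
  then show ?thesis using act_id[OF P X p] unfolding A_def by auto
qed

text \<open>The zigzag class of \<open>(j, f)\<close> is a compatible family of sets of arrows,
  hence induces a map out of \<open>P\<close>. This map cannot separate equal elements, so the class
  of \<open>(j, f)\<close> also contains \<open>(j', f')\<close>.\<close>

lemma universal_elements_eq_imp:
  fixes C :: "('o, 'v) category"
  assumes U: "inaccessible TYPE('v)" and C: "locally_small C" and D: "is_functor J C D"
    and x: "universal_elements C J D P x"
    and j: "j \<in> Obj J" "f \<in> hom C X (ob_map D j)" and j': "j' \<in> Obj J" "f' \<in> hom C X (ob_map D j')"
    and eq: "act P f (x j) = act P f' (x j')"
  shows "equivclp (generator_step C J D X) (j, f) (j', f')"
proof -
  have cat: "is_category C" using C by (simp add: locally_small_def)
  have J: "is_category J" using D by (simp add: is_functor_def)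
  have X: "X \<in> Obj C" using hom_objects[OF cat j(2)] by simp
  have x_in: "x i \<in> ob_map P (ob_map D i)" if "i \<in> Obj J" for i
    using x that by (simp add: universal_elements_def compatible_elements_def)
  obtain Q and e :: "'o \<Rightarrow> 'v set \<Rightarrow> 'v" where Q: "Q \<in> Obj (presheaf_cat C)"
    and Qob: "\<And>Y. Y \<in> Obj C \<Longrightarrow> ob_map Q Y = e Y ` Pow (hom C X Y)"
    and inj: "\<And>Y. Y \<in> Obj C \<Longrightarrow> inj_on (e Y) (Pow (hom C X Y))"
    and Qact: "\<And>g Y Z B. \<lbrakk>g \<in> hom C Y Z; B \<subseteq> hom C X Z\<rbrakk> \<Longrightarrow>
       act Q g (e Z B) = e Y {k \<in> hom C X Y. Comp C g k \<in> B}"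
    using obtain_power_presheaf[OF U C X] by blast
  define \<chi> where "\<chi> i = {k \<in> hom C X (ob_map D i). equivclp (generator_step C J D X) (j, f) (i, k)}" for i
  have \<chi>_sub: "\<chi> i \<subseteq> hom C X (ob_map D i)" for i by (auto simp: \<chi>_def)
  have "compatible_elements J D Q (\<lambda>i. e (ob_map D i) (\<chi> i))"
    unfolding compatible_elements_def
  proof (intro conjI ballI)
    show "e (ob_map D i) (\<chi> i) \<in> ob_map Q (ob_map D i)" if "i \<in> Obj J" for i
      using Qob[OF functor_obj[OF D that]] \<chi>_sub by auto
    fix u assume "u \<in> Arr J"
    then have u: "u \<in> hom J (Dom J u) (Cod J u)" by (rule arr_in_hom)
    note Du = functor_hom[OF D u]
    \<comment> \<open>A zigzag class is closed under steps in both directions; that is precisely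
      compatibility of the sets \<open>\<chi> i\<close>.\<close>
    have "{k \<in> hom C X (ob_map D (Dom J u)). Comp C (ar_map D u) k \<in> \<chi> (Cod J u)} = \<chi> (Dom J u)"
    proof -
      have "equivclp (generator_step C J D X) (j, f) (Dom J u, k) \<longleftrightarrow>
          equivclp (generator_step C J D X) (j, f) (Cod J u, Comp C (ar_map D u) k)"
        if "k \<in> hom C X (ob_map D (Dom J u))" for k
      proof -
        have "generator_step C J D X (Dom J u, k) (Cod J u, Comp C (ar_map D u) k)"
          using that u by (auto simp: generator_step_def)
        then have "equivclp (generator_step C J D X) (Dom J u, k) (Cod J u, Comp C (ar_map D u) k)"
          by (rule r_into_equivclp)
        then show ?thesis using equivclp_sym equivclp_trans by metis
      qed
      then show ?thesis using comp_in_hom[OF cat _ Du, of _ X] by (auto simp: \<chi>_def)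
    qed
    then show "act Q (ar_map D u) (e (ob_map D (Cod J u)) (\<chi> (Cod J u))) = e (ob_map D (Dom J u)) (\<chi> (Dom J u))"
      using Qact[OF Du \<chi>_sub] by simp
  qed
  then obtain h where h: "h \<in> hom (presheaf_cat C) P Q"
    and hx: "\<forall>i\<in>Obj J. app h (ob_map D i) (x i) = e (ob_map D i) (\<chi> i)"
    using x Q unfolding universal_elements_def by blast
  have h_act: "app h X (act P k (x i)) = e X {l \<in> hom C X X. Comp C k l \<in> \<chi> i}"
    if "i \<in> Obj J" "k \<in> hom C X (ob_map D i)" for i k
    using app_act[OF cat h that(2) x_in[OF that(1)]] hx that(1) Qact[OF that(2) \<chi>_sub] by simp
  then have "e X {l \<in> hom C X X. Comp C f l \<in> \<chi> j} = e X {l \<in> hom C X X. Comp C f' l \<in> \<chi> j'}"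
    using h_act[OF j] h_act[OF j'] eq by simp
  then have "{l \<in> hom C X X. Comp C f l \<in> \<chi> j} = {l \<in> hom C X X. Comp C f' l \<in> \<chi> j'}"
    by (rule inj_onD[OF inj[OF X]]) auto
  \<comment> \<open>The identity lies in the left set because \<open>(j, f)\<close> is in its own
    class; moving it to the right set yields the claim.\<close>
  moreover have "Id C X \<in> {l \<in> hom C X X. Comp C f l \<in> \<chi> j}"
    using id_in_hom[OF cat X] comp_id_right[OF cat j(2)] j(2) by (simp add: \<chi>_def)
  ultimately have "Comp C f' (Id C X) \<in> \<chi> j'" by blast
  then show ?thesis using comp_id_right[OF cat j'(2)] by (simp add: \<chi>_def)
qed


section \<open>Small full subcategories of a category of elements\<close>

lemma obtain_triple_encoding:
  assumes "infinite (UNIV :: 'v set)"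
  obtains e :: "'v \<times> 'v \<times> 'v \<Rightarrow> 'v" where "inj e"
proof -
  obtain p :: "'v \<times> 'v \<Rightarrow> 'v" where p: "inj p" using obtain_pairing[OF assms] .
  have "inj (\<lambda>(a, b, c). p (a, p (b, c)))" by (intro injI) (auto simp: inj_eq[OF p])
  then show ?thesis by (rule that)
qed

text \<open>
  The full subcategory of the category of elements of \<open>P\<close> on the elements \<open>z a \<in> ob_map P (W a)\<close>
  for \<open>a \<in> I\<close>, with the arrow \<open>f : z a \<rightarrow> z b\<close> encoded as \<open>e (a, b, f)\<close>.
\<close>

definition elements_cat :: "('v, 'v) category \<Rightarrow> ('v, 'v) presheaf \<Rightarrow> ('v \<times> 'v \<times> 'v \<Rightarrow> 'v) \<Rightarrow>
    'v set \<Rightarrow> ('v \<Rightarrow> 'v) \<Rightarrow> ('v \<Rightarrow> 'v) \<Rightarrow> ('v, 'v) category" where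
  "elements_cat C P e I W z =
     \<lparr>Obj = I,
      Arr = e ` {(a, b, f). a \<in> I \<and> b \<in> I \<and> f \<in> hom C (W a) (W b) \<and> act P f (z b) = z a},
      Dom = (\<lambda>m. fst (inv e m)),
      Cod = (\<lambda>m. fst (snd (inv e m))),
      Id = (\<lambda>a. e (a, a, Id C (W a))),
      Comp = (\<lambda>n m. e (fst (inv e m), fst (snd (inv e n)),
                       Comp C (snd (snd (inv e n))) (snd (snd (inv e m)))))\<rparr>"

definition elements_proj :: "('v \<times> 'v \<times> 'v \<Rightarrow> 'v) \<Rightarrow> ('v \<Rightarrow> 'v) \<Rightarrow> ('v, 'v, 'v, 'v) cfunctor" where
  "elements_proj e W = \<lparr>ob_map = W, ar_map = (\<lambda>m. snd (snd (inv e m)))\<rparr>"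

lemma hom_elements_cat:
  assumes e: "inj e"
  shows "hom (elements_cat C P e I W z) a b =
    (if a \<in> I \<and> b \<in> I then {e (a, b, f) | f. f \<in> hom C (W a) (W b) \<and> act P f (z b) = z a} else {})"
  unfolding hom_def[of "elements_cat _ _ _ _ _ _"] by (auto simp: elements_cat_def inv_f_f[OF e])

text \<open>Functoriality of restriction makes the selected arrows closed under identities and
  composition. The endpoints are kept in the code because one arrow of \<open>C\<close> may underlie
  several arrows between elements.\<close>

lemma is_functor_elements_proj:
  assumes C: "is_category C" and P: "P \<in> Obj (presheaf_cat C)" and e: "inj e"
    and W: "\<And>a. a \<in> I \<Longrightarrow> W a \<in> Obj C" and z: "\<And>a. a \<in> I \<Longrightarrow> z a \<in> ob_map P (W a)"
  shows "is_functor (elements_cat C P e I W z) C (elements_proj e W)"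
proof -
  let ?T = "elements_cat C P e I W z"
  have arr: "\<exists>a b f. m = e (a, b, f) \<and> a \<in> I \<and> b \<in> I \<and> f \<in> hom C (W a) (W b) \<and> act P f (z b) = z a"
    if "m \<in> Arr ?T" for m
    using that by (auto simp: elements_cat_def)
  have dom: "Dom ?T (e (a, b, f)) = a" "Cod ?T (e (a, b, f)) = b" for a b f
    by (simp_all add: elements_cat_def inv_f_f[OF e])
  have comp: "Comp ?T (e (b', c, g)) (e (a, b, f)) = e (a, c, Comp C g f)" for a b b' c f g
    by (simp add: elements_cat_def inv_f_f[OF e])
  have ob: "Obj ?T = I" and id: "Id ?T a = e (a, a, Id C (W a))" for a
    by (simp_all add: elements_cat_def)
  have "is_category ?T"
    unfolding is_category_def
  proof (intro conjI ballI impI)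
    show "Dom ?T m \<in> Obj ?T" "Cod ?T m \<in> Obj ?T" if "m \<in> Arr ?T" for m
      using arr[OF that] by (auto simp: dom ob)
    show "Id ?T a \<in> hom ?T a a" if "a \<in> Obj ?T" for a
      using that id_in_hom[OF C W] act_id[OF P W z] by (auto simp: hom_elements_cat[OF e] id ob)
  next
    fix m n assume "m \<in> Arr ?T" "n \<in> Arr ?T" and eq: "Dom ?T n = Cod ?T m"
    then obtain a b f b' c g where m: "m = e (a, b, f)" "a \<in> I" "b \<in> I"
      "f \<in> hom C (W a) (W b)" "act P f (z b) = z a"
      and n: "n = e (b', c, g)" "c \<in> I" "g \<in> hom C (W b') (W c)" "act P g (z c) = z b'"
      using arr by metis
    have [simp]: "b' = b" using eq m(1) n(1) by (simp add: dom)
    have g: "g \<in> hom C (W b) (W c)" using n(3) by simp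
    show "Comp ?T n m \<in> hom ?T (Dom ?T m) (Cod ?T n)"
      using m n comp_in_hom[OF C m(4) g] act_comp[OF P m(4) g z[OF n(2)]]
      by (auto simp: hom_elements_cat[OF e] dom comp)
  next
    fix m assume "m \<in> Arr ?T"
    then obtain a b f where m: "m = e (a, b, f)" "f \<in> hom C (W a) (W b)" using arr by metis
    show "Comp ?T m (Id ?T (Dom ?T m)) = m" "Comp ?T (Id ?T (Cod ?T m)) m = m"
      using comp_id_right[OF C m(2)] comp_id_left[OF C m(2)] by (simp_all add: m(1) dom id comp)
  next
    fix m n k assume "m \<in> Arr ?T" "n \<in> Arr ?T" "k \<in> Arr ?T"
      and eq: "Dom ?T n = Cod ?T m" "Dom ?T k = Cod ?T n"
    then obtain a b f b' c g c' d h where m: "m = e (a, b, f)" "f \<in> hom C (W a) (W b)"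
      and n: "n = e (b', c, g)" "g \<in> hom C (W b') (W c)"
      and k: "k = e (c', d, h)" "h \<in> hom C (W c') (W d)"
      using arr by metis
    have [simp]: "b' = b" "c' = c" using eq by (simp_all add: m(1) n(1) k(1) dom)
    show "Comp ?T k (Comp ?T n m) = Comp ?T (Comp ?T k n) m"
      using category_comp_assoc[OF C m(2), of g "W c" h "W d"] n(2) k(2) by (simp add: m(1) n(1) k(1) comp)
  qed
  moreover have "ar_map (elements_proj e W) (e (a, b, f)) = f" for a b f
    by (simp add: elements_proj_def inv_f_f[OF e])
  ultimately show ?thesis
    unfolding is_functor_def using C W
    by (auto simp: ob id dom comp elements_proj_def[of e W] dest!: arr)
qed

lemma small_elements_cat:
  fixes C :: "('v, 'v) category"
  assumes U: "inaccessible TYPE('v)" and C: "locally_small C" and P: "P \<in> Obj (presheaf_cat C)"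
    and e: "inj e" and I: "small I"
    and W: "\<And>a. a \<in> I \<Longrightarrow> W a \<in> Obj C" and z: "\<And>a. a \<in> I \<Longrightarrow> z a \<in> ob_map P (W a)"
  shows "small_diagram C (elements_cat C P e I W z, elements_proj e W)"
proof -
  have cat: "is_category C" using C by (simp add: locally_small_def)
  let ?A = "SIGMA a:I. SIGMA b:I. hom C (W a) (W b)"
  have "|?A| <o |UNIV :: 'v set|"
    using I C W by (intro ordLess_Sigma_inaccessible[OF U]) (auto simp: small_def locally_small_def)
  then have "|e ` ?A| <o |UNIV :: 'v set|" using card_of_image ordLeq_ordLess_trans by blast
  moreover have "Arr (elements_cat C P e I W z) \<subseteq> e ` ?A" by (auto simp: elements_cat_def)
  ultimately have "small (Arr (elements_cat C P e I W z))"
    unfolding small_def using card_of_mono1 ordLeq_ordLess_trans by blast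
  then show ?thesis
    using is_functor_elements_proj[OF cat P e W z, of I] I
    by (simp add: small_diagram_def small_category_def is_functor_def[of "elements_cat _ _ _ _ _ _"])
      (simp add: elements_cat_def)
qed

text \<open>
  The comma category of \<open>z b\<close> over \<open>J\<close> consists of the ways to write \<open>z b\<close> as a restriction of
  some \<open>x j\<close>; that it is non-empty and connected is the description of the elements of a colimit.
\<close>

lemma elements_cat_confinal_arrow:
  fixes C J :: "('v, 'v) category"
  assumes U: "inaccessible TYPE('v)" and C: "locally_small C" and J: "small_diagram C (J, D)"
    and x: "universal_elements C J D P x" and e: "inj e" and I: "small I"
    and W: "\<And>a. a \<in> I \<Longrightarrow> W a \<in> Obj C" and z: "\<And>a. a \<in> I \<Longrightarrow> z a \<in> ob_map P (W a)"
    and \<iota>: "\<And>j. j \<in> Obj J \<Longrightarrow> \<iota> j \<in> I \<and> W (\<iota> j) = ob_map D j \<and> z (\<iota> j) = x j"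
  shows "confinal_arrow C (J, D) (elements_cat C P e I W z, elements_proj e W)"
proof -
  let ?T = "elements_cat C P e I W z"
  have cat: "is_category C" using C by (simp add: locally_small_def)
  have P: "P \<in> Obj (presheaf_cat C)" using x by (simp add: universal_elements_def)
  have D: "is_functor J C D" using J by (simp add: small_diagram_def)
  then have Jc: "is_category J" by (simp add: is_functor_def)
  have T: "is_functor ?T C (elements_proj e W)" by (rule is_functor_elements_proj[OF cat P e W z])
  have comp: "Comp ?T (e (b', c, g)) (e (a, b, f)) = e (a, c, Comp C g f)" for a b b' c f g
    by (simp add: elements_cat_def inv_f_f[OF e])
  have x_in: "x j \<in> ob_map P (ob_map D j)" if "j \<in> Obj J" for j
    using x that by (simp add: universal_elements_def compatible_elements_def)
  have x_arr: "act P (ar_map D u) (x j') = x j" if "u \<in> hom J j j'" for u j j'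
    using x that by (auto simp: universal_elements_def compatible_elements_def hom_def)
  \<comment> \<open>The lift of \<open>D\<close>: an object \<open>j\<close> goes to the index of
    the element \<open>x j\<close>, and compatibility of \<open>x\<close> makes \<open>D u\<close>
    an arrow of elements.\<close>
  define G :: "('v, 'v, 'v, 'v) cfunctor" where
    "G = \<lparr>ob_map = \<iota>, ar_map = (\<lambda>u. e (\<iota> (Dom J u), \<iota> (Cod J u), ar_map D u))\<rparr>"
  have G_ar: "ar_map G u = e (\<iota> j, \<iota> j', ar_map D u)" if "u \<in> hom J j j'" for u j j'
    using that by (auto simp: G_def hom_def)
  have G_ob: "ob_map G j = \<iota> j" for j by (simp add: G_def)
  have G: "is_functor J ?T G"
    unfolding is_functor_def
  proof (intro conjI ballI impI)
    show "is_category J" by (rule Jc)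
    show "is_category ?T" using T by (simp add: is_functor_def)
    show "ob_map G j \<in> Obj ?T" if "j \<in> Obj J" for j
      using \<iota>[OF that] by (simp add: G_ob elements_cat_def)
    show "ar_map G (Id J j) = Id ?T (ob_map G j)" if "j \<in> Obj J" for j
      using \<iota>[OF that] G_ar[OF id_in_hom[OF Jc that]] functor_id[OF D that]
      by (simp add: G_ob elements_cat_def)
  next
    fix u assume u: "u \<in> Arr J"
    note u' = arr_in_hom[OF u]
    show "ar_map G u \<in> hom ?T (ob_map G (Dom J u)) (ob_map G (Cod J u))"
      using G_ar[OF u'] functor_hom[OF D u'] x_arr[OF u'] \<iota> hom_objects[OF Jc u']
      by (auto simp: hom_elements_cat[OF e] G_ob)
    fix v assume v: "v \<in> Arr J" and vu: "Dom J v = Cod J u"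
    have v': "v \<in> hom J (Cod J u) (Cod J v)" using arr_in_hom[OF v] vu by simp
    show "ar_map G (Comp J v u) = Comp ?T (ar_map G v) (ar_map G u)"
      using G_ar[OF u'] G_ar[OF v'] G_ar[OF comp_in_hom[OF Jc u' v']] functor_comp[OF D u' v']
      by (simp add: comp)
  qed
  have "Obj (comma_cat J ?T G b) \<noteq> {} \<and> connected_category (comma_cat J ?T G b)"
    if b: "b \<in> Obj ?T" for b
  proof
    have bI: "b \<in> I" using b by (simp add: elements_cat_def)
    let ?K = "comma_cat J ?T G b"
    \<comment> \<open>The pairs satisfying \<open>good\<close> are the presentations of
      \<open>z b\<close> as a restriction of a generator; \<open>\<phi>\<close> matches them with
      the objects of the comma category.\<close>
    define \<phi> where "\<phi> = (\<lambda>(j, f). (j, e (b, \<iota> j, f)))"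
    define good where "good = (\<lambda>(j, f). j \<in> Obj J \<and> f \<in> hom C (W b) (ob_map D j) \<and> act P f (x j) = z b)"
    have obj: "Obj ?K = \<phi> ` {p. good p}"
      using \<iota> bI by (auto simp: set_eq_iff obj_comma_cat hom_elements_cat[OF e] G_ob \<phi>_def good_def)
    show "Obj ?K \<noteq> {}"
      using universal_elements_exhaust[OF U C x W[OF bI] z[OF bI]]
      unfolding obj good_def by fastforce
    \<comment> \<open>A step does not change the restricted element, so a zigzag of pairs that
      starts at a presentation of \<open>z b\<close> never leaves the comma category.\<close>
    have step: "(good p \<longleftrightarrow> good q) \<and> (good p \<longrightarrow> hom ?K (\<phi> p) (\<phi> q) \<noteq> {})"
      if pq: "generator_step C J D (W b) p q" for p q
    proof -
      obtain j f j' f' u where p: "p = (j, f)" and q: "q = (j', f')" and u: "u \<in> hom J j j'"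
        and f: "f \<in> hom C (W b) (ob_map D j)" and f': "f' = Comp C (ar_map D u) f"
        using pq by (auto simp: generator_step_def)
      have ob: "j \<in> Obj J" "j' \<in> Obj J" using hom_objects[OF Jc u] by auto
      note Du = functor_hom[OF D u]
      have f'h: "f' \<in> hom C (W b) (ob_map D j')" using comp_in_hom[OF cat f Du] f' by simp
      have act: "act P f' (x j') = act P f (x j)"
        using act_comp[OF P f Du x_in[OF ob(2)]] x_arr[OF u] f' by simp
      have "hom ?K (\<phi> p) (\<phi> q) \<noteq> {}" if "act P f (x j) = z b"
        using that ob \<iota> bI f f'h act u G_ar[OF u] f'
        by (auto simp: p q \<phi>_def hom_comma_cat_nonempty[of J ?T G] hom_elements_cat[OF e] G_ob comp
            intro!: bexI[OF _ u])
      then show ?thesis using ob f f'h act by (simp add: p q good_def)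
    qed
    show "connected_category ?K"
      unfolding connected_category_def obj
    proof (intro ballI)
      fix X Y assume "X \<in> \<phi> ` {p. good p}" "Y \<in> \<phi> ` {p. good p}"
      then obtain p q where p: "good p" "X = \<phi> p" and q: "good q" "Y = \<phi> q" by auto
      have "equivclp (generator_step C J D (W b)) p q"
        using p(1) q(1) universal_elements_eq_imp[OF U C D x] by (auto simp: good_def)
      then have "good q \<and> equivclp (\<lambda>X Y. hom ?K X Y \<noteq> {}) (\<phi> p) (\<phi> q)"
      proof (induction rule: equivclp_induct)
        case base
        show ?case using p(1) by simp
      next
        case (step q r)
        then have "good r \<and> (hom ?K (\<phi> q) (\<phi> r) \<noteq> {} \<or> hom ?K (\<phi> r) (\<phi> q) \<noteq> {})"
          using \<open>\<And>q p. generator_step C J D (W b) p q \<Longrightarrow> _\<close> by blast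
        then show ?case using step.IH equivclp_into_equivclp[of _ "\<phi> p" "\<phi> q" "\<phi> r"] by simp
      qed
      then show "equivclp (\<lambda>X Y. hom ?K X Y \<noteq> {}) X Y" using p(2) q(2) by simp
    qed
  qed
  then have "confinal J ?T G" using G by (simp add: confinal_def)
  moreover have "slice_arrow C (J, D) (?T, elements_proj e W) G"
    using J small_elements_cat[OF U C P e I W z] G \<iota>
    by (auto simp: slice_arrow_def elements_proj_def G_def inv_f_f[OF e])
  ultimately show ?thesis unfolding confinal_arrow_def by auto
qed

text \<open>Both diagrams are lifted to elements of the same \<open>P\<close>; the objects of the
  middle category are the elements hit by either lift, a small set as both index categories are
  small.\<close>

lemma iso_image_presheaves_confinal_zigzag:
  fixes C J K :: "('v, 'v) category"
  assumes U: "inaccessible TYPE('v)" and C: "locally_small C"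
    and J: "small_diagram C (J, D)" and K: "small_diagram C (K, E)"
    and iso: "iso_objects (presheaf_cat C) (image_presheaf J C D) (image_presheaf K C E)"
  shows "confinal_zigzag C (J, D) (K, E)"
proof -
  have cat: "is_category C" using C by (simp add: locally_small_def)
  have D: "is_functor J C D" "small_category J" and E: "is_functor K C E" "small_category K"
    using J K by (simp_all add: small_diagram_def)
  define P where "P = image_presheaf J C D"
  have "is_colimit_object J (presheaf_cat C) (yoneda C \<circ>\<^sub>F D) P"
    unfolding P_def by (rule is_colimit_image_presheaf[OF U C D(2,1)])
  then obtain x where x: "universal_elements C J D P x"
    using colimit_universal_elements[OF C D(1)] by blast
  have "is_colimit_object K (presheaf_cat C) (yoneda C \<circ>\<^sub>F E) P"
    unfolding P_def
    using is_colimit_object_iso[OF is_category_presheaf_cat[OF cat]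
        is_functor_comp[OF E(1) is_functor_yoneda[OF C]]
        is_colimit_image_presheaf[OF U C E(2,1)] iso_objects_sym[OF iso]] .
  then obtain y where y: "universal_elements C K E P y"
    using colimit_universal_elements[OF C E(1)] by blast
  obtain p :: "'v \<times> 'v \<Rightarrow> 'v" where p: "inj p"
    using obtain_pairing[OF infinite_UNIV_inaccessible[OF U]] .
  obtain e :: "'v \<times> 'v \<times> 'v \<Rightarrow> 'v" where e: "inj e"
    using obtain_triple_encoding[OF infinite_UNIV_inaccessible[OF U]] .
  \<comment> \<open>The object is coded along with the element, since one value of \<open>'v\<close>
    may be an element of \<open>P\<close> at several objects. Indices with the same pair share an
    object of the middle category.\<close>
  define \<iota> where "\<iota> j = p (ob_map D j, x j)" for j
  define \<iota>' where "\<iota>' k = p (ob_map E k, y k)" for k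
  define I where "I = \<iota> ` Obj J \<union> \<iota>' ` Obj K"
  define W where "W a = fst (inv p a)" for a
  define z where "z a = snd (inv p a)" for a
  have "small I"
  proof -
    have "|\<iota> ` Obj J| <o |UNIV :: 'v set|" "|\<iota>' ` Obj K| <o |UNIV :: 'v set|"
      using D(2) E(2) card_of_image ordLeq_ordLess_trans
      unfolding small_category_def small_def by blast+
    then show ?thesis
      unfolding small_def I_def
      by (rule card_of_Un_ordLess_infinite[OF infinite_UNIV_inaccessible[OF U]])
  qed
  moreover have \<iota>: "\<iota> j \<in> I \<and> W (\<iota> j) = ob_map D j \<and> z (\<iota> j) = x j" if "j \<in> Obj J" for j
    using that by (simp add: I_def W_def z_def \<iota>_def inv_f_f[OF p])
  moreover have \<iota>': "\<iota>' k \<in> I \<and> W (\<iota>' k) = ob_map E k \<and> z (\<iota>' k) = y k" if "k \<in> Obj K" for k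
    using that by (simp add: I_def W_def z_def \<iota>'_def inv_f_f[OF p])
  moreover have "W a \<in> Obj C \<and> z a \<in> ob_map P (W a)" if "a \<in> I" for a
  proof -
    from that consider j where "j \<in> Obj J" "a = \<iota> j" | k where "k \<in> Obj K" "a = \<iota>' k"
      unfolding I_def by blast
    then show ?thesis
      using \<iota> \<iota>' functor_obj[OF D(1)] functor_obj[OF E(1)] x y
      by cases (auto simp: universal_elements_def compatible_elements_def)
  qed
  ultimately have
    "confinal_arrow C (J, D) (elements_cat C P e I W z, elements_proj e W)"
    "confinal_arrow C (K, E) (elements_cat C P e I W z, elements_proj e W)"
    using elements_cat_confinal_arrow[OF U C J x e, of I W z \<iota>]
      elements_cat_confinal_arrow[OF U C K y e, of I W z \<iota>'] by blast+
  then show ?thesis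
    unfolding confinal_zigzag_def
    by (meson equivclp_sym equivclp_trans r_into_equivclp)
qed


section \<open>Encoding categories of presheaves\<close>

text \<open>\<open>\<Phi>\<close> is an isomorphism onto \<open>L\<close> from the full subcategory of \<open>M\<close> on \<open>S\<close>.\<close>

definition full_subcategory_iso ::
  "('o, 'm) category \<Rightarrow> 'o set \<Rightarrow> ('p, 'n) category \<Rightarrow> ('o, 'm, 'p, 'n) cfunctor \<Rightarrow> bool" where
  "full_subcategory_iso M S L \<Phi> \<longleftrightarrow> is_category M \<and> is_category L \<and> S \<subseteq> Obj M \<and>
     bij_betw (ob_map \<Phi>) S (Obj L) \<and>
     (\<forall>X\<in>S. \<forall>Y\<in>S. bij_betw (ar_map \<Phi>) (hom M X Y) (hom L (ob_map \<Phi> X) (ob_map \<Phi> Y))) \<and>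
     (\<forall>X\<in>S. ar_map \<Phi> (Id M X) = Id L (ob_map \<Phi> X)) \<and>
     (\<forall>X\<in>S. \<forall>Y\<in>S. \<forall>Z\<in>S. \<forall>f\<in>hom M X Y. \<forall>g\<in>hom M Y Z.
        ar_map \<Phi> (Comp M g f) = Comp L (ar_map \<Phi> g) (ar_map \<Phi> f))"

lemma full_subcategory_iso_hom:
  "\<lbrakk>full_subcategory_iso M S L \<Phi>; X \<in> S; Y \<in> S\<rbrakk> \<Longrightarrow>
    hom L (ob_map \<Phi> X) (ob_map \<Phi> Y) = ar_map \<Phi> ` hom M X Y"
  by (simp add: full_subcategory_iso_def bij_betw_def)

lemma full_subcategory_iso_eq:
  "\<lbrakk>full_subcategory_iso M S L \<Phi>; X \<in> S; Y \<in> S; f \<in> hom M X Y; g \<in> hom M X Y;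
    ar_map \<Phi> f = ar_map \<Phi> g\<rbrakk> \<Longrightarrow> f = g"
  unfolding full_subcategory_iso_def bij_betw_def by (meson inj_onD)

lemma full_subcategory_iso_comp:
  "\<lbrakk>full_subcategory_iso M S L \<Phi>; X \<in> S; Y \<in> S; Z \<in> S; f \<in> hom M X Y; g \<in> hom M Y Z\<rbrakk> \<Longrightarrow>
    Comp L (ar_map \<Phi> g) (ar_map \<Phi> f) = ar_map \<Phi> (Comp M g f)"
  unfolding full_subcategory_iso_def by auto

lemma full_subcategory_iso_id:
  "\<lbrakk>full_subcategory_iso M S L \<Phi>; X \<in> S\<rbrakk> \<Longrightarrow> Id L (ob_map \<Phi> X) = ar_map \<Phi> (Id M X)"
  unfolding full_subcategory_iso_def by auto

lemma full_subcategory_iso_obj: "full_subcategory_iso M S L \<Phi> \<Longrightarrow> Obj L = ob_map \<Phi> ` S"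
  by (simp add: full_subcategory_iso_def bij_betw_def)

text \<open>Needed because \<open>same_colimits\<close> quantifies over categories inside
  \<open>'v\<close>, whereas presheaves and their maps have other types.\<close>

lemma obtain_full_subcategory_iso:
  fixes M :: "('o, 'm) category"
  assumes inf: "infinite (UNIV :: 'v set)" and M: "is_category M" and S: "S \<subseteq> Obj M"
    and card_S: "|S| \<le>o |UNIV :: 'v set|"
    and card_hom: "\<And>X Y. \<lbrakk>X \<in> S; Y \<in> S\<rbrakk> \<Longrightarrow> |hom M X Y| <o |UNIV :: 'v set|"
  obtains L :: "('v, 'v) category" and \<Phi> where "locally_small L" "full_subcategory_iso M S L \<Phi>"
proof -
  \<comment> \<open>One injection codes all hom-sets at once, so that a code determines its domain
    and codomain; the union is still at most as large as \<open>'v\<close>.\<close>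
  define A where "A = (\<Union>X\<in>S. \<Union>Y\<in>S. hom M X Y)"
  have "|A| \<le>o |UNIV :: 'v set|"
    unfolding A_def using card_hom
    by (intro card_of_UNION_ordLeq_infinite[OF inf card_S] ballI) (simp add: ordLess_imp_ordLeq)
  then obtain e :: "'m \<Rightarrow> 'v" where e: "inj_on e A"
    unfolding card_of_ordLeq[symmetric] by blast
  obtain i :: "'o \<Rightarrow> 'v" where i: "inj_on i S"
    using card_S unfolding card_of_ordLeq[symmetric] by blast
  let ?d = "inv_into A e" and ?b = "inv_into S i"
  have d: "?d (e f) = f" if "f \<in> hom M X Y" "X \<in> S" "Y \<in> S" for f X Y
    using that inv_into_f_f[OF e] by (auto simp: A_def)
  have b: "?b (i X) = X" if "X \<in> S" for X using that inv_into_f_f[OF i] by simp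
  define L :: "('v, 'v) category" where
    "L = \<lparr>Obj = i ` S, Arr = e ` A, Dom = (\<lambda>m. i (Dom M (?d m))), Cod = (\<lambda>m. i (Cod M (?d m))),
          Id = (\<lambda>a. e (Id M (?b a))), Comp = (\<lambda>n m. e (Comp M (?d n) (?d m)))\<rparr>"
  have dom: "Dom L (e f) = i X" "Cod L (e f) = i Y" if "f \<in> hom M X Y" "X \<in> S" "Y \<in> S" for f X Y
    using d[OF that] that by (auto simp: L_def hom_def)
  have arr: "\<exists>X\<in>S. \<exists>Y\<in>S. \<exists>f\<in>hom M X Y. m = e f" if "m \<in> Arr L" for m
    using that by (auto simp: L_def A_def)
  have arr': "e f \<in> Arr L" if "f \<in> hom M X Y" "X \<in> S" "Y \<in> S" for f X Y
    using that by (auto simp: L_def A_def)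
  have comp: "Comp L (e g) (e f) = e (Comp M g f)"
    if "f \<in> hom M X Y" "g \<in> hom M Y Z" "X \<in> S" "Y \<in> S" "Z \<in> S" for f g X Y Z
    using d[OF that(1,3,4)] d[OF that(2,4,5)] by (simp add: L_def)
  have id: "Id L (i X) = e (Id M X)" if "X \<in> S" for X using b[OF that] by (simp add: L_def)
  have hom: "hom L (i X) (i Y) = e ` hom M X Y" if XY: "X \<in> S" "Y \<in> S" for X Y
  proof
    show "e ` hom M X Y \<subseteq> hom L (i X) (i Y)"
      using arr'[OF _ XY] dom[OF _ XY] by (auto simp: hom_def[of L])
    show "hom L (i X) (i Y) \<subseteq> e ` hom M X Y"
    proof
      fix m assume "m \<in> hom L (i X) (i Y)"
      then have m: "m \<in> Arr L" "Dom L m = i X" "Cod L m = i Y" by (auto simp: hom_def)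
      then obtain X' Y' f where f: "X' \<in> S" "Y' \<in> S" "f \<in> hom M X' Y'" "m = e f" using arr by blast
      then have "X' = X" "Y' = Y" using m dom[OF f(3,1,2)] inj_onD[OF i] XY by auto
      then show "m \<in> e ` hom M X Y" using f by auto
    qed
  qed
  have L: "is_category L"
    unfolding is_category_def
  proof (intro conjI ballI impI)
    show "Dom L m \<in> Obj L" "Cod L m \<in> Obj L" if "m \<in> Arr L" for m
      using arr[OF that] dom by (auto simp: L_def[THEN arg_cong, of Obj])
    show "Id L a \<in> hom L a a" if "a \<in> Obj L" for a
      using that id hom id_in_hom[OF M] S by (auto simp: L_def[THEN arg_cong, of Obj])
  next
    fix m n assume m: "m \<in> Arr L" and n: "n \<in> Arr L" and eq: "Dom L n = Cod L m"
    obtain X Y f where f: "X \<in> S" "Y \<in> S" "f \<in> hom M X Y" "m = e f" using arr[OF m] by blast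
    obtain Y' Z g where g: "Y' \<in> S" "Z \<in> S" "g \<in> hom M Y' Z" "n = e g" using arr[OF n] by blast
    have [simp]: "Y' = Y"
      using eq dom[OF f(3,1,2)] dom[OF g(3,1,2)] inj_onD[OF i] f g by auto
    have g': "g \<in> hom M Y Z" using g by simp
    show "Comp L n m \<in> hom L (Dom L m) (Cod L n)"
      using comp[OF f(3) g' f(1,2) g(2)] dom[OF f(3,1,2)] dom[OF g(3,1,2)] hom[OF f(1) g(2)]
        comp_in_hom[OF M f(3) g'] f(4) g(4) by simp
  next
    fix m assume m: "m \<in> Arr L"
    obtain X Y f where f: "X \<in> S" "Y \<in> S" "f \<in> hom M X Y" "m = e f" using arr[OF m] by blast
    have ids: "Id M X \<in> hom M X X" "Id M Y \<in> hom M Y Y" using id_in_hom[OF M] f(1,2) S by auto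
    show "Comp L m (Id L (Dom L m)) = m" "Comp L (Id L (Cod L m)) m = m"
      using comp[OF ids(1) f(3)] comp[OF f(3) ids(2)] dom[OF f(3,1,2)] id f
        comp_id_left[OF M f(3)] comp_id_right[OF M f(3)] by simp_all
  next
    fix m n k assume m: "m \<in> Arr L" and n: "n \<in> Arr L" and k: "k \<in> Arr L"
      and eq: "Dom L n = Cod L m" "Dom L k = Cod L n"
    obtain X Y f where f: "X \<in> S" "Y \<in> S" "f \<in> hom M X Y" "m = e f" using arr[OF m] by blast
    obtain Y' Z g where g: "Y' \<in> S" "Z \<in> S" "g \<in> hom M Y' Z" "n = e g" using arr[OF n] by blast
    obtain Z' V h where h: "Z' \<in> S" "V \<in> S" "h \<in> hom M Z' V" "k = e h" using arr[OF k] by blast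
    have [simp]: "Y' = Y"
      using eq(1) dom[OF f(3,1,2)] dom[OF g(3,1,2)] inj_onD[OF i] f g by auto
    have [simp]: "Z' = Z"
      using eq(2) dom[OF g(3,1,2)] dom[OF h(3,1,2)] inj_onD[OF i] g h by auto
    have g': "g \<in> hom M Y Z" and h': "h \<in> hom M Z V" using g h by simp_all
    show "Comp L k (Comp L n m) = Comp L (Comp L k n) m"
      using comp[OF f(3) g' f(1,2) g(2)] comp[OF g' h' f(2) g(2) h(2)]
        comp[OF comp_in_hom[OF M f(3) g'] h' f(1) g(2) h(2)]
        comp[OF f(3) comp_in_hom[OF M g' h'] f(1,2) h(2)]
        category_comp_assoc[OF M f(3) g' h'] f(4) g(4) h(4) by simp
  qed
  have "|hom L (i X) (i Y)| <o |UNIV :: 'v set|" if "X \<in> S" "Y \<in> S" for X Y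
    unfolding hom[OF that] using card_of_image card_hom[OF that] ordLeq_ordLess_trans by blast
  then have "locally_small L"
    using L by (auto simp: locally_small_def small_def L_def[THEN arg_cong, of Obj])
  moreover have "full_subcategory_iso M S L \<lparr>ob_map = i, ar_map = e\<rparr>"
  proof -
    have "inj_on e (hom M X Y)" if "X \<in> S" "Y \<in> S" for X Y
      using that by (intro inj_on_subset[OF e]) (auto simp: A_def)
    moreover have "Obj L = i ` S" by (simp add: L_def)
    ultimately show ?thesis
      using M L S i hom id comp by (auto simp: full_subcategory_iso_def bij_betw_def)
  qed
  ultimately show ?thesis by (rule that)
qed

lemma is_functor_full_subcategory_iso:
  assumes \<Phi>: "full_subcategory_iso M S L \<Phi>" and F: "is_functor A M F"
    and FS: "\<And>X. X \<in> Obj A \<Longrightarrow> ob_map F X \<in> S"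
  shows "is_functor A L (\<Phi> \<circ>\<^sub>F F)"
proof -
  have A: "is_category A" using F by (simp add: is_functor_def)
  show ?thesis
    unfolding is_functor_def
  proof (intro conjI ballI impI)
    show "is_category A" by (rule A)
    show "is_category L" using \<Phi> by (simp add: full_subcategory_iso_def)
    show "ob_map (\<Phi> \<circ>\<^sub>F F) X \<in> Obj L" if "X \<in> Obj A" for X
      using FS[OF that] full_subcategory_iso_obj[OF \<Phi>] by simp
    show "ar_map (\<Phi> \<circ>\<^sub>F F) (Id A X) = Id L (ob_map (\<Phi> \<circ>\<^sub>F F) X)" if "X \<in> Obj A" for X
      using full_subcategory_iso_id[OF \<Phi> FS[OF that]] functor_id[OF F that] by simp
  next
    fix f assume f: "f \<in> Arr A"
    note f' = arr_in_hom[OF f]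
    have ob: "Dom A f \<in> Obj A" "Cod A f \<in> Obj A" using hom_objects[OF A f'] by auto
    show "ar_map (\<Phi> \<circ>\<^sub>F F) f \<in> hom L (ob_map (\<Phi> \<circ>\<^sub>F F) (Dom A f)) (ob_map (\<Phi> \<circ>\<^sub>F F) (Cod A f))"
      using full_subcategory_iso_hom[OF \<Phi> FS[OF ob(1)] FS[OF ob(2)]] functor_hom[OF F f'] by simp
    fix g assume g: "g \<in> Arr A" and gf: "Dom A g = Cod A f"
    have g': "g \<in> hom A (Cod A f) (Cod A g)" using arr_in_hom[OF g] gf by simp
    show "ar_map (\<Phi> \<circ>\<^sub>F F) (Comp A g f) = Comp L (ar_map (\<Phi> \<circ>\<^sub>F F) g) (ar_map (\<Phi> \<circ>\<^sub>F F) f)"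
      using full_subcategory_iso_comp[OF \<Phi> FS FS FS functor_hom[OF F f'] functor_hom[OF F g']]
        functor_comp[OF F f' g'] ob hom_objects[OF A g'] by simp
  qed
qed

text \<open>A cocone in the full subcategory is a cocone in \<open>M\<close> whose vertex lies in
  \<open>S\<close>, and the mediating arrow exists there by fullness. So a colimit whose vertex is
  in \<open>S\<close> stays a colimit.\<close>

lemma full_subcategory_iso_colimit:
  assumes \<Phi>: "full_subcategory_iso M S L \<Phi>" and D: "is_functor J M D"
    and DS: "\<And>j. j \<in> Obj J \<Longrightarrow> ob_map D j \<in> S" and X: "X \<in> S"
    and col: "is_colimit_object J M D X"
  shows "is_colimit_object J L (\<Phi> \<circ>\<^sub>F D) (ob_map \<Phi> X)"
proof -
  have M: "is_category M" and S: "S \<subseteq> Obj M" using \<Phi> by (simp_all add: full_subcategory_iso_def)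
  have J: "is_category J" using D by (simp add: is_functor_def)
  obtain \<kappa> where \<kappa>: "is_colimit J M D X \<kappa>" using col unfolding is_colimit_object_def by auto
  then have cc: "cocone J M D X \<kappa>" unfolding is_colimit_def by auto
  note hom = full_subcategory_iso_hom[OF \<Phi>] and comp = full_subcategory_iso_comp[OF \<Phi>]
    and inj = full_subcategory_iso_eq[OF \<Phi>]
  have "is_colimit J L (\<Phi> \<circ>\<^sub>F D) (ob_map \<Phi> X) (\<lambda>j. ar_map \<Phi> (\<kappa> j))"
    unfolding is_colimit_def
  proof (intro conjI allI impI)
    show "cocone J L (\<Phi> \<circ>\<^sub>F D) (ob_map \<Phi> X) (\<lambda>j. ar_map \<Phi> (\<kappa> j))"
      unfolding cocone_def
    proof (intro conjI ballI)
      show "ob_map \<Phi> X \<in> Obj L" using X full_subcategory_iso_obj[OF \<Phi>] by simp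
      show "ar_map \<Phi> (\<kappa> j) \<in> hom L (ob_map (\<Phi> \<circ>\<^sub>F D) j) (ob_map \<Phi> X)" if "j \<in> Obj J" for j
        using hom[OF DS[OF that] X] cocone_hom[OF cc that] by simp
      fix u assume u: "u \<in> Arr J"
      note u' = arr_in_hom[OF u]
      have ob: "Dom J u \<in> Obj J" "Cod J u \<in> Obj J" using hom_objects[OF J u'] by auto
      show "Comp L (ar_map \<Phi> (\<kappa> (Cod J u))) (ar_map (\<Phi> \<circ>\<^sub>F D) u) = ar_map \<Phi> (\<kappa> (Dom J u))"
        using comp[OF DS[OF ob(1)] DS[OF ob(2)] X functor_hom[OF D u'] cocone_hom[OF cc ob(2)]]
          cocone_arr[OF cc u'] by simp
    qed
    fix Y' \<mu>' assume \<mu>': "cocone J L (\<Phi> \<circ>\<^sub>F D) Y' \<mu>'"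
    then obtain Y where Y: "Y \<in> S" and Y': "Y' = ob_map \<Phi> Y"
      unfolding cocone_def full_subcategory_iso_obj[OF \<Phi>] by auto
    have "\<exists>m. m \<in> hom M (ob_map D j) Y \<and> \<mu>' j = ar_map \<Phi> m" if "j \<in> Obj J" for j
      using cocone_hom[OF \<mu>' that] hom[OF DS[OF that] Y] Y' by auto
    then obtain \<mu> where \<mu>: "\<mu> j \<in> hom M (ob_map D j) Y" "\<mu>' j = ar_map \<Phi> (\<mu> j)" if "j \<in> Obj J" for j
      by metis
    have "cocone J M D Y \<mu>"
      unfolding cocone_def
    proof (intro conjI ballI)
      show "Y \<in> Obj M" using Y S by blast
      show "\<mu> j \<in> hom M (ob_map D j) Y" if "j \<in> Obj J" for j using \<mu>(1)[OF that] .
      fix u assume u: "u \<in> Arr J"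
      note u' = arr_in_hom[OF u]
      have ob: "Dom J u \<in> Obj J" "Cod J u \<in> Obj J" using hom_objects[OF J u'] by auto
      show "Comp M (\<mu> (Cod J u)) (ar_map D u) = \<mu> (Dom J u)"
        using inj[OF DS[OF ob(1)] Y comp_in_hom[OF M functor_hom[OF D u'] \<mu>(1)[OF ob(2)]] \<mu>(1)[OF ob(1)]]
          comp[OF DS[OF ob(1)] DS[OF ob(2)] Y functor_hom[OF D u'] \<mu>(1)[OF ob(2)]]
          cocone_arr[OF \<mu>' u'] \<mu>(2) ob by simp
    qed
    then obtain h where h: "h \<in> hom M X Y" "\<forall>j\<in>Obj J. Comp M h (\<kappa> j) = \<mu> j"
      and uniq: "\<And>h'. h' \<in> hom M X Y \<Longrightarrow> \<forall>j\<in>Obj J. Comp M h' (\<kappa> j) = \<mu> j \<Longrightarrow> h' = h"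
      using \<kappa> unfolding is_colimit_def by metis
    have \<Phi>_comp: "Comp L (ar_map \<Phi> k) (ar_map \<Phi> (\<kappa> j)) = \<mu>' j \<longleftrightarrow> Comp M k (\<kappa> j) = \<mu> j"
      if k: "k \<in> hom M X Y" and j: "j \<in> Obj J" for k j
      using comp[OF DS[OF j] X Y cocone_hom[OF cc j] k] \<mu>[OF j]
        inj[OF DS[OF j] Y comp_in_hom[OF M cocone_hom[OF cc j] k] \<mu>(1)[OF j]] by auto
    show "\<exists>!h. h \<in> hom L (ob_map \<Phi> X) Y' \<and> (\<forall>j\<in>Obj J. Comp L h (ar_map \<Phi> (\<kappa> j)) = \<mu>' j)"
    proof (rule ex1I[of _ "ar_map \<Phi> h"])
      show "ar_map \<Phi> h \<in> hom L (ob_map \<Phi> X) Y' \<and>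
          (\<forall>j\<in>Obj J. Comp L (ar_map \<Phi> h) (ar_map \<Phi> (\<kappa> j)) = \<mu>' j)"
        using h hom[OF X Y] \<Phi>_comp Y' by simp
      fix k' assume k': "k' \<in> hom L (ob_map \<Phi> X) Y' \<and> (\<forall>j\<in>Obj J. Comp L k' (ar_map \<Phi> (\<kappa> j)) = \<mu>' j)"
      then obtain k where "k \<in> hom M X Y" "k' = ar_map \<Phi> k" using hom[OF X Y] Y' by auto
      then show "k' = ar_map \<Phi> h" using uniq[of k] \<Phi>_comp k' by simp
    qed
  qed
  then show ?thesis unfolding is_colimit_object_def by blast
qed

lemma full_subcategory_iso_reflects_iso:
  assumes \<Phi>: "full_subcategory_iso M S L \<Phi>" and X: "X \<in> S" and Y: "Y \<in> S"
    and iso: "iso_objects L (ob_map \<Phi> X) (ob_map \<Phi> Y)"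
  shows "iso_objects M X Y"
proof -
  have M: "is_category M" and S: "S \<subseteq> Obj M" using \<Phi> by (simp_all add: full_subcategory_iso_def)
  obtain f g where f: "f \<in> hom M X Y" and g: "g \<in> hom M Y X"
    and gf: "Comp L (ar_map \<Phi> g) (ar_map \<Phi> f) = Id L (ob_map \<Phi> X)"
    and fg: "Comp L (ar_map \<Phi> f) (ar_map \<Phi> g) = Id L (ob_map \<Phi> Y)"
    using iso full_subcategory_iso_hom[OF \<Phi> X Y] full_subcategory_iso_hom[OF \<Phi> Y X]
    unfolding iso_objects_def by auto
  have XY: "X \<in> Obj M" "Y \<in> Obj M" using X Y S by auto
  have "Comp M g f = Id M X"
    using full_subcategory_iso_eq[OF \<Phi> X X comp_in_hom[OF M f g] id_in_hom[OF M XY(1)]]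
      full_subcategory_iso_comp[OF \<Phi> X Y X f g] full_subcategory_iso_id[OF \<Phi> X] gf by simp
  moreover have "Comp M f g = Id M Y"
    using full_subcategory_iso_eq[OF \<Phi> Y Y comp_in_hom[OF M g f] id_in_hom[OF M XY(2)]]
      full_subcategory_iso_comp[OF \<Phi> Y X Y g f] full_subcategory_iso_id[OF \<Phi> Y] fg by simp
  ultimately show ?thesis using f g XY unfolding iso_objects_def by blast
qed

lemma comp_functor_assoc: "(H \<circ>\<^sub>F G) \<circ>\<^sub>F F = H \<circ>\<^sub>F (G \<circ>\<^sub>F F)"
  by (simp add: comp_functor_def o_assoc)

text \<open>
  The test category is the full subcategory of presheaves on the representables and the two image
  presheaves. It is locally small because each of these presheaves has a small generating family.
\<close>

lemma same_colimits_iso_image_presheaves: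
  fixes C J K :: "('v, 'v) category"
  assumes U: "inaccessible TYPE('v)" and C: "locally_small C"
    and J: "small_diagram C (J, D)" and K: "small_diagram C (K, E)"
    and same: "same_colimits C (J, D) (K, E)"
  shows "iso_objects (presheaf_cat C) (image_presheaf J C D) (image_presheaf K C E)"
proof -
  let ?M = "presheaf_cat C" and ?D = "yoneda C \<circ>\<^sub>F D" and ?E = "yoneda C \<circ>\<^sub>F E"
  let ?ID = "image_presheaf J C D" and ?IE = "image_presheaf K C E"
  have inf: "infinite (UNIV :: 'v set)" by (rule infinite_UNIV_inaccessible[OF U])
  have cat: "is_category C" using C by (simp add: locally_small_def)
  have M: "is_category ?M" using is_category_presheaf_cat[OF cat] .
  have D: "is_functor J C D" "small_category J" and E: "is_functor K C E" "small_category K"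
    using J K by (simp_all add: small_diagram_def)
  have Y: "is_functor C ?M (yoneda C)" by (rule is_functor_yoneda[OF C])
  have YD: "is_functor J ?M ?D" and YE: "is_functor K ?M ?E"
    using is_functor_comp[OF D(1) Y] is_functor_comp[OF E(1) Y] .
  have colD: "is_colimit_object J ?M ?D ?ID" and colE: "is_colimit_object K ?M ?E ?IE"
    using is_colimit_image_presheaf[OF U C D(2,1)] is_colimit_image_presheaf[OF U C E(2,1)] .
  obtain x where x: "universal_elements C J D ?ID x"
    using colimit_universal_elements[OF C D(1) colD] by blast
  obtain y where y: "universal_elements C K E ?IE y"
    using colimit_universal_elements[OF C E(1) colE] by blast
  define S where "S = representable C ` Obj C \<union> {?ID, ?IE}"
  have S: "S \<subseteq> Obj ?M"
    using representable_obj[OF C] x y by (auto simp: S_def universal_elements_def)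
  have "|{?ID, ?IE}| \<le>o |UNIV :: 'v set|"
    by (rule ordLess_imp_ordLeq, rule finite_ordLess_UNIV[OF inf]) simp
  \<comment> \<open>Objects of \<open>C\<close> lie in \<open>'v\<close>, so there are at most as
    many representables as elements of \<open>'v\<close>.\<close>
  then have card_S: "|S| \<le>o |UNIV :: 'v set|"
    unfolding S_def
    by (intro card_of_Un_ordLeq_infinite_Field ordLeq_transitive[OF card_of_image card_of_mono1])
      (auto simp: Field_card_of inf card_of_card_order_on)
  have small_gen: "\<exists>(I :: 'v set) W z. |I| <o |UNIV :: 'v set| \<and> generates C P I W z" if P: "P \<in> S" for P
  proof -
    consider X where "X \<in> Obj C" "P = representable C X" | "P = ?ID" | "P = ?IE"
      using P unfolding S_def by blast
    then show ?thesis
    proof cases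
      case 1
      \<comment> \<open>By Yoneda a representable has a single generator, its identity;
        \<open>undefined\<close> is merely an arbitrary index for it.\<close>
      have "|{undefined :: 'v}| <o |UNIV :: 'v set|"
        by (rule finite_ordLess_UNIV[OF inf]) simp
      then show ?thesis
        using generates_representable[OF C 1(1), of "undefined :: 'v"] unfolding 1(2)
        by (intro exI conjI)
    next
      case 2
      have "|Obj J| <o |UNIV :: 'v set|" using D(2) by (simp add: small_category_def small_def)
      moreover have "generates C P (Obj J) (ob_map D) x"
        using x by (simp add: universal_elements_def 2)
      ultimately show ?thesis by (intro exI conjI)
    next
      case 3
      have "|Obj K| <o |UNIV :: 'v set|" using E(2) by (simp add: small_category_def small_def)
      moreover have "generates C P (Obj K) (ob_map E) y"
        using y by (simp add: universal_elements_def 3)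
      ultimately show ?thesis by (intro exI conjI)
    qed
  qed
  have "|hom ?M P Q| <o |UNIV :: 'v set|" if P: "P \<in> S" and Q: "Q \<in> S" for P Q
  proof -
    obtain I :: "'v set" and W z where "|I| <o |UNIV :: 'v set|" "generates C P I W z"
      using small_gen[OF P] by (elim exE conjE)
    then show ?thesis using card_hom_presheaf_cat[OF U] Q S by blast
  qed
  then obtain L :: "('v, 'v) category" and \<Phi> where
    L: "locally_small L" and \<Phi>: "full_subcategory_iso ?M S L \<Phi>"
    using obtain_full_subcategory_iso[OF inf M S card_S] by blast
  have rep: "ob_map (yoneda C) X \<in> S" if "X \<in> Obj C" for X
    using that by (simp add: S_def ob_map_yoneda)
  have IS: "?ID \<in> S" "?IE \<in> S" by (simp_all add: S_def)
  have F: "is_functor C L (\<Phi> \<circ>\<^sub>F yoneda C)" by (rule is_functor_full_subcategory_iso[OF \<Phi> Y rep])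
  have "is_colimit_object J L (\<Phi> \<circ>\<^sub>F ?D) (ob_map \<Phi> ?ID)"
    using full_subcategory_iso_colimit[OF \<Phi> YD _ IS(1) colD] rep functor_obj[OF D(1)] by simp
  moreover have "is_colimit_object K L (\<Phi> \<circ>\<^sub>F ?E) (ob_map \<Phi> ?IE)"
    using full_subcategory_iso_colimit[OF \<Phi> YE _ IS(2) colE] rep functor_obj[OF E(1)] by simp
  \<comment> \<open>Condition (2) is applied to the coded Yoneda embedding
    \<open>\<Phi> \<circ>\<^sub>F yoneda C\<close>; reassociation exhibits the two coded diagrams as
    its composites with \<open>D\<close> and \<open>E\<close>.\<close>
  ultimately have "iso_objects L (ob_map \<Phi> ?ID) (ob_map \<Phi> ?IE)"
    using same L F unfolding same_colimits_def comp_functor_assoc[symmetric] by blast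
  then show ?thesis by (rule full_subcategory_iso_reflects_iso[OF \<Phi> IS])
qed


theorem proposition3p9:
  fixes C J K :: "('v, 'v) category"
    and D E :: "('v, 'v, 'v, 'v) cfunctor"
  assumes "inaccessible TYPE('v)"
    and "locally_small C"
    and "small_diagram C (J, D)"
    and "small_diagram C (K, E)"
  shows "(iso_objects (presheaf_cat C) (image_presheaf J C D) (image_presheaf K C E) \<longleftrightarrow>
            same_colimits C (J, D) (K, E)) \<and>
         (same_colimits C (J, D) (K, E) \<longleftrightarrow> confinal_zigzag C (J, D) (K, E))"
proof -
  have "same_colimits C (J, D) (K, E)" if "confinal_zigzag C (J, D) (K, E)"
    using confinal_zigzag_same_colimits[OF that] .
  then show ?thesis
    using iso_image_presheaves_confinal_zigzag[OF assms] same_colimits_iso_image_presheaves[OF assms]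
    by blast
qed

end
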